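(* Let $(k,|\cdot|)$ be a complete and separable valued field, let $\mathbf{G}$ be a $k$-algebraic group with a $k$-action on a $k$-variety $\mathbf{V}$, and let $G=\mathbf{G}(k)$. Fix a closed subgroup $L<G$ and let $\mu$ be an $L$-invariant weakly mixing probability measure on $V=\mathbf{V}(k)$. Then there exists a point $x\in V^L$ such that $\mu=\delta_x$.
   Context: A valued field $(k,|\cdot|)$ is a field with an absolute value; it is complete and separable as a metric space. Sets of $k$-points of $k$-varieties carry the Polish topology induced from the absolute value (via affine charts); measures are Borel measures. A $k$-action is an algebraic action defined over $k$. An $L$-invariant probability measure $\mu$ is weakly mixing if $\mu\times\mu$ is ergodic for the diagonal action of $L$ on $V\times V$. $V^L$ is the set of $L$-fixed points in $V$ and $\delta_x$ is the Dirac measure at $x$. *)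

theory Defs
  imports
    "HOL-Probability.Probability"
    "HOL-Algebra.Algebraic_Closure_Type"
    "HOL-Algebra.Group_Action"
    "HOL-Library.Poly_Mapping"
begin

section \<open>Valued fields\<close>

text \<open>The absolute value is an explicit real-valued function, since no type class covers
  archimedean and non-archimedean absolute values at once.  The trivial one is not excluded.\<close>

definition absolute_value :: "('k::field \<Rightarrow> real) \<Rightarrow> bool" where
  "absolute_value v \<longleftrightarrow>
     (\<forall>x. 0 \<le> v x) \<and> (\<forall>x. v x = 0 \<longleftrightarrow> x = 0) \<and>
     (\<forall>x y. v (x * y) = v x * v y) \<and> (\<forall>x y. v (x + y) \<le> v x + v y)"

definition val_dist :: "('k::field \<Rightarrow> real) \<Rightarrow> 'k \<Rightarrow> 'k \<Rightarrow> real" where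
  "val_dist v x y = v (x - y)"

definition val_topology :: "('k::field \<Rightarrow> real) \<Rightarrow> 'k topology" where
  "val_topology v = Metric_space.mtopology UNIV (val_dist v)"

definition complete_separable_valued_field :: "('k::field \<Rightarrow> real) \<Rightarrow> bool" where
  "complete_separable_valued_field v \<longleftrightarrow>
     absolute_value v \<and> Metric_space.mcomplete UNIV (val_dist v) \<and>
     separable_space (val_topology v)"

text \<open>The metric-space notions above are meaningful only inside the locale.\<close>

lemma Metric_space_val_dist:
  assumes "absolute_value v"
  shows "Metric_space UNIV (val_dist v)"
proof -
  have pos: "0 \<le> v x" and zero: "v x = 0 \<longleftrightarrow> x = 0" and mult: "v (x * y) = v x * v y"
    and tri: "v (x + y) \<le> v x + v y" for x y
    using assms unfolding absolute_value_def by blast+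
  have "v 1 = 1" using mult[of 1 1] zero[of 1] by simp
  then have "v (-1) * v (-1) = 1" using mult[of "-1" "-1"] by simp
  with pos[of "-1"] have "v (-1) = 1"
    by (simp add: square_eq_1_iff)
  then have minus: "v (x - y) = v (y - x)" for x y
    using mult[of "-1" "y - x"] by simp
  show ?thesis
  proof
    show "val_dist v x y = val_dist v y x" for x y unfolding val_dist_def by (rule minus)
    show "val_dist v x z \<le> val_dist v x y + val_dist v y z" for x y z
      using tri[of "x - y" "y - z"] by (simp add: val_dist_def)
  qed (auto simp: val_dist_def pos zero)
qed


section \<open>Polynomials in several variables\<close>

type_synonym 'a mpoly = "(nat \<Rightarrow>\<^sub>0 nat) \<Rightarrow>\<^sub>0 'a"

definition mpoly_ring :: "nat \<Rightarrow> ('a::comm_ring_1) mpoly set" where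
  "mpoly_ring n = {p. \<forall>m \<in> Poly_Mapping.keys p. Poly_Mapping.keys m \<subseteq> {..<n}}"

definition mpoly_eval :: "(nat \<Rightarrow> 'a::comm_ring_1) \<Rightarrow> 'a mpoly \<Rightarrow> 'a" where
  "mpoly_eval x p = (\<Sum>m \<in> Poly_Mapping.keys p. Poly_Mapping.lookup p m *
      (\<Prod>i \<in> Poly_Mapping.keys m. x i ^ Poly_Mapping.lookup m i))"

text \<open>Extension of scalars from a field to its algebraic closure.\<close>

abbreviation mpoly_ac :: "('k::field) mpoly \<Rightarrow> 'k alg_closure mpoly" where
  "mpoly_ac \<equiv> Poly_Mapping.map to_ac"


section \<open>Varieties over a field\<close>

text \<open>Varieties over \<open>k\<close> are taken in the classical sense of Weil, Serre and Borel: sets of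
  points over the algebraic closure, with a \<open>k\<close>-structure.  Points of affine \<open>n\<close>-space are
  functions on \<open>{..<n}\<close>, extended by \<open>undefined\<close>.\<close>

definition affine_space :: "nat \<Rightarrow> (nat \<Rightarrow> 'a) set" where
  "affine_space n = ({..<n} \<rightarrow>\<^sub>E UNIV)"

definition k_ideal :: "nat \<Rightarrow> (nat \<Rightarrow> ('k::field) alg_closure) set \<Rightarrow> 'k mpoly set" where
  "k_ideal n Z = {p \<in> mpoly_ring n. \<forall>x\<in>Z. mpoly_eval x (mpoly_ac p) = 0}"

definition ac_ideal ::
    "nat \<Rightarrow> (nat \<Rightarrow> ('k::field) alg_closure) set \<Rightarrow> 'k alg_closure mpoly set" where
  "ac_ideal n Z = {q \<in> mpoly_ring n. \<forall>x\<in>Z. mpoly_eval x q = 0}"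

text \<open>\<open>Z\<close> is Zariski closed and defined over \<open>k\<close>: it is the zero set of polynomials over \<open>k\<close>, and
  these generate its full vanishing ideal.  Over imperfect \<open>k\<close> the second condition does not
  follow from the first; it amounts to geometric reducedness.\<close>

definition affine_k_variety :: "nat \<Rightarrow> (nat \<Rightarrow> ('k::field) alg_closure) set \<Rightarrow> bool" where
  "affine_k_variety n Z \<longleftrightarrow>
     Z = {x \<in> affine_space n. \<forall>p \<in> k_ideal n Z. mpoly_eval x (mpoly_ac p) = 0} \<and>
     (\<forall>q \<in> ac_ideal n Z. \<exists>S c. finite S \<and> S \<subseteq> k_ideal n Z \<and> (\<forall>p\<in>S. c p \<in> mpoly_ring n) \<and>
        q = (\<Sum>p\<in>S. c p * mpoly_ac p))"

record (overloaded) ('x, 'k::field) chart =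
  cdom :: "'x set"
  cdim :: nat
  coord :: "'x \<Rightarrow> nat \<Rightarrow> 'k alg_closure"

text \<open>Zariski open subsets of a chart domain that are defined by polynomials over \<open>k\<close>.\<close>

definition k_open :: "('x, 'k::field) chart \<Rightarrow> 'x set \<Rightarrow> bool" where
  "k_open c W \<longleftrightarrow> (\<exists>S \<subseteq> mpoly_ring (cdim c).
     W = {x \<in> cdom c. \<exists>p\<in>S. mpoly_eval (coord c x) (mpoly_ac p) \<noteq> 0})"

text \<open>Regular functions on \<open>W\<close> defined over \<open>k\<close>: locally quotients of polynomials over \<open>k\<close>.\<close>

definition k_regular ::
    "('x, 'k::field) chart \<Rightarrow> 'x set \<Rightarrow> ('x \<Rightarrow> 'k alg_closure) \<Rightarrow> bool" where
  "k_regular c W f \<longleftrightarrow> (\<forall>x\<in>W. \<exists>p \<in> mpoly_ring (cdim c). \<exists>q \<in> mpoly_ring (cdim c).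
     mpoly_eval (coord c x) (mpoly_ac q) \<noteq> 0 \<and>
     (\<forall>y\<in>W. mpoly_eval (coord c y) (mpoly_ac q) \<noteq> 0 \<longrightarrow>
        f y = mpoly_eval (coord c y) (mpoly_ac p) / mpoly_eval (coord c y) (mpoly_ac q)))"

text \<open>\<open>f\<close> in terms of the charts \<open>c\<close> and \<open>d\<close> of its source and target.\<close>

definition k_morphism_charts ::
    "('x, 'k::field) chart \<Rightarrow> ('y, 'k) chart \<Rightarrow> ('x \<Rightarrow> 'y) \<Rightarrow> bool" where
  "k_morphism_charts c d f \<longleftrightarrow> k_open c {x \<in> cdom c. f x \<in> cdom d} \<and>
     (\<forall>j < cdim d. k_regular c {x \<in> cdom c. f x \<in> cdom d} (\<lambda>x. coord d (f x) j))"

definition prod_chart ::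
    "('x, 'k::field) chart \<Rightarrow> ('y, 'k) chart \<Rightarrow> ('x \<times> 'y, 'k) chart" where
  "prod_chart c d =
     \<lparr>cdom = cdom c \<times> cdom d, cdim = cdim c + cdim d,
      coord = (\<lambda>(x, y). \<lambda>i \<in> {..<cdim c + cdim d}.
                 if i < cdim c then coord c x i else coord d y (i - cdim c))\<rparr>"

record (overloaded) ('x, 'k::field) atlas =
  pts :: "'x set"
  charts :: "('x, 'k) chart set"

text \<open>A variety over \<open>k\<close>, not necessarily irreducible, is presented by a finite atlas of affine
  charts.  The conditions say, in order: the chart domains cover; each chart identifies its
  domain with an affine variety over \<open>k\<close>; changes of charts are regular over \<open>k\<close> on \<open>k\<close>-open
  overlaps; the diagonal is closed (separatedness).\<close>

definition k_variety :: "('x, 'k::field) atlas \<Rightarrow> bool" where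
  "k_variety V \<longleftrightarrow> finite (charts V) \<and> pts V = (\<Union>c \<in> charts V. cdom c) \<and>
     (\<forall>c \<in> charts V. inj_on (coord c) (cdom c) \<and> affine_k_variety (cdim c) (coord c ` cdom c)) \<and>
     (\<forall>c \<in> charts V. \<forall>d \<in> charts V. k_morphism_charts c d (\<lambda>x. x)) \<and>
     (\<forall>c \<in> charts V. \<forall>d \<in> charts V. k_open (prod_chart c d) {(x, y) \<in> cdom c \<times> cdom d. x \<noteq> y})"

definition k_morphism ::
    "('x, 'k::field) atlas \<Rightarrow> ('y, 'k) atlas \<Rightarrow> ('x \<Rightarrow> 'y) \<Rightarrow> bool" where
  "k_morphism V W f \<longleftrightarrow> f \<in> pts V \<rightarrow> pts W \<and>
     (\<forall>c \<in> charts V. \<forall>d \<in> charts W. k_morphism_charts c d f)"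

definition prod_variety ::
    "('x, 'k::field) atlas \<Rightarrow> ('y, 'k) atlas \<Rightarrow> ('x \<times> 'y, 'k) atlas" where
  "prod_variety V W =
     \<lparr>pts = pts V \<times> pts W, charts = (\<lambda>(c, d). prod_chart c d) ` (charts V \<times> charts W)\<rparr>"


subsection \<open>Rational points and their topology\<close>

definition k_points :: "('x, 'k::field) atlas \<Rightarrow> 'x set" where
  "k_points V = {x \<in> pts V. \<exists>c \<in> charts V. x \<in> cdom c \<and> (\<forall>i < cdim c. coord c x i \<in> range to_ac)}"

definition k_coord :: "('x, 'k::field) chart \<Rightarrow> 'x \<Rightarrow> nat \<Rightarrow> 'k" where
  "k_coord c x = (\<lambda>i \<in> {..<cdim c}. of_ac (coord c x i))"

text \<open>The topology that the chart \<open>c\<close> induces on its \<open>k\<close>-points from the product topology on \<open>k\<^sup>n\<close>.\<close>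

definition chart_topology ::
    "('k::field \<Rightarrow> real) \<Rightarrow> ('x, 'k) atlas \<Rightarrow> ('x, 'k) chart \<Rightarrow> 'x topology" where
  "chart_topology v V c = pullback_topology (cdom c \<inter> k_points V) (k_coord c)
     (product_topology (\<lambda>_. val_topology v) {..<cdim c})"

definition k_points_topology :: "('k::field \<Rightarrow> real) \<Rightarrow> ('x, 'k) atlas \<Rightarrow> 'x topology" where
  "k_points_topology v V = topology (\<lambda>U. U \<subseteq> k_points V \<and>
     (\<forall>c \<in> charts V. openin (chart_topology v V c) (cdom c \<inter> U)))"

lemma openin_k_points_topology:
  "openin (k_points_topology v V) U \<longleftrightarrow>
     U \<subseteq> k_points V \<and> (\<forall>c \<in> charts V. openin (chart_topology v V c) (cdom c \<inter> U))"
proof -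
  have "istopology (\<lambda>U. U \<subseteq> k_points V \<and>
     (\<forall>c \<in> charts V. openin (chart_topology v V c) (cdom c \<inter> U)))"
    unfolding istopology_def
  proof (rule conjI; intro allI impI conjI ballI)
    fix S T c
    assume "S \<subseteq> k_points V \<and> (\<forall>c\<in>charts V. openin (chart_topology v V c) (cdom c \<inter> S))"
      and "T \<subseteq> k_points V \<and> (\<forall>c\<in>charts V. openin (chart_topology v V c) (cdom c \<inter> T))"
      and "c \<in> charts V"
    then have "openin (chart_topology v V c) ((cdom c \<inter> S) \<inter> (cdom c \<inter> T))" by blast
    then show "openin (chart_topology v V c) (cdom c \<inter> (S \<inter> T))"
      by (simp add: Int_ac)
  next
    fix \<K> c
    assume "\<forall>K\<in>\<K>. K \<subseteq> k_points V \<and> (\<forall>c\<in>charts V. openin (chart_topology v V c) (cdom c \<inter> K))"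
      and "c \<in> charts V"
    then have "openin (chart_topology v V c) (\<Union>K\<in>\<K>. cdom c \<inter> K)" by blast
    then show "openin (chart_topology v V c) (cdom c \<inter> \<Union>\<K>)" by (simp only: Int_Union)
  qed blast+
  then show ?thesis by (simp add: k_points_topology_def topology_inverse')
qed

lemma topspace_k_points_topology:
  assumes "absolute_value v"
  shows "topspace (k_points_topology v V) = k_points V"
proof
  interpret Metric_space UNIV "val_dist v" by (rule Metric_space_val_dist [OF assms])
  have "topspace (chart_topology v V c) = cdom c \<inter> k_points V" for c
    by (auto simp: chart_topology_def topspace_pullback_topology val_topology_def k_coord_def)
  then have "openin (chart_topology v V c) (cdom c \<inter> k_points V)" for c
    using openin_topspace[of "chart_topology v V c"] by (simp only:)
  then have "openin (k_points_topology v V) (k_points V)"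
    by (simp add: openin_k_points_topology)
  then show "k_points V \<subseteq> topspace (k_points_topology v V)" by (rule openin_subset)
  show "topspace (k_points_topology v V) \<subseteq> k_points V"
    using openin_topspace[of "k_points_topology v V"] by (simp only: openin_k_points_topology)
qed

definition borel_measurable_space :: "'x topology \<Rightarrow> 'x measure" where
  "borel_measurable_space T = sigma (topspace T) {U. openin T U}"


subsection \<open>Algebraic groups and actions\<close>

text \<open>\<open>G\<close> is the group structure on all points of \<open>\<G>\<close> over the algebraic closure, not only on the
  rational ones.  Affineness is not assumed.\<close>

definition k_algebraic_group :: "('g, 'k::field) atlas \<Rightarrow> ('g, 'm) monoid_scheme \<Rightarrow> bool" where
  "k_algebraic_group \<G> G \<longleftrightarrow> k_variety \<G> \<and> group G \<and> carrier G = pts \<G> \<and>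
     k_morphism (prod_variety \<G> \<G>) \<G> (\<lambda>(g, h). g \<otimes>\<^bsub>G\<^esub> h) \<and>
     k_morphism \<G> \<G> (\<lambda>g. inv\<^bsub>G\<^esub> g) \<and> \<one>\<^bsub>G\<^esub> \<in> k_points \<G>"

definition k_action ::
    "('g, 'k::field) atlas \<Rightarrow> ('g, 'm) monoid_scheme \<Rightarrow> ('x, 'k) atlas \<Rightarrow> ('g \<Rightarrow> 'x \<Rightarrow> 'x) \<Rightarrow> bool"
  where
  "k_action \<G> G V \<phi> \<longleftrightarrow>
     group_action G (pts V) \<phi> \<and> k_morphism (prod_variety \<G> V) V (\<lambda>(g, x). \<phi> g x)"

definition fixed_points :: "'g set \<Rightarrow> ('g \<Rightarrow> 'x \<Rightarrow> 'x) \<Rightarrow> 'x set \<Rightarrow> 'x set" where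
  "fixed_points L \<phi> E = {x \<in> E. \<forall>g\<in>L. \<phi> g x = x}"


section \<open>Invariance, ergodicity and weak mixing\<close>

definition invariant_measure :: "'g set \<Rightarrow> ('g \<Rightarrow> 'x \<Rightarrow> 'x) \<Rightarrow> 'x measure \<Rightarrow> bool" where
  "invariant_measure L \<phi> M \<longleftrightarrow> (\<forall>g\<in>L. \<phi> g \<in> measurable M M \<and> distr M M (\<phi> g) = M)"

text \<open>Only strictly invariant measurable sets are tested.\<close>

definition ergodic :: "'g set \<Rightarrow> ('g \<Rightarrow> 'x \<Rightarrow> 'x) \<Rightarrow> 'x measure \<Rightarrow> bool" where
  "ergodic L \<phi> M \<longleftrightarrow> (\<forall>A \<in> sets M. (\<forall>g\<in>L. \<phi> g -` A \<inter> space M = A) \<longrightarrow>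
     emeasure M A = 0 \<or> emeasure M (space M - A) = 0)"

definition weakly_mixing :: "'g set \<Rightarrow> ('g \<Rightarrow> 'x \<Rightarrow> 'x) \<Rightarrow> 'x measure \<Rightarrow> bool" where
  "weakly_mixing L \<phi> M \<longleftrightarrow> ergodic L (\<lambda>g. map_prod (\<phi> g) (\<phi> g)) (M \<Otimes>\<^sub>M M)"

end

theory Submission
  imports Defs "HOL-Library.Function_Algebras"
begin

text \<open>
The acting group is finite-dimensional, while the powers \<open>V\<^sup>n\<close> of the space have arbitrarily many
independent coordinates; and weak mixing makes \<open>L\<close> act ergodically on all these powers.

Let \<open>f\<close> be a coordinate function on the domain \<open>C\<close> of a chart of \<open>V\<close>, and let \<open>n\<close> exceed the
number of coordinates of every chart of the group.  For points \<open>x 1, ..., x n\<close> the functions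
\<open>g \<mapsto> f (g x i)\<close> are quotients of polynomials in fewer than \<open>n\<close> coordinates of \<open>g\<close>, locally and, by
Hilbert's basis theorem, on finitely many patches.  Counting monomials shows that they satisfy a
nontrivial polynomial relation (\<open>orbit_algebraic_dependence\<close>).  In other words, the part of the
\<open>L\<close>-orbit of \<open>(x 1, ..., x n)\<close> that lies in \<open>C\<^sup>n\<close> satisfies such a relation.  For a fixed order of
the monomials there is a first one that is a linear combination of its predecessors on this set.  Its index
and the coefficients depend on the orbit only, and they are measurable although \<open>L\<close> may be uncountable:
linear independence on an orbit is an open condition, and the coefficients are continuous where they are
defined (\<open>continuous_dual_basis\<close>).  By ergodicity of the power they are almost everywhere constant
(\<open>AE_constant_relation\<close>).  So one nontrivial polynomial relation holds between
\<open>f (x 1), ..., f (x n)\<close> for almost all points of \<open>C\<^sup>n\<close>.  As the entries \<open>x i\<close> are independent,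
Fubini's theorem permits this only if \<open>f\<close> has an atom on every subset of \<open>C\<close> of positive measure
(\<open>AE_polynomial_relation_trivial\<close>).  Applying this to one coordinate after the other yields an atom
of \<open>\<mu>\<close> (\<open>atom_exists\<close>).  The diagonal pairs of atoms form an invariant set of positive measure in
\<open>V \<times> V\<close>, so by weak mixing there is only one atom, of mass one; being unique it is fixed by \<open>L\<close>.

Ergodicity of the powers (\<open>weakly_mixing_power_ergodic\<close>) must be derived with care, because only
strictly invariant sets are tested, and for a group that is not locally compact a set which is invariant up to
null sets need not agree almost everywhere with a strictly invariant one.  The argument uses only the
following function.  For an invariant set \<open>E\<close> in \<open>V \<times> Y\<close> let \<open>F (x, y)\<close> be the measure of the symmetric
difference of its sections over \<open>x\<close> and \<open>y\<close>.  This function is strictly invariant on \<open>V \<times> V\<close>, hence almost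
everywhere constant, and the constant is zero because the sections form a separable family.  So membership
in \<open>E\<close> does not depend on the first coordinate.\<close>

section \<open>Hilbert's basis theorem\<close>

definition subring_set :: "'a::comm_ring_1 set \<Rightarrow> bool" where
  "subring_set R \<longleftrightarrow> 0 \<in> R \<and> 1 \<in> R \<and> (\<forall>x\<in>R. \<forall>y\<in>R. x + y \<in> R \<and> x * y \<in> R) \<and> (\<forall>x\<in>R. - x \<in> R)"

inductive_set ideal_span :: "'a::comm_ring_1 set \<Rightarrow> 'a set \<Rightarrow> 'a set" for R S where
  zero: "0 \<in> ideal_span R S"
| step: "a \<in> ideal_span R S \<Longrightarrow> r \<in> R \<Longrightarrow> s \<in> S \<Longrightarrow> a + r * s \<in> ideal_span R S"

text \<open>For a subring this amounts to finite generation of all its ideals; the sequential form is the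
  one that Hilbert's argument uses.\<close>

definition noetherian_set :: "'a::comm_ring_1 set \<Rightarrow> bool" where
  "noetherian_set R \<longleftrightarrow> (\<forall>s :: nat \<Rightarrow> 'a. range s \<subseteq> R \<longrightarrow> (\<exists>N. s N \<in> ideal_span R (s ` {..<N})))"

text \<open>Polynomial expressions in \<open>z\<close> of degree less than \<open>n\<close>.  They are sets of ring elements, not formal
  polynomials: \<open>z\<close> may satisfy algebraic relations over \<open>R\<close>, as happens in rings of functions.\<close>

primrec polys_below :: "'a::comm_ring_1 set \<Rightarrow> 'a \<Rightarrow> nat \<Rightarrow> 'a set" where
  "polys_below R z 0 = {0}"
| "polys_below R z (Suc n) = {r * z ^ n + q | r q. r \<in> R \<and> q \<in> polys_below R z n}"

definition adjoin :: "'a::comm_ring_1 set \<Rightarrow> 'a \<Rightarrow> 'a set" where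
  "adjoin R z = (\<Union>n. polys_below R z n)"

lemma ideal_span_add:
  assumes "a \<in> ideal_span R S" "b \<in> ideal_span R S"
  shows "a + b \<in> ideal_span R S"
  using assms(2)
proof induction
  case zero
  then show ?case using assms(1) by simp
next
  case (step b r s)
  have "(a + b) + r * s \<in> ideal_span R S"
    using step by (intro ideal_span.step)
  then show ?case by (simp add: add.assoc)
qed

lemma ideal_span_mult:
  assumes "subring_set R" "c \<in> R" "a \<in> ideal_span R S"
  shows "c * a \<in> ideal_span R S"
  using assms(3)
proof induction
  case zero
  then show ?case by (simp add: ideal_span.zero)
next
  case (step a r s)
  have "c * r \<in> R" using assms step by (simp add: subring_set_def)
  then have "c * a + (c * r) * s \<in> ideal_span R S"
    using step by (intro ideal_span.step)
  then show ?case by (simp add: algebra_simps)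
qed

lemma ideal_span_diff:
  assumes "subring_set R" "a \<in> ideal_span R S" "b \<in> ideal_span R S"
  shows "a - b \<in> ideal_span R S"
proof -
  have "-1 \<in> R" using assms(1) by (simp add: subring_set_def)
  from ideal_span_mult[OF assms(1) this assms(3)] ideal_span_add[OF assms(2)]
  show ?thesis by fastforce
qed

lemma ideal_span_base:
  assumes "subring_set R" "s \<in> S"
  shows "s \<in> ideal_span R S"
  using ideal_span.step[OF ideal_span.zero, of 1 R s S] assms by (simp add: subring_set_def)

lemma ideal_span_trans:
  assumes "subring_set R" "S \<subseteq> ideal_span R T" "a \<in> ideal_span R S"
  shows "a \<in> ideal_span R T"
  using assms(3)
proof induction
  case (step a r s)
  then show ?case using assms(1,2) by (intro ideal_span_add ideal_span_mult) auto
qed (rule ideal_span.zero)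

lemma ideal_span_mono:
  assumes "subring_set R" "S \<subseteq> T"
  shows "ideal_span R S \<subseteq> ideal_span R T"
  using ideal_span_trans[OF assms(1)] ideal_span_base[OF assms(1)] assms(2) by (metis subsetD subsetI)

lemma ideal_span_subset:
  assumes "subring_set R" "S \<subseteq> R"
  shows "ideal_span R S \<subseteq> R"
proof
  fix a assume "a \<in> ideal_span R S"
  then show "a \<in> R" by induction (use assms in \<open>auto simp: subring_set_def\<close>)
qed

lemma polys_below_zero: "subring_set R \<Longrightarrow> 0 \<in> polys_below R z n"
proof (induction n)
  case (Suc n)
  then have "0 = 0 * z ^ n + 0 \<and> 0 \<in> R \<and> 0 \<in> polys_below R z n"
    by (simp add: subring_set_def)
  then show ?case unfolding polys_below.simps by blast
qed simp

lemma polys_below_Suc: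
  assumes "subring_set R"
  shows "polys_below R z n \<subseteq> polys_below R z (Suc n)"
proof
  fix q assume "q \<in> polys_below R z n"
  then have "q = 0 * z ^ n + q \<and> 0 \<in> R \<and> q \<in> polys_below R z n"
    using assms by (simp add: subring_set_def)
  then show "q \<in> polys_below R z (Suc n)" unfolding polys_below.simps by blast
qed

lemma polys_below_mono:
  assumes "subring_set R" "m \<le> n"
  shows "polys_below R z m \<subseteq> polys_below R z n"
  using lift_Suc_mono_le[of "polys_below R z", OF polys_below_Suc[OF assms(1)] assms(2)] .

lemma polys_below_add:
  assumes "subring_set R" "p \<in> polys_below R z n" "q \<in> polys_below R z n"
  shows "p + q \<in> polys_below R z n"
  using assms(2,3)
proof (induction n arbitrary: p q)
  case (Suc n)
  then obtain r p' s q' where "p = r * z ^ n + p'" "q = s * z ^ n + q'" "r \<in> R" "s \<in> R"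
    "p' \<in> polys_below R z n" "q' \<in> polys_below R z n" by auto
  then have "p + q = (r + s) * z ^ n + (p' + q')" "r + s \<in> R" "p' + q' \<in> polys_below R z n"
    using assms(1) Suc.IH by (auto simp: algebra_simps subring_set_def)
  then show ?case by auto
qed simp

lemma polys_below_monom:
  assumes "subring_set R" "c \<in> R" "p \<in> polys_below R z n"
  shows "c * z ^ k * p \<in> polys_below R z (n + k)"
  using assms(3)
proof (induction n arbitrary: p)
  case 0
  then show ?case using polys_below_zero[OF assms(1)] by simp
next
  case (Suc n)
  then obtain r p' where p: "p = r * z ^ n + p'" "r \<in> R" "p' \<in> polys_below R z n" by auto
  then have "c * z ^ k * p = (c * r) * z ^ (n + k) + c * z ^ k * p'"
    by (simp add: algebra_simps power_add)
  moreover have "c * r \<in> R" using assms(1,2) p(2) by (simp add: subring_set_def)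
  moreover have "c * z ^ k * p' \<in> polys_below R z (n + k)" by (rule Suc.IH[OF p(3)])
  ultimately show ?case unfolding add_Suc polys_below.simps by blast
qed

lemma polys_below_diff:
  assumes "subring_set R" "p \<in> polys_below R z n" "q \<in> polys_below R z n"
  shows "p - q \<in> polys_below R z n"
proof -
  have "-1 \<in> R" using assms(1) by (simp add: subring_set_def)
  from polys_below_monom[OF assms(1) this assms(3), of 0] polys_below_add[OF assms(1,2)]
  show ?thesis by fastforce
qed

lemma polys_below_mult:
  assumes "subring_set R" "p \<in> polys_below R z m" "q \<in> polys_below R z n"
  shows "p * q \<in> polys_below R z (n + m)"
  using assms(2)
proof (induction m arbitrary: p)
  case 0
  then show ?case using polys_below_zero[OF assms(1)] by simp
next
  case (Suc m)
  then obtain r p' where p: "p = r * z ^ m + p'" "r \<in> R" "p' \<in> polys_below R z m" by auto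
  have "r * z ^ m * q \<in> polys_below R z (Suc (n + m))"
    using polys_below_monom[OF assms(1) p(2) assms(3), of m] polys_below_mono[OF assms(1)]
    by (meson le_SucI order_refl subsetD)
  moreover have "p' * q \<in> polys_below R z (Suc (n + m))"
    using Suc.IH[OF p(3)] polys_below_mono[OF assms(1)]
    by (meson le_SucI order_refl subsetD)
  ultimately show ?case
    using polys_below_add[OF assms(1)] p(1) by (simp only: distrib_right add_Suc_right)
qed

lemma subring_adjoin:
  assumes "subring_set R"
  shows "subring_set (adjoin R z)"
  unfolding subring_set_def
proof (intro conjI ballI)
  show "0 \<in> adjoin R z" using polys_below_zero[OF assms] by (auto simp: adjoin_def)
  have "1 = 1 * z ^ 0 + 0 \<and> 1 \<in> R \<and> 0 \<in> polys_below R z 0"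
    using assms by (simp add: subring_set_def)
  then have "1 \<in> polys_below R z (Suc 0)" unfolding polys_below.simps by blast
  then show "1 \<in> adjoin R z" unfolding adjoin_def by blast
next
  fix x y assume "x \<in> adjoin R z" "y \<in> adjoin R z"
  then obtain m n where m: "x \<in> polys_below R z m" and n: "y \<in> polys_below R z n"
    by (auto simp: adjoin_def)
  then have "x \<in> polys_below R z (m + n)" "y \<in> polys_below R z (m + n)"
    using polys_below_mono[OF assms] le_add1 le_add2 by blast+
  then show "x + y \<in> adjoin R z"
    using polys_below_add[OF assms] unfolding adjoin_def by blast
  show "x * y \<in> adjoin R z"
    using polys_below_mult[OF assms m n] by (auto simp: adjoin_def)
next
  fix x assume "x \<in> adjoin R z"
  then obtain m where m: "x \<in> polys_below R z m" by (auto simp: adjoin_def)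
  then show "- x \<in> adjoin R z"
    using polys_below_diff[OF assms polys_below_zero[OF assms] m] by (auto simp: adjoin_def)
qed

lemma adjoin_base:
  assumes "subring_set R" "r \<in> R"
  shows "r \<in> adjoin R z"
proof -
  have "r = r * z ^ 0 + 0 \<and> r \<in> R \<and> 0 \<in> polys_below R z 0" using assms by simp
  then have "r \<in> polys_below R z (Suc 0)" unfolding polys_below.simps(2) by blast
  then show ?thesis unfolding adjoin_def by blast
qed

lemma adjoin_var:
  assumes "subring_set R"
  shows "z \<in> adjoin R z"
proof -
  have "z = 1 * z ^ 1 + 0 \<and> 1 \<in> R \<and> 0 \<in> polys_below R z 1"
    using assms polys_below_zero[OF assms] by (simp add: subring_set_def)
  then have "z \<in> polys_below R z (Suc 1)" unfolding polys_below.simps(2) by blast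
  then show ?thesis unfolding adjoin_def by blast
qed

text \<open>Hilbert's argument.  If some sequence in \<open>R[z]\<close> violated the chain condition, one could choose
  recursively elements \<open>f n\<close> of the ideal it spans, each of least degree outside the ideal spanned by
  \<open>f 0, ..., f (n - 1)\<close>.  The chain condition in \<open>R\<close> applied to the leading coefficients then
  produces an element of smaller degree, contrary to minimality.\<close>

lemma noetherian_adjoin:
  fixes R :: "'a::comm_ring_1 set"
  assumes R: "subring_set R" and noeth: "noetherian_set R"
  shows "noetherian_set (adjoin R z)"
  unfolding noetherian_set_def
proof (intro allI impI, rule ccontr)
  define A where "A = adjoin R z"
  have A: "subring_set A" unfolding A_def by (rule subring_adjoin[OF R])
  fix s :: "nat \<Rightarrow> 'a"
  assume "range s \<subseteq> adjoin R z" and "\<nexists>N. s N \<in> ideal_span (adjoin R z) (s ` {..<N})"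
  then have sA: "range s \<subseteq> A" and bad: "s N \<notin> ideal_span A (s ` {..<N})" for N
    by (auto simp: A_def)
  define I where "I = ideal_span A (range s)"
  have I_sub: "I \<subseteq> A" unfolding I_def by (rule ideal_span_subset[OF A sA])
  have fin: "\<exists>N. F \<subseteq> ideal_span A (s ` {..<N})" if "finite F" "F \<subseteq> I" for F
    using that
  proof (induction F)
    case (insert a F)
    then obtain N where N: "F \<subseteq> ideal_span A (s ` {..<N})" by auto
    have "a \<in> ideal_span A (range s)" using insert by (simp add: I_def)
    then have "\<exists>M. a \<in> ideal_span A (s ` {..<M})"
    proof induction
      case (step a r t)
      then obtain M k where M: "a \<in> ideal_span A (s ` {..<M})" and k: "t = s k" by auto
      have "a \<in> ideal_span A (s ` {..<max M (Suc k)})"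
        using ideal_span_mono[OF A, of "s ` {..<M}" "s ` {..<max M (Suc k)}"] M by fastforce
      then show ?case using step k
        by (intro exI[of _ "max M (Suc k)"] ideal_span.step) auto
    qed (auto intro: ideal_span.zero)
    then obtain M where "a \<in> ideal_span A (s ` {..<M})" by blast
    moreover have "ideal_span A (s ` {..<M}) \<subseteq> ideal_span A (s ` {..<max M N})"
      "ideal_span A (s ` {..<N}) \<subseteq> ideal_span A (s ` {..<max M N})"
      by (intro ideal_span_mono[OF A]; auto)+
    ultimately show ?case using N by blast
  qed simp
  have outside: "\<exists>h\<in>I. h \<notin> ideal_span A F" if F: "finite F" "F \<subseteq> I" for F
  proof -
    obtain N where "F \<subseteq> ideal_span A (s ` {..<N})" using fin[OF F] by blast
    then have "s N \<notin> ideal_span A F" using bad ideal_span_trans[OF A] by blast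
    moreover have "s N \<in> I" unfolding I_def by (intro ideal_span_base[OF A]) simp
    ultimately show ?thesis by blast
  qed
  define deg where "deg h = (LEAST n. h \<in> polys_below R z n)" for h
  have deg_mem: "h \<in> polys_below R z (deg h)" if "h \<in> I" for h
  proof -
    have "\<exists>n. h \<in> polys_below R z n" using that I_sub by (auto simp: A_def adjoin_def)
    then show ?thesis unfolding deg_def by (rule LeastI_ex)
  qed
  \<comment> \<open>The ideal spanned by a finite \<open>F\<close> misses some \<open>s N\<close>, hence some element of least degree.\<close>
  define next_elt where "next_elt F = (ARG_MIN deg h. h \<in> I \<and> h \<notin> ideal_span A F)" for F
  have next_elt: "next_elt F \<in> I \<and> next_elt F \<notin> ideal_span A F \<and>
      (\<forall>h\<in>I. h \<notin> ideal_span A F \<longrightarrow> deg (next_elt F) \<le> deg h)" if F: "finite F" "F \<subseteq> I" for F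
  proof -
    obtain h0 where "h0 \<in> I \<and> h0 \<notin> ideal_span A F" using outside[OF F] by blast
    from arg_min_nat_lemma[of "\<lambda>h. h \<in> I \<and> h \<notin> ideal_span A F", OF this, of deg]
    show ?thesis unfolding next_elt_def by blast
  qed
  define F where "F = rec_nat {} (\<lambda>_ B. insert (next_elt B) B)"
  have F_simps: "F 0 = {}" "F (Suc n) = insert (next_elt (F n)) (F n)" for n
    by (simp_all add: F_def)
  define f where "f n = next_elt (F n)" for n
  have F_eq: "F n = f ` {..<n}" for n
    by (induction n) (auto simp: F_simps f_def lessThan_Suc)
  have F: "finite (F n) \<and> F n \<subseteq> I" for n
    by (induction n) (auto simp: F_simps next_elt)
  have f: "f n \<in> I" "f n \<notin> ideal_span A (F n)"
    and f_min: "h \<in> I \<Longrightarrow> h \<notin> ideal_span A (F n) \<Longrightarrow> deg (f n) \<le> deg h" for n h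
    using next_elt[of "F n"] F[of n] by (auto simp: f_def)
  have deg_mono: "deg (f m) \<le> deg (f n)" if "m \<le> n" for m n
  proof (rule f_min)
    have "ideal_span A (F m) \<subseteq> ideal_span A (F n)"
      using that by (intro ideal_span_mono[OF A]) (auto simp: F_eq)
    then show "f n \<notin> ideal_span A (F m)" using f by blast
  qed (rule f)
  have "\<exists>d r q. deg (f n) = Suc d \<and> f n = r * z ^ d + q \<and> r \<in> R \<and> q \<in> polys_below R z d" for n
  proof (cases "deg (f n)")
    case 0
    then have "f n = 0" using deg_mem[OF f(1)[of n]] by simp
    then show ?thesis using f(2)[of n] ideal_span.zero[of A "F n"] by simp
  next
    case (Suc d)
    then show ?thesis using deg_mem[OF f(1)[of n]] by auto
  qed
  then obtain d r q where d: "\<And>n. deg (f n) = Suc (d n)"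
    and f_eq: "\<And>n. f n = r n * z ^ d n + q n" and r: "\<And>n. r n \<in> R"
    and q: "\<And>n. q n \<in> polys_below R z (d n)" by metis
  obtain N where N: "r N \<in> ideal_span R (r ` {..<N})"
    using noeth r unfolding noetherian_set_def by (meson image_subsetI)
  \<comment> \<open>Cancel the leading coefficient of \<open>f N\<close> by earlier elements.\<close>
  have "\<exists>u\<in>ideal_span A (F N). \<exists>p\<in>polys_below R z (d N). u = a * z ^ d N + p"
    if "a \<in> ideal_span R (r ` {..<N})" for a
    using that
  proof induction
    case zero
    show ?case
      by (rule bexI[of _ 0], rule bexI[of _ 0])
        (simp_all add: polys_below_zero[OF R] ideal_span.zero)
  next
    case (step a c t)
    then obtain u p k where u: "u \<in> ideal_span A (F N)" and p: "p \<in> polys_below R z (d N)"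
      and eq: "u = a * z ^ d N + p" and k: "k < N" "t = r k" by auto
    have dk: "d k \<le> d N" using deg_mono[of k N] k d by simp
    define e where "e = d N - d k"
    have zpow: "z ^ e \<in> A" for e
      by (induction e) (use A adjoin_var[OF R, of z] in \<open>auto simp: subring_set_def A_def\<close>)
    have "c * z ^ e \<in> A"
      using A zpow[of e] adjoin_base[OF R step(2), of z] by (auto simp: subring_set_def A_def)
    then have "u + (c * z ^ e) * f k \<in> ideal_span A (F N)"
      using u k by (intro ideal_span.step) (auto simp: F_eq)
    moreover have "c * z ^ e * q k \<in> polys_below R z (d N)"
      using polys_below_monom[OF R step(2) q[of k], of e] dk by (simp add: e_def)
    then have "p + c * z ^ e * q k \<in> polys_below R z (d N)"
      by (rule polys_below_add[OF R p])
    moreover have "z ^ d N = z ^ e * z ^ d k" using dk by (simp add: e_def flip: power_add)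
    then have "u + (c * z ^ e) * f k = (a + c * t) * z ^ d N + (p + c * z ^ e * q k)"
      by (simp add: eq f_eq k algebra_simps)
    ultimately show ?case by blast
  qed
  from this[OF N] obtain u p where u: "u \<in> ideal_span A (F N)"
    and p: "p \<in> polys_below R z (d N)" and u_eq: "u = r N * z ^ d N + p" by blast
  have "u \<in> I" using u ideal_span_trans[OF A, of "F N" "range s"] F[of N] by (auto simp: I_def)
  then have "f N - u \<in> I" using f(1)[of N] ideal_span_diff[OF A] by (auto simp: I_def)
  moreover have "f N - u \<notin> ideal_span A (F N)"
    using ideal_span_add[OF _ u] f(2)[of N] by (metis diff_add_cancel)
  ultimately have "deg (f N) \<le> deg (f N - u)" by (rule f_min)
  moreover have "f N - u \<in> polys_below R z (d N)"
    using polys_below_diff[OF R q[of N] p] by (simp add: f_eq u_eq)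
  then have "deg (f N - u) \<le> d N" unfolding deg_def by (rule Least_le)
  ultimately show False using d[of N] by simp
qed


section \<open>Polynomial functions\<close>

text \<open>Polynomials enter only through their values at rational points, and so functions replace formal
  polynomials throughout; over a finite field different polynomials give the same function.\<close>

inductive_set polyfun :: "nat \<Rightarrow> ((nat \<Rightarrow> 'k::field) \<Rightarrow> 'k) set" for m where
  const: "(\<lambda>_. c) \<in> polyfun m"
| var: "i < m \<Longrightarrow> (\<lambda>y. y i) \<in> polyfun m"
| add: "F \<in> polyfun m \<Longrightarrow> G \<in> polyfun m \<Longrightarrow> (\<lambda>y. F y + G y) \<in> polyfun m"
| mult: "F \<in> polyfun m \<Longrightarrow> G \<in> polyfun m \<Longrightarrow> (\<lambda>y. F y * G y) \<in> polyfun m"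

lemma polyfun_mono: "F \<in> polyfun m \<Longrightarrow> m \<le> n \<Longrightarrow> F \<in> polyfun n"
  by (induction rule: polyfun.induct) (auto intro: polyfun.intros)

lemma polyfun_cong:
  assumes "F \<in> polyfun m" "\<And>i. i < m \<Longrightarrow> y i = z i"
  shows "F y = F z"
  using assms by (induction rule: polyfun.induct) auto

lemma polyfun_subst:
  assumes "F \<in> polyfun m" "\<And>i. i < m \<Longrightarrow> (\<lambda>y. s y i) \<in> polyfun n"
  shows "(\<lambda>y. F (s y)) \<in> polyfun n"
  using assms by (induction rule: polyfun.induct) (auto intro: polyfun.intros)

lemma polyfun_sum:
  assumes "\<And>a. a \<in> A \<Longrightarrow> F a \<in> polyfun m"
  shows "(\<lambda>y. \<Sum>a\<in>A. F a y) \<in> polyfun m"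
  using assms by (induction A rule: infinite_finite_induct) (auto intro: polyfun.intros)

lemma polyfun_prod:
  assumes "\<And>a. a \<in> A \<Longrightarrow> F a \<in> polyfun m"
  shows "(\<lambda>y. \<Prod>a\<in>A. F a y) \<in> polyfun m"
  using assms by (induction A rule: infinite_finite_induct) (auto intro: polyfun.intros)

lemma polyfun_power: "F \<in> polyfun m \<Longrightarrow> (\<lambda>y. F y ^ n) \<in> polyfun m"
  by (induction n) (auto intro: polyfun.intros)

lemma subring_polyfun: "subring_set (polyfun m)"
  unfolding subring_set_def
proof (intro conjI ballI)
  show "0 \<in> polyfun m" "1 \<in> polyfun m"
    unfolding zero_fun_def one_fun_def by (rule polyfun.const)+
  fix F :: "(nat \<Rightarrow> 'a) \<Rightarrow> 'a" assume F: "F \<in> polyfun m"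
  have "(\<lambda>y. (- 1) * F y) \<in> polyfun m"
    by (rule polyfun.mult[OF polyfun.const F])
  then show "- F \<in> polyfun m" by (simp add: fun_Compl_def)
  fix G :: "(nat \<Rightarrow> 'a) \<Rightarrow> 'a" assume G: "G \<in> polyfun m"
  show "F + G \<in> polyfun m" "F * G \<in> polyfun m"
    unfolding plus_fun_def times_fun_def by (intro polyfun.add polyfun.mult F G)+
qed

lemma polyfun_Suc: "polyfun (Suc m) = adjoin (polyfun m) (\<lambda>y. y m)"
proof
  let ?z = "\<lambda>y::nat \<Rightarrow> 'a. y m"
  note sub = subring_adjoin[OF subring_polyfun, of m ?z]
  show "polyfun (Suc m) \<subseteq> adjoin (polyfun m) ?z"
  proof
    fix F :: "(nat \<Rightarrow> 'a) \<Rightarrow> 'a" assume "F \<in> polyfun (Suc m)"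
    then show "F \<in> adjoin (polyfun m) ?z"
    proof induction
      case (var i)
      then show ?case
        by (cases "i = m")
          (auto intro!: adjoin_var adjoin_base subring_polyfun polyfun.var)
    next
      case (add F G)
      then show ?case using sub unfolding subring_set_def plus_fun_def by blast
    next
      case (mult F G)
      then show ?case using sub unfolding subring_set_def times_fun_def by blast
    qed (intro adjoin_base subring_polyfun polyfun.const)
  qed
  have "polys_below (polyfun m) ?z n \<subseteq> polyfun (Suc m)" for n
  proof (induction n)
    case 0
    then show ?case by (auto simp: zero_fun_def intro: polyfun.const)
  next
    case (Suc n)
    have pow: "?z ^ n \<in> polyfun (Suc m)" for n
      using subring_polyfun[of "Suc m"] polyfun.var[of m "Suc m"]
      by (induction n) (auto simp: subring_set_def)
    show ?case
    proof
      fix F assume "F \<in> polys_below (polyfun m) ?z (Suc n)"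
      then obtain r q where F: "F = r * ?z ^ n + q" and r: "r \<in> polyfun m"
        and q: "q \<in> polys_below (polyfun m) ?z n" by auto
      have "r \<in> polyfun (Suc m)" using polyfun_mono[OF r] by simp
      moreover have "q \<in> polyfun (Suc m)" using Suc q by blast
      ultimately show "F \<in> polyfun (Suc m)"
        using pow[of n] subring_polyfun[of "Suc m"] unfolding F subring_set_def by blast
    qed
  qed
  then show "adjoin (polyfun m) ?z \<subseteq> polyfun (Suc m)" by (auto simp: adjoin_def)
qed

lemma noetherian_polyfun: "noetherian_set (polyfun m :: ((nat \<Rightarrow> 'k::field) \<Rightarrow> 'k) set)"
proof (induction m)
  case 0
  have const: "\<exists>c. F = (\<lambda>_. c)" if "F \<in> polyfun 0" for F :: "(nat \<Rightarrow> 'k) \<Rightarrow> 'k"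
    using that by induction auto
  show ?case unfolding noetherian_set_def
  proof (intro allI impI)
    fix s :: "nat \<Rightarrow> (nat \<Rightarrow> 'k) \<Rightarrow> 'k"
    assume s: "range s \<subseteq> polyfun 0"
    obtain a b where ab: "s 0 = (\<lambda>_. a)" "s 1 = (\<lambda>_. b)" using const s by (meson rangeI subsetD)
    show "\<exists>N. s N \<in> ideal_span (polyfun 0) (s ` {..<N})"
    proof (cases "a = 0")
      case True
      then have "s 0 = 0" using ab by (simp add: zero_fun_def)
      then show ?thesis using ideal_span.zero by metis
    next
      case False
      then have "s 1 = 0 + (\<lambda>_. b / a) * s 0" using ab by (simp add: fun_eq_iff)
      moreover have "0 + (\<lambda>_. b / a) * s 0 \<in> ideal_span (polyfun 0) (s ` {..<1})"
        by (intro ideal_span.step ideal_span.zero polyfun.const) simp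
      ultimately show ?thesis by metis
    qed
  qed
next
  case (Suc m)
  then show ?case unfolding polyfun_Suc by (rule noetherian_adjoin[OF subring_polyfun])
qed

text \<open>Zariski quasi-compactness of subsets of \<open>k\<^sup>m\<close>: a sequence in which each function is nonzero
  at a common zero of its predecessors would violate the chain condition.\<close>

lemma polyfun_quasi_compact:
  fixes Q :: "((nat \<Rightarrow> 'k::field) \<Rightarrow> 'k) set"
  assumes Q: "Q \<subseteq> polyfun m"
  shows "\<exists>Q0. finite Q0 \<and> Q0 \<subseteq> Q \<and> (\<forall>y. (\<exists>q\<in>Q. q y \<noteq> 0) \<longrightarrow> (\<exists>q\<in>Q0. q y \<noteq> 0))"
proof (rule ccontr)
  assume contra: "\<not> ?thesis"
  define new where "new B = (SOME q. q \<in> Q \<and> (\<exists>y. q y \<noteq> 0 \<and> (\<forall>p\<in>B. p y = 0)))"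
    for B :: "((nat \<Rightarrow> 'k) \<Rightarrow> 'k) set"
  have new: "new B \<in> Q \<and> (\<exists>y. new B y \<noteq> 0 \<and> (\<forall>p\<in>B. p y = 0))" if "finite B" "B \<subseteq> Q" for B
  proof -
    have "\<not> (\<forall>y. (\<exists>q\<in>Q. q y \<noteq> 0) \<longrightarrow> (\<exists>q\<in>B. q y \<noteq> 0))"
    proof
      assume "\<forall>y. (\<exists>q\<in>Q. q y \<noteq> 0) \<longrightarrow> (\<exists>q\<in>B. q y \<noteq> 0)"
      with that have "finite B \<and> B \<subseteq> Q \<and> (\<forall>y. (\<exists>q\<in>Q. q y \<noteq> 0) \<longrightarrow> (\<exists>q\<in>B. q y \<noteq> 0))" by simp
      with contra show False by (elim notE, intro exI[of _ B])
    qed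
    then obtain q y where "q \<in> Q" "q y \<noteq> 0" "\<forall>p\<in>B. p y = 0" by auto
    then have "\<exists>q. q \<in> Q \<and> (\<exists>y. q y \<noteq> 0 \<and> (\<forall>p\<in>B. p y = 0))" by auto
    then show ?thesis unfolding new_def by (rule someI_ex)
  qed
  define F where "F = rec_nat {} (\<lambda>_ B. insert (new B) B)"
  have F_simps: "F 0 = {}" "F (Suc n) = insert (new (F n)) (F n)" for n
    by (simp_all add: F_def)
  define s where "s n = new (F n)" for n
  have F_eq: "F n = s ` {..<n}" for n
    by (induction n) (auto simp: F_simps s_def lessThan_Suc)
  have F: "finite (F n) \<and> F n \<subseteq> Q" for n
    by (induction n) (auto simp: F_simps new)
  have s: "s n \<in> Q \<and> (\<exists>y. s n y \<noteq> 0 \<and> (\<forall>p\<in>F n. p y = 0))" for n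
    using new[of "F n"] F[of n] by (simp add: s_def)
  then have "range s \<subseteq> polyfun m" using Q by auto
  then obtain N where N: "s N \<in> ideal_span (polyfun m) (F N)"
    using noetherian_polyfun[of m] unfolding noetherian_set_def F_eq by metis
  obtain y where y: "s N y \<noteq> 0" "\<forall>p\<in>F N. p y = 0" using s[of N] by auto
  have "g y = 0" if "g \<in> ideal_span (polyfun m) (F N)" for g
    using that y(2) by induction auto
  from this[OF N] y(1) show False by simp
qed


section \<open>Algebraic dependence by counting\<close>

text \<open>Gaussian elimination: more unknowns than equations.\<close>

lemma homogeneous_system_nontrivial:
  fixes K :: "'b \<Rightarrow> 'a \<Rightarrow> 'k::field"
  assumes "finite B" "finite A" "card B < card A"
  shows "\<exists>c. (\<exists>a\<in>A. c a \<noteq> 0) \<and> (\<forall>b\<in>B. (\<Sum>a\<in>A. c a * K b a) = 0)"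
  using assms
proof (induction B arbitrary: A K)
  case empty
  then obtain a where "a \<in> A" by fastforce
  then show ?case by (intro exI[of _ "\<lambda>_. 1"]) auto
next
  case (insert b B)
  show ?case
  proof (cases "\<forall>a\<in>A. K b a = 0")
    case True
    have "card B < card A" using insert by simp
    from insert.IH[OF insert.prems(1) this, of K] True show ?thesis by auto
  next
    case False
    then obtain p where p: "p \<in> A" "K b p \<noteq> 0" by blast
    define A' where "A' = A - {p}"
    define K' where "K' b' a = K b' a - K b' p * K b a / K b p" for b' a
    have A': "finite A'" "card B < card A'" "A = insert p A'" "p \<notin> A'"
      using insert p by (auto simp: A'_def)
    from insert.IH[OF A'(1,2), of K'] obtain c where c: "\<exists>a\<in>A'. c a \<noteq> 0"
      "\<And>b'. b' \<in> B \<Longrightarrow> (\<Sum>a\<in>A'. c a * K' b' a) = 0" by blast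
    define S where "S = (\<Sum>a\<in>A'. c a * K b a)"
    define c' where "c' = c(p := - S / K b p)"
    have sum_c': "(\<Sum>a\<in>A. c' a * K b' a) = - S / K b p * K b' p + (\<Sum>a\<in>A'. c a * K b' a)" for b'
    proof -
      have "(\<Sum>a\<in>A'. c' a * K b' a) = (\<Sum>a\<in>A'. c a * K b' a)"
        using A'(4) by (intro sum.cong) (auto simp: c'_def)
      then show ?thesis using A' by (simp add: c'_def)
    qed
    have "(\<Sum>a\<in>A. c' a * K b a) = 0" using p by (simp add: sum_c' S_def)
    moreover have "(\<Sum>a\<in>A. c' a * K b' a) = 0" if "b' \<in> B" for b'
    proof -
      have "(\<Sum>a\<in>A'. c a * K' b' a) = (\<Sum>a\<in>A'. c a * K b' a) - (\<Sum>a\<in>A'. c a * K b a) * (K b' p / K b p)"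
        unfolding sum_distrib_right sum_subtractf[symmetric]
        by (intro sum.cong) (auto simp: K'_def algebra_simps)
      then show ?thesis using c(2)[OF that] by (simp add: sum_c' S_def)
    qed
    moreover have "\<exists>a\<in>A. c' a \<noteq> 0" using c(1) A' by (force simp: c'_def)
    ultimately show ?thesis by auto
  qed
qed

text \<open>The degree is taken in each variable separately, which leaves \<open>(D + 1) ^ m\<close> coefficients.\<close>

definition bounded_poly :: "nat \<Rightarrow> nat \<Rightarrow> ((nat \<Rightarrow> 'k::field) \<Rightarrow> 'k) set" where
  "bounded_poly m D = {F. \<exists>c. \<forall>y. F y =
     (\<Sum>b \<in> {..<m} \<rightarrow>\<^sub>E {..D}. c b * (\<Prod>i<m. y i ^ b i))}"

lemma finite_exponents: "finite ({..<m::nat} \<rightarrow>\<^sub>E {..D::nat})" "finite ({..<m} \<rightarrow>\<^sub>E {..<D})"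
  by (intro finite_PiE; simp)+

lemma bounded_poly_monom:
  assumes b: "b \<in> {..<m} \<rightarrow>\<^sub>E {..D}"
  shows "(\<lambda>y. c * (\<Prod>i<m. y i ^ b i)) \<in> bounded_poly m D"
  unfolding bounded_poly_def
proof (intro CollectI exI[of _ "\<lambda>b'. if b' = b then c else 0"] allI)
  fix y :: "nat \<Rightarrow> 'a"
  have "(\<Sum>b'\<in>{..<m} \<rightarrow>\<^sub>E {..D}. (if b' = b then c else 0) * (\<Prod>i<m. y i ^ b' i)) =
      (\<Sum>b'\<in>{..<m} \<rightarrow>\<^sub>E {..D}. if b' = b then c * (\<Prod>i<m. y i ^ b' i) else 0)"
    by (intro sum.cong) auto
  then show "c * (\<Prod>i<m. y i ^ b i) =
      (\<Sum>b'\<in>{..<m} \<rightarrow>\<^sub>E {..D}. (if b' = b then c else 0) * (\<Prod>i<m. y i ^ b' i))"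
    using b finite_exponents(1)[of m D] by (simp add: sum.delta)
qed

lemma bounded_poly_add:
  assumes "F \<in> bounded_poly m D" "G \<in> bounded_poly m D"
  shows "(\<lambda>y. F y + G y) \<in> bounded_poly m D"
proof -
  obtain c e where "\<And>y. F y = (\<Sum>b \<in> {..<m} \<rightarrow>\<^sub>E {..D}. c b * (\<Prod>i<m. y i ^ b i))"
    "\<And>y. G y = (\<Sum>b \<in> {..<m} \<rightarrow>\<^sub>E {..D}. e b * (\<Prod>i<m. y i ^ b i))"
    using assms unfolding bounded_poly_def by blast
  then show ?thesis unfolding bounded_poly_def
    by (intro CollectI exI[of _ "\<lambda>b. c b + e b"]) (simp add: sum.distrib distrib_right)
qed

lemma bounded_poly_zero: "(\<lambda>y. 0) \<in> bounded_poly m D"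
  unfolding bounded_poly_def by (intro CollectI exI[of _ "\<lambda>b. 0"]) simp

lemma bounded_poly_sum:
  assumes "\<And>a. a \<in> A \<Longrightarrow> F a \<in> bounded_poly m D"
  shows "(\<lambda>y. \<Sum>a\<in>A. F a y) \<in> bounded_poly m D"
  using assms
  by (induction A rule: infinite_finite_induct) (auto intro: bounded_poly_zero bounded_poly_add)

lemma bounded_poly_mono:
  assumes "F \<in> bounded_poly m D" "D \<le> E"
  shows "F \<in> bounded_poly m E"
proof -
  obtain c where F: "F = (\<lambda>y. \<Sum>b \<in> {..<m} \<rightarrow>\<^sub>E {..D}. c b * (\<Prod>i<m. y i ^ b i))"
    using assms(1) unfolding bounded_poly_def by blast
  have "{..<m} \<rightarrow>\<^sub>E {..D} \<subseteq> {..<m} \<rightarrow>\<^sub>E {..E}" using assms(2) by (intro PiE_mono) auto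
  then show ?thesis unfolding F by (intro bounded_poly_sum bounded_poly_monom) auto
qed

lemma bounded_poly_mult:
  assumes "F \<in> bounded_poly m D" "G \<in> bounded_poly m E"
  shows "(\<lambda>y. F y * G y) \<in> bounded_poly m (D + E)"
proof -
  obtain c where F: "F = (\<lambda>y. \<Sum>b \<in> {..<m} \<rightarrow>\<^sub>E {..D}. c b * (\<Prod>i<m. y i ^ b i))"
    using assms(1) unfolding bounded_poly_def by blast
  obtain e where G: "G = (\<lambda>y. \<Sum>b \<in> {..<m} \<rightarrow>\<^sub>E {..E}. e b * (\<Prod>i<m. y i ^ b i))"
    using assms(2) unfolding bounded_poly_def by blast
  have prod: "(\<Prod>i<m. y i ^ b i) * (\<Prod>i<m. y i ^ b' i) =
      (\<Prod>i<m. y i ^ ((\<lambda>i\<in>{..<m}. b i + b' i) i))" for b b' and y :: "nat \<Rightarrow> 'a"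
    unfolding prod.distrib[symmetric] by (intro prod.cong) (auto simp: power_add)
  have "F y * G y = (\<Sum>b \<in> {..<m} \<rightarrow>\<^sub>E {..D}. \<Sum>b' \<in> {..<m} \<rightarrow>\<^sub>E {..E}.
      (c b * e b') * (\<Prod>i<m. y i ^ ((\<lambda>i\<in>{..<m}. b i + b' i) i)))" for y
    unfolding F G sum_product prod[symmetric] by (simp add: mult_ac)
  moreover have "(\<lambda>i\<in>{..<m}. b i + b' i) \<in> {..<m} \<rightarrow>\<^sub>E {..D + E}"
    if "b \<in> {..<m} \<rightarrow>\<^sub>E {..D}" "b' \<in> {..<m} \<rightarrow>\<^sub>E {..E}" for b b'
    using that by (auto simp: restrict_PiE_iff intro!: add_mono dest: PiE_mem)
  ultimately show ?thesis by (simp only:) (intro bounded_poly_sum bounded_poly_monom)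
qed

lemma bounded_poly_const: "(\<lambda>y. c) \<in> bounded_poly m D"
  using bounded_poly_monom[of "\<lambda>i\<in>{..<m}. 0" m D c] by simp

lemma bounded_poly_power:
  "F \<in> bounded_poly m D \<Longrightarrow> (\<lambda>y. F y ^ n) \<in> bounded_poly m (n * D)"
  by (induction n) (auto intro: bounded_poly_const bounded_poly_mult)

lemma bounded_poly_prod:
  assumes "finite A" "\<And>a. a \<in> A \<Longrightarrow> F a \<in> bounded_poly m D"
  shows "(\<lambda>y. \<Prod>a\<in>A. F a y) \<in> bounded_poly m (card A * D)"
  using assms by (induction A) (auto intro: bounded_poly_const bounded_poly_mult)

lemma polyfun_bounded: "F \<in> polyfun m \<Longrightarrow> \<exists>D. F \<in> bounded_poly m D"
proof (induction rule: polyfun.induct)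
  case (const c)
  then show ?case using bounded_poly_const by blast
next
  case (var i)
  define b where "b = (\<lambda>j\<in>{..<m}. if j = i then 1 else 0 :: nat)"
  have "b \<in> {..<m} \<rightarrow>\<^sub>E {..1}" by (auto simp: b_def)
  from bounded_poly_monom[OF this, of 1] have "(\<lambda>y::nat \<Rightarrow> 'a. \<Prod>j<m. y j ^ b j) \<in> bounded_poly m 1"
    by simp
  moreover have "(\<Prod>j<m. y j ^ b j) = y i" for y :: "nat \<Rightarrow> 'a"
  proof -
    have "(\<Prod>j<m. y j ^ b j) = (\<Prod>j<m. if j = i then y j else 1)"
      by (intro prod.cong) (auto simp: b_def)
    then show ?thesis using var by (simp add: prod.delta)
  qed
  ultimately show ?case by auto
next
  case (add F G)
  then obtain D E where "F \<in> bounded_poly m D" "G \<in> bounded_poly m E" by blast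
  then have "F \<in> bounded_poly m (D + E)" "G \<in> bounded_poly m (D + E)"
    by (meson bounded_poly_mono le_add1 le_add2)+
  then show ?case using bounded_poly_add by blast
next
  case (mult F G)
  then show ?case using bounded_poly_mult by blast
qed

text \<open>Let \<open>n = m + 1\<close> functions be given on \<open>U\<close> that are, on each of finitely many patches, quotients of
  polynomials of degree at most \<open>D\<close> in \<open>m\<close> parameters.  There are \<open>d ^ n\<close> monomials of
  degree below \<open>d\<close> in these functions.  Clearing denominators by the \<open>d\<close>-th power of their
  product turns such a monomial into a polynomial of degree at most \<open>n * d * D\<close> on each patch, which
  has about \<open>(n * D * d) ^ m\<close> coefficients.  As \<open>n > m\<close>, for large \<open>d\<close> the monomials outnumber
  the coefficients of all patches together, and so they are linearly dependent.\<close>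

lemma algebraic_dependence:
  fixes h :: "nat \<Rightarrow> 'g \<Rightarrow> 'k::field" and P Q :: "'s \<Rightarrow> nat \<Rightarrow> (nat \<Rightarrow> 'k) \<Rightarrow> 'k"
  assumes fin: "finite T"
    and PQ: "\<And>s i. s \<in> T \<Longrightarrow> i < Suc m \<Longrightarrow> P s i \<in> polyfun m \<and> Q s i \<in> polyfun m"
    and patch: "\<And>g. g \<in> U \<Longrightarrow> \<exists>s\<in>T. \<forall>i<Suc m. Q s i (y s g) \<noteq> 0 \<and> h i g = P s i (y s g) / Q s i (y s g)"
  shows "\<exists>d c. (\<exists>a\<in>{..<Suc m} \<rightarrow>\<^sub>E {..<d}. c a \<noteq> 0) \<and>
    (\<forall>g\<in>U. (\<Sum>a\<in>{..<Suc m} \<rightarrow>\<^sub>E {..<d}. c a * (\<Prod>i<Suc m. h i g ^ a i)) = 0)"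
proof -
  let ?n = "Suc m"
  have "\<exists>D. \<forall>(s, i) \<in> T \<times> {..<?n}. P s i \<in> bounded_poly m D \<and> Q s i \<in> bounded_poly m D"
  proof -
    have "\<exists>D. P s i \<in> bounded_poly m D \<and> Q s i \<in> bounded_poly m D" if si: "s \<in> T" "i < ?n" for s i
    proof -
      obtain D E where "P s i \<in> bounded_poly m D" "Q s i \<in> bounded_poly m E"
        using PQ[OF si] polyfun_bounded by blast
      then show ?thesis by (meson bounded_poly_mono le_add1 le_add2)
    qed
    then obtain D where D: "\<And>s i. s \<in> T \<Longrightarrow> i < ?n \<Longrightarrow>
        P s i \<in> bounded_poly m (D s i) \<and> Q s i \<in> bounded_poly m (D s i)" by metis
    define E where "E = Max ((\<lambda>(s, i). D s i) ` (T \<times> {..<?n}))"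
    have "D s i \<le> E" if "s \<in> T" "i < ?n" for s i
      unfolding E_def using that fin by (intro Max_ge) auto
    then show ?thesis using D bounded_poly_mono by (intro exI[of _ E]) blast
  qed
  then obtain D where D: "\<And>s i. s \<in> T \<Longrightarrow> i < ?n \<Longrightarrow> P s i \<in> bounded_poly m D \<and> Q s i \<in> bounded_poly m D"
    by blast
  \<comment> \<open>Large enough for \<open>card T * (?n * D * d + 1) ^ m < d ^ ?n\<close>.\<close>
  define d where "d = Suc (card T * (?n * D + 1) ^ m)"
  define A where "A = ({..<?n} \<rightarrow>\<^sub>E {..<d})"
  define N where "N = ?n * (d * D)"
  define B where "B = T \<times> ({..<m} \<rightarrow>\<^sub>E {..N})"
  define H where "H s a z = (\<Prod>i<?n. P s i z ^ a i * Q s i z ^ (d - a i))" for s a z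
  have H: "H s a \<in> bounded_poly m N" if s: "s \<in> T" and a: "a \<in> A" for s a
  proof -
    have "(\<lambda>z. P s i z ^ a i * Q s i z ^ (d - a i)) \<in> bounded_poly m (d * D)" if i: "i < ?n" for i
    proof -
      have "a i \<le> d" using a i by (auto simp: A_def PiE_iff intro: less_imp_le)
      then have "a i * D + (d - a i) * D = d * D" by (metis add_mult_distrib le_add_diff_inverse)
      moreover have "(\<lambda>z. P s i z ^ a i * Q s i z ^ (d - a i)) \<in> bounded_poly m (a i * D + (d - a i) * D)"
        using D[OF s i] by (intro bounded_poly_mult bounded_poly_power) simp_all
      ultimately show ?thesis by simp
    qed
    then have "(\<lambda>z. \<Prod>i\<in>{..<?n}. P s i z ^ a i * Q s i z ^ (d - a i)) \<in>
        bounded_poly m (card {..<?n} * (d * D))"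
      by (intro bounded_poly_prod) simp_all
    then show ?thesis unfolding H_def N_def card_lessThan .
  qed
  then have "\<forall>s\<in>T. \<forall>a\<in>A. \<exists>k. \<forall>z. H s a z = (\<Sum>b \<in> {..<m} \<rightarrow>\<^sub>E {..N}. k b * (\<Prod>i<m. z i ^ b i))"
    by (auto simp: bounded_poly_def)
  then have "\<exists>k. \<forall>s\<in>T. \<forall>a\<in>A. \<forall>z.
      H s a z = (\<Sum>b \<in> {..<m} \<rightarrow>\<^sub>E {..N}. k s a b * (\<Prod>i<m. z i ^ b i))"
    unfolding bchoice_iff .
  then obtain k where k: "\<And>s a z. s \<in> T \<Longrightarrow> a \<in> A \<Longrightarrow>
      H s a z = (\<Sum>b \<in> {..<m} \<rightarrow>\<^sub>E {..N}. k s a b * (\<Prod>i<m. z i ^ b i))" by blast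
  have "card B = card T * (N + 1) ^ m"
    by (simp add: B_def card_cartesian_product card_PiE)
  also have "\<dots> \<le> card T * ((?n * D + 1) * d) ^ m"
  proof -
    have "N + 1 \<le> (?n * D + 1) * d" by (simp add: N_def d_def algebra_simps)
    then show ?thesis by (intro mult_left_mono power_mono) auto
  qed
  also have "\<dots> = card T * (?n * D + 1) ^ m * d ^ m" by (simp only: power_mult_distrib mult.assoc)
  also have "\<dots> < d * d ^ m" by (intro mult_strict_right_mono) (auto simp: d_def)
  also have "\<dots> = card A" by (simp add: A_def card_PiE)
  finally have "card B < card A" .
  moreover have "finite A" "finite B"
    using fin finite_exponents by (auto simp: A_def B_def)
  ultimately obtain c where c: "\<exists>a\<in>A. c a \<noteq> 0"
    and eq: "\<And>s b. (s, b) \<in> B \<Longrightarrow> (\<Sum>a\<in>A. c a * k s a b) = 0"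
    using homogeneous_system_nontrivial[of B A "\<lambda>(s, b) a. k s a b"] by fastforce
  have H_zero: "(\<Sum>a\<in>A. c a * H s a z) = 0" if s: "s \<in> T" for s z
  proof -
    have "(\<Sum>a\<in>A. c a * H s a z) =
        (\<Sum>a\<in>A. \<Sum>b \<in> {..<m} \<rightarrow>\<^sub>E {..N}. c a * k s a b * (\<Prod>i<m. z i ^ b i))"
      by (intro sum.cong refl) (simp add: k[OF s] sum_distrib_left mult.assoc)
    also have "\<dots> = (\<Sum>b \<in> {..<m} \<rightarrow>\<^sub>E {..N}. (\<Sum>a\<in>A. c a * k s a b) * (\<Prod>i<m. z i ^ b i))"
      by (subst sum.swap) (simp add: sum_distrib_right)
    also have "\<dots> = 0" using s eq by (intro sum.neutral) (auto simp: B_def)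
    finally show ?thesis .
  qed
  have "(\<Sum>a\<in>A. c a * (\<Prod>i<?n. h i g ^ a i)) = 0" if g: "g \<in> U" for g
  proof -
    obtain s where s: "s \<in> T" and Q: "\<And>i. i < ?n \<Longrightarrow> Q s i (y s g) \<noteq> 0"
      and h: "\<And>i. i < ?n \<Longrightarrow> h i g = P s i (y s g) / Q s i (y s g)" using patch[OF g] by blast
    define q where "q = (\<Prod>i<?n. Q s i (y s g) ^ d)"
    have "q \<noteq> 0" using Q by (simp add: q_def)
    have "H s a (y s g) = (\<Prod>i<?n. h i g ^ a i) * q" if a: "a \<in> A" for a
      unfolding H_def q_def prod.distrib[symmetric]
    proof (intro prod.cong refl)
      fix i assume i: "i \<in> {..<?n}"
      then have "a i \<le> d" using a by (auto simp: A_def PiE_iff intro: less_imp_le)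
      then have "Q s i (y s g) ^ d = Q s i (y s g) ^ a i * Q s i (y s g) ^ (d - a i)"
        by (simp flip: power_add)
      then show "P s i (y s g) ^ a i * Q s i (y s g) ^ (d - a i) = h i g ^ a i * Q s i (y s g) ^ d"
        using Q i h by (simp add: power_divide)
    qed
    then have "(\<Sum>a\<in>A. c a * (\<Prod>i<?n. h i g ^ a i)) * q = (\<Sum>a\<in>A. c a * H s a (y s g))"
      unfolding sum_distrib_right by (intro sum.cong) auto
    then show ?thesis using H_zero[OF s] \<open>q \<noteq> 0\<close> by simp
  qed
  then show ?thesis using c unfolding A_def by blast
qed

section \<open>Polynomials over the base field as functions\<close>



lemma polyfun_mpoly_eval:
  fixes p :: "'k::field mpoly"
  assumes p: "p \<in> mpoly_ring n"
  shows "(\<lambda>y. mpoly_eval y p) \<in> polyfun n"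
  unfolding mpoly_eval_def
proof (intro polyfun_sum polyfun.mult polyfun.const polyfun_prod polyfun_power)
  fix a i assume "a \<in> Poly_Mapping.keys p" "i \<in> Poly_Mapping.keys a"
  then have "i < n" using p by (auto simp: mpoly_ring_def)
  then show "(\<lambda>y. y i) \<in> polyfun n" by (rule polyfun.var)
qed

lemma mpoly_eval_mpoly_ac:
  fixes p :: "'k::field mpoly"
  assumes p: "p \<in> mpoly_ring n" and x: "\<And>i. i < n \<Longrightarrow> x i = to_ac (y i)"
  shows "mpoly_eval x (mpoly_ac p) = to_ac (mpoly_eval y p)"
proof -
  have keys: "Poly_Mapping.keys (mpoly_ac p) = Poly_Mapping.keys p"
    by (auto simp: Poly_Mapping.in_keys_iff map.rep_eq when_def)
  have lookup: "Poly_Mapping.lookup (mpoly_ac p) a = to_ac (Poly_Mapping.lookup p a)" for a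
    by (simp add: map.rep_eq when_def)
  show ?thesis unfolding mpoly_eval_def keys lookup to_ac_sum to_ac_mult to_ac_prod to_ac_power
  proof (intro sum.cong prod.cong refl arg_cong2[where f = "(*)"])
    fix a i assume "a \<in> Poly_Mapping.keys p" "i \<in> Poly_Mapping.keys a"
    then have "i < n" using p by (auto simp: mpoly_ring_def)
    then show "x i ^ Poly_Mapping.lookup a i = to_ac (y i) ^ Poly_Mapping.lookup a i"
      by (simp add: x)
  qed
qed


section \<open>Ergodicity of powers of a weakly mixing action\<close>

lemma pred_AE:
  assumes "sigma_finite_measure M" and P: "Measurable.pred (N \<Otimes>\<^sub>M M) (\<lambda>p. P (fst p) (snd p))"
  shows "Measurable.pred N (\<lambda>x. AE y in M. P x y)"
proof -
  interpret sigma_finite_measure M by fact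
  define Q where "Q = {p \<in> space (N \<Otimes>\<^sub>M M). \<not> P (fst p) (snd p)}"
  have Q: "Q \<in> sets (N \<Otimes>\<^sub>M M)" unfolding Q_def using P by measurable
  have "(AE y in M. P x y) \<longleftrightarrow> emeasure M (Pair x -` Q) = 0" if x: "x \<in> space N" for x
  proof -
    have "Pair x -` Q = {y \<in> space M. \<not> P x y}"
      using x by (auto simp: Q_def space_pair_measure)
    moreover have "Pair x -` Q \<in> sets M" by (rule sets_Pair1[OF Q])
    ultimately show ?thesis by (intro AE_iff_measurable) auto
  qed
  moreover have "Measurable.pred N (\<lambda>x. emeasure M (Pair x -` Q) = 0)"
    using measurable_emeasure_Pair[OF Q] by measurable
  ultimately show ?thesis by (simp cong: measurable_cong)
qed

lemma AE_PiM_insert: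
  assumes M: "prob_space M" and P: "Measurable.pred (PiM (insert i I) (\<lambda>_. M)) P"
  shows "(AE w in PiM (insert i I) (\<lambda>_. M). P w) \<longleftrightarrow>
    (AE x in M. AE w in PiM I (\<lambda>_. M). P (w(i := x)))"
proof -
  interpret M: prob_space M by fact
  interpret I: prob_space "PiM I (\<lambda>_. M)" by (intro prob_space_PiM M)
  interpret pair_prob_space M "PiM I (\<lambda>_. M)" ..
  let ?f = "\<lambda>(x, w). w(i := x)"
  have f: "?f \<in> measurable (M \<Otimes>\<^sub>M PiM I (\<lambda>_. M)) (PiM (insert i I) (\<lambda>_. M))"
    by measurable
  have "(AE w in PiM (insert i I) (\<lambda>_. M). P w) \<longleftrightarrow>
      (AE w in distr (M \<Otimes>\<^sub>M PiM I (\<lambda>_. M)) (PiM (insert i I) (\<lambda>_. M)) ?f. P w)"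
    by (subst distr_pair_PiM_eq_PiM[of I "\<lambda>_. M" i]) (simp_all add: M)
  also have "\<dots> \<longleftrightarrow> (AE p in M \<Otimes>\<^sub>M PiM I (\<lambda>_. M). P (?f p))"
    by (rule AE_distr_iff[OF f]) (use P in measurable)
  also have "\<dots> \<longleftrightarrow> (AE x in M. AE w in PiM I (\<lambda>_. M). P (w(i := x)))"
    using measurable_compose[OF f P]
    by (subst AE_pair_iff) (auto simp: case_prod_beta pred_def)
  finally show ?thesis .
qed

text \<open>A set that does not depend, up to null sets, on any single coordinate is trivial.  By induction
  almost every section in direction \<open>i\<close> is null or conull, and all these sections agree almost
  everywhere with one of them.\<close>

lemma zero_one_coordinates:
  assumes M: "prob_space M" and "finite I" and "E \<in> sets (PiM I (\<lambda>_. M))"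
    and "\<And>i. i \<in> I \<Longrightarrow> AE w in PiM I (\<lambda>_. M). AE y in M. w \<in> E \<longleftrightarrow> w(i := y) \<in> E"
  shows "(AE w in PiM I (\<lambda>_. M). w \<in> E) \<or> (AE w in PiM I (\<lambda>_. M). w \<notin> E)"
  using assms(2-)
proof (induction I arbitrary: E)
  case empty
  show ?case
    by (cases "(\<lambda>_. undefined) \<in> E") (auto intro!: AE_I2 simp: space_PiM)
next
  case (insert i J)
  interpret M: prob_space M by fact
  let ?P = "PiM J (\<lambda>_. M)" and ?Q = "PiM (insert i J) (\<lambda>_. M)"
  interpret J: prob_space ?P by (intro prob_space_PiM M)
  interpret MJ: pair_prob_space M ?P ..
  interpret JM: pair_prob_space ?P M ..
  interpret MM: pair_prob_space M M ..
  note E[measurable] = insert.prems(1)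
  define Ex where "Ex x = {w \<in> space ?P. w(i := x) \<in> E}" for x
  have upd: "(\<lambda>w. w(i := x)) \<in> measurable ?P ?Q" if "x \<in> space M" for x
    using that by measurable
  have Ex: "Ex x \<in> sets ?P" if "x \<in> space M" for x
    unfolding Ex_def using measurable_sets[OF upd[OF that] E]
    by (simp add: vimage_def Collect_conj_eq Int_commute)
  have pred: "Measurable.pred ?Q (\<lambda>w. AE y in M. w \<in> E \<longleftrightarrow> w(j := y) \<in> E)"
    if "j \<in> insert i J" for j
  proof (rule pred_AE)
    have "(\<lambda>p. (fst p)(j := snd p)) \<in> measurable (?Q \<Otimes>\<^sub>M M)
        (PiM (insert j (insert i J)) (\<lambda>_. M))" by measurable
    moreover have "insert j (insert i J) = insert i J" using that by auto
    ultimately have [measurable]: "(\<lambda>p. (fst p)(j := snd p)) \<in>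
        measurable (?Q \<Otimes>\<^sub>M M) ?Q" by simp
    show "Measurable.pred (?Q \<Otimes>\<^sub>M M)
        (\<lambda>p. fst p \<in> E \<longleftrightarrow> (fst p)(j := snd p) \<in> E)" by measurable
  qed (rule M.sigma_finite_measure_axioms)
  have fiber: "AE x in M. AE w in ?P. AE y in M. w(i := x) \<in> E \<longleftrightarrow> w(i := y) \<in> E"
    using AE_PiM_insert[OF M pred, of i, THEN iffD1, OF _ insert.prems(2)[of i]] by simp
  have commute: "(AE w in ?P. AE y in M. w(i := x) \<in> E \<longleftrightarrow> w(i := y) \<in> E) \<longleftrightarrow>
      (AE y in M. AE w in ?P. w(i := x) \<in> E \<longleftrightarrow> w(i := y) \<in> E)" if x: "x \<in> space M" for x
  proof (rule JM.AE_commute)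
    have [measurable]: "(\<lambda>p. (fst p)(i := x)) \<in> measurable (?P \<Otimes>\<^sub>M M) ?Q"
      using x by measurable
    show "{p \<in> space (?P \<Otimes>\<^sub>M M). ((fst p)(i := x) \<in> E) = ((fst p)(i := snd p) \<in> E)} \<in> sets (?P \<Otimes>\<^sub>M M)"
      by measurable
  qed
  from fiber AE_space
  have indep: "AE x in M. AE y in M. AE w in ?P. w(i := x) \<in> E \<longleftrightarrow> w(i := y) \<in> E"
    by eventually_elim (simp add: commute)
  have "AE x in M. AE w in ?P. AE y in M. w(i := x) \<in> E \<longleftrightarrow> w(i := x, j := y) \<in> E"
    if "j \<in> J" for j
    using AE_PiM_insert[OF M pred, of j, THEN iffD1, OF _ insert.prems(2)[of j]] that by simp
  then have "AE x in M. \<forall>j\<in>J. AE w in ?P. AE y in M. w(i := x) \<in> E \<longleftrightarrow> w(i := x, j := y) \<in> E"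
    using \<open>finite J\<close> by (simp add: AE_finite_all)
  with indep have "AE x in M. (AE y in M. AE w in ?P. w(i := x) \<in> E \<longleftrightarrow> w(i := y) \<in> E) \<and>
      (\<forall>j\<in>J. AE w in ?P. AE y in M. w(i := x) \<in> E \<longleftrightarrow> w(i := x, j := y) \<in> E)"
    by (rule AE_conjI)
  with AE_space have "AE x in M. x \<in> space M \<and>
      (AE y in M. AE w in ?P. w(i := x) \<in> E \<longleftrightarrow> w(i := y) \<in> E) \<and>
      (\<forall>j\<in>J. AE w in ?P. AE y in M. w(i := x) \<in> E \<longleftrightarrow> w(i := x, j := y) \<in> E)"
    by (rule AE_conjI)
  then obtain x where x: "x \<in> space M"
    and x_indep: "AE y in M. AE w in ?P. w(i := x) \<in> E \<longleftrightarrow> w(i := y) \<in> E"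
    and x_coord: "\<And>j. j \<in> J \<Longrightarrow> AE w in ?P. AE y in M. w(i := x) \<in> E \<longleftrightarrow> w(i := x, j := y) \<in> E"
    using eventually_happens'[OF M.ae_filter_bot] by blast
  have "(AE w in ?P. w \<in> Ex x) \<or> (AE w in ?P. w \<notin> Ex x)"
  proof (rule insert.IH[OF Ex[OF x]])
    fix j assume j: "j \<in> J"
    with insert.hyps have "i \<noteq> j" by auto
    from x_coord[OF j] AE_space
    show "AE w in ?P. AE y in M. w \<in> Ex x \<longleftrightarrow> w(j := y) \<in> Ex x"
    proof eventually_elim
      case (elim w)
      from elim(1) AE_space show ?case
      proof eventually_elim
        case (elim y)
        then have "w(j := y) \<in> space ?P"
          using \<open>w \<in> space ?P\<close> j by (auto simp: space_PiM PiE_iff extensional_def)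
        then show ?case using elim \<open>w \<in> space ?P\<close> fun_upd_twist[OF \<open>i \<noteq> j\<close>, of w x y] by (simp add: Ex_def)
      qed
    qed
  qed
  then have "(AE w in ?P. w(i := x) \<in> E) \<or> (AE w in ?P. w(i := x) \<notin> E)"
  proof
    assume "AE w in ?P. w \<in> Ex x"
    then have "AE w in ?P. w(i := x) \<in> E" by eventually_elim (simp add: Ex_def)
    then show ?thesis ..
  next
    assume "AE w in ?P. w \<notin> Ex x"
    with AE_space have "AE w in ?P. w(i := x) \<notin> E" by eventually_elim (simp add: Ex_def)
    then show ?thesis ..
  qed
  then have "(AE y in M. AE w in ?P. w(i := y) \<in> E) \<or> (AE y in M. AE w in ?P. w(i := y) \<notin> E)"
  proof (elim disjE)
    assume a: "AE w in ?P. w(i := x) \<in> E"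
    from x_indep have "AE y in M. AE w in ?P. w(i := y) \<in> E"
    proof eventually_elim
      case (elim y)
      from elim a show ?case by eventually_elim simp
    qed
    then show ?thesis ..
  next
    assume a: "AE w in ?P. w(i := x) \<notin> E"
    from x_indep have "AE y in M. AE w in ?P. w(i := y) \<notin> E"
    proof eventually_elim
      case (elim y)
      from elim a show ?case by eventually_elim simp
    qed
    then show ?thesis ..
  qed
  then show ?case by (simp add: AE_PiM_insert[OF M])
qed

text \<open>Countably many sets approximate all sections of \<open>E\<close> at once.  For rectangles two sets suffice, and
  the property passes to complements and, by truncation, to disjoint countable unions; so it holds
  for all \<open>E\<close> by the pi-lambda theorem.\<close>

lemma separable_sections:
  assumes N: "finite_measure N" and E: "E \<in> sets (M \<Otimes>\<^sub>M N)"
  shows "\<exists>B. countable B \<and> B \<subseteq> sets N \<and> (\<forall>x\<in>space M. \<forall>e>0. \<exists>b\<in>B.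
    measure N ((Pair x -` E - b) \<union> (b - Pair x -` E)) < e)"
proof -
  interpret finite_measure N by fact
  let ?G = "{A \<times> B | A B. A \<in> sets M \<and> B \<in> sets N}"
  let ?d = "\<lambda>A b. (A - b) \<union> (b - A)"
  have sub: "?G \<subseteq> Pow (space M \<times> space N)"
    by (rule pair_measure_closed)
  have "E \<in> sigma_sets (space M \<times> space N) ?G"
    using E by (simp add: sets_pair_measure)
  from Int_stable_pair_measure_generator sub this show ?thesis
  proof (induction rule: sigma_sets_induct_disjoint)
    case (basic R)
    then obtain A B where R: "R = A \<times> B" "A \<in> sets M" "B \<in> sets N" by auto
    have "\<exists>b\<in>{{}, B}. measure N (?d (Pair x -` R) b) < e" if "e > 0" for x e
      using that by (cases "x \<in> A") (auto simp: R)
    then show ?case using R(3) by (intro exI[of _ "{{}, B}"]) auto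
  next
    case empty
    show ?case by (intro exI[of _ "{{}}"]) auto
  next
    case (compl A)
    from compl(2) obtain B where "countable B \<and> B \<subseteq> sets N \<and>
        (\<forall>x\<in>space M. \<forall>e>0. \<exists>b\<in>B. measure N (?d (Pair x -` A) b) < e)" ..
    then have B: "countable B" "B \<subseteq> sets N"
      "\<And>x e. x \<in> space M \<Longrightarrow> e > 0 \<Longrightarrow> \<exists>b\<in>B. measure N (?d (Pair x -` A) b) < e" by simp_all
    have "\<exists>b\<in>(\<lambda>b. space N - b) ` B. measure N (?d (Pair x -` (space M \<times> space N - A)) b) < e"
      if x: "x \<in> space M" "e > 0" for x and e :: real
    proof -
      obtain b where b: "b \<in> B" "measure N (?d (Pair x -` A) b) < e" using B(3)[OF x] by blast
      have "b \<subseteq> space N" using b(1) B(2) sets.sets_into_space by blast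
      have "A \<subseteq> space M \<times> space N"
        using compl(1) sigma_sets_into_sp[OF sub] by blast
      then have "?d (Pair x -` (space M \<times> space N - A)) (space N - b) = ?d (Pair x -` A) b"
        using x \<open>b \<subseteq> space N\<close> by auto
      then have "measure N (?d (Pair x -` (space M \<times> space N - A)) (space N - b)) < e"
        using b(2) by (simp only:)
      then show ?thesis by (rule bexI[OF _ imageI[OF b(1)]])
    qed
    moreover have "(\<lambda>b. space N - b) ` B \<subseteq> sets N" using B(2) by auto
    ultimately show ?case using B(1)
      by (intro exI[of _ "(\<lambda>b. space N - b) ` B"] conjI ballI allI impI) simp_all
  next
    case (union A)
    from choice[OF allI, OF union(3)] obtain B where
      "\<forall>i. countable (B i) \<and> B i \<subseteq> sets N \<and>
        (\<forall>x\<in>space M. \<forall>e>0. \<exists>b\<in>B i. measure N (?d (Pair x -` A i) b) < e)" ..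
    then have B: "\<And>i. countable (B i)" "\<And>i. B i \<subseteq> sets N"
      "\<And>i x e. x \<in> space M \<Longrightarrow> e > 0 \<Longrightarrow> \<exists>b\<in>B i. measure N (?d (Pair x -` A i) b) < e"
      by simp_all
    define C where "C = (\<lambda>l. \<Union> (set l)) ` lists (\<Union>i. B i)"
    have C: "countable C" unfolding C_def using B(1) by auto
    have C_sets: "C \<subseteq> sets N" unfolding C_def using B(2) by (fastforce simp: lists_eq_set)
    have "\<exists>b\<in>C. measure N (?d (Pair x -` (\<Union>i. A i)) b) < e"
      if x: "x \<in> space M" and e: "e > 0" for x and e :: real
    proof -
      define S where "S i = Pair x -` A i" for i
      have S: "S i \<in> sets N" for i
        unfolding S_def using union(2) by (intro sets_Pair1) (auto simp: sets_pair_measure)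
      define T where "T m = (\<Union>i<m. S i)" for m
      have T: "T m \<in> sets N" for m using S by (auto simp: T_def)
      have UT: "(\<Union>m. T m) = (\<Union>i. S i)" by (auto simp: T_def)
      have "(\<lambda>m. measure N (T m)) \<longlonglongrightarrow> measure N (\<Union>m. T m)"
      proof (rule finite_Lim_measure_incseq)
        show "range T \<subseteq> sets N" using T by auto
        show "incseq T" unfolding incseq_def T_def by (intro allI impI UN_mono) auto
      qed
      then obtain m where "dist (measure N (T m)) (measure N (\<Union>i. S i)) < e / 2"
        using e unfolding UT lim_sequentially by (meson half_gt_zero order_refl)
      then have m: "measure N ((\<Union>i. S i) - T m) < e / 2"
      proof -
        have sub: "T m \<subseteq> (\<Union>i. S i)" by (auto simp: T_def)
        have "(\<Union>i. S i) \<in> sets N" using S by auto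
        with finite_measure_Diff[OF _ T sub] finite_measure_mono[OF sub]
        show ?thesis using \<open>dist _ _ < e / 2\<close> by (simp add: dist_real_def)
      qed
      define r where "r = e / (2 * real (Suc m))"
      have "r > 0" using e by (simp add: r_def)
      then have "\<forall>i. \<exists>b\<in>B i. measure N (?d (S i) b) < r" using B(3)[OF x] by (simp add: S_def)
      then obtain b where b: "\<And>i. b i \<in> B i" "\<And>i. measure N (?d (S i) (b i)) < r" by metis
      have b_sets: "b i \<in> sets N" for i using b(1) B(2) by blast
      have "(\<Union>i<m. b i) \<in> C"
        unfolding C_def using b(1) by (intro image_eqI[of _ _ "map b [0..<m]"]) (auto simp: lists_eq_set)
      moreover have "measure N (?d (\<Union>i. S i) (\<Union>i<m. b i)) < e"
      proof -
        have "measure N (?d (\<Union>i. S i) (\<Union>i<m. b i)) \<le>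
            measure N (((\<Union>i. S i) - T m) \<union> (\<Union>i<m. ?d (S i) (b i)))"
          using S T b_sets by (intro finite_measure_mono) (auto simp: T_def)
        also have "\<dots> \<le> measure N ((\<Union>i. S i) - T m) + measure N (\<Union>i<m. ?d (S i) (b i))"
          using S T b_sets by (intro measure_Un_le) auto
        also have "measure N (\<Union>i<m. ?d (S i) (b i)) \<le> (\<Sum>i<m. measure N (?d (S i) (b i)))"
          using S b_sets by (intro measure_UNION_le) auto
        also have "\<dots> \<le> (\<Sum>i<m. r)" using b(2) by (intro sum_mono less_imp_le)
        also have "\<dots> = real m * r" by simp
        also have "\<dots> \<le> e / 2"
          using e by (simp add: r_def field_simps)
        finally show ?thesis using m by simp
      qed
      moreover have "Pair x -` (\<Union>i. A i) = (\<Union>i. S i)" by (auto simp: S_def)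
      ultimately show ?thesis by auto
    qed
    then show ?case using C C_sets by (intro exI[of _ C] conjI ballI allI impI)
  qed
qed

text \<open>The function \<open>F (x, y)\<close>, the \<open>N\<close>-measure of the symmetric difference of the sections of \<open>E\<close>
  over \<open>x\<close> and \<open>y\<close>, is invariant under the diagonal action at every point, because \<open>\<psi>\<close>
  preserves \<open>N\<close>.  Its sublevel sets are therefore admissible in the definition of ergodicity, which
  tests strictly invariant sets only, and so each of them is null or conull.  It is not null: countably many
  small balls, for the distance between sections, cover \<open>M\<close>, one of them has positive measure, and
  \<open>F\<close> is small on the square of it.  Hence \<open>F\<close> vanishes almost everywhere.\<close>

lemma weakly_mixing_sections:
  assumes M: "prob_space M" and N: "prob_space N" and wm: "weakly_mixing L \<phi> M"
    and phi: "\<And>g. g \<in> L \<Longrightarrow> \<phi> g \<in> measurable M M"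
    and psi: "\<And>g. g \<in> L \<Longrightarrow> \<psi> g \<in> measurable N N \<and> distr N N (\<psi> g) = N"
    and E: "E \<in> sets (M \<Otimes>\<^sub>M N)"
    and inv: "\<And>g x w. g \<in> L \<Longrightarrow> x \<in> space M \<Longrightarrow> w \<in> space N \<Longrightarrow>
      (\<phi> g x, \<psi> g w) \<in> E \<longleftrightarrow> (x, w) \<in> E"
  shows "AE p in M \<Otimes>\<^sub>M M. AE w in N. (fst p, w) \<in> E \<longleftrightarrow> (snd p, w) \<in> E"
proof -
  interpret M: prob_space M by fact
  interpret N: prob_space N by fact
  interpret MM: pair_prob_space M M ..
  define Q where "Q = {q \<in> space ((M \<Otimes>\<^sub>M M) \<Otimes>\<^sub>M N).
    ((fst (fst q), snd q) \<in> E) \<noteq> ((snd (fst q), snd q) \<in> E)}"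
  note E[measurable]
  have Q: "Q \<in> sets ((M \<Otimes>\<^sub>M M) \<Otimes>\<^sub>M N)" unfolding Q_def by measurable
  define F where "F p = emeasure N (Pair p -` Q)" for p
  have F[measurable]: "F \<in> borel_measurable (M \<Otimes>\<^sub>M M)"
    unfolding F_def by (rule N.measurable_emeasure_Pair[OF Q])
  have sec: "Pair p -` Q = {w \<in> space N. ((fst p, w) \<in> E) \<noteq> ((snd p, w) \<in> E)}"
    if "p \<in> space (M \<Otimes>\<^sub>M M)" for p
    using that by (auto simp: Q_def space_pair_measure)
  have sec_sets: "Pair p -` Q \<in> sets N" for p by (rule sets_Pair1[OF Q])
  have phi_space: "map_prod (\<phi> g) (\<phi> g) p \<in> space (M \<Otimes>\<^sub>M M)"
    if "g \<in> L" "p \<in> space (M \<Otimes>\<^sub>M M)" for g p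
    using that measurable_space[OF phi] by (auto simp: space_pair_measure)
  have F_inv: "F (map_prod (\<phi> g) (\<phi> g) p) = F p" if g: "g \<in> L" and p: "p \<in> space (M \<Otimes>\<^sub>M M)" for g p
  proof -
    let ?q = "map_prod (\<phi> g) (\<phi> g) p"
    have "F ?q = emeasure (distr N N (\<psi> g)) (Pair ?q -` Q)"
      using psi[OF g] by (simp add: F_def)
    also have "\<dots> = emeasure N (\<psi> g -` (Pair ?q -` Q) \<inter> space N)"
      using psi[OF g] sec_sets by (intro emeasure_distr) auto
    also have "\<psi> g -` (Pair ?q -` Q) \<inter> space N = Pair p -` Q"
      unfolding sec[OF phi_space[OF g p]] sec[OF p]
      using p inv[OF g] measurable_space[of "\<psi> g" N N] psi[OF g]
      by (auto simp: space_pair_measure)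
    finally show ?thesis by (simp add: F_def)
  qed
  from separable_sections[OF N.finite_measure_axioms E] obtain B where
    "countable B \<and> B \<subseteq> sets N \<and> (\<forall>x\<in>space M. \<forall>e>0. \<exists>b\<in>B.
      measure N ((Pair x -` E - b) \<union> (b - Pair x -` E)) < e)" ..
  then have B: "countable B" "B \<subseteq> sets N"
    "\<And>x e. x \<in> space M \<Longrightarrow> e > 0 \<Longrightarrow> \<exists>b\<in>B. measure N ((Pair x -` E - b) \<union> (b - Pair x -` E)) < e"
    by simp_all
  have small: "AE p in M \<Otimes>\<^sub>M M. F p \<le> ennreal e" if e: "e > 0" for e :: real
  proof -
    define A where "A = {p \<in> space (M \<Otimes>\<^sub>M M). F p \<le> ennreal e}"
    have A: "A \<in> sets (M \<Otimes>\<^sub>M M)" unfolding A_def by measurable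
    have A_inv: "\<forall>g\<in>L. map_prod (\<phi> g) (\<phi> g) -` A \<inter> space (M \<Otimes>\<^sub>M M) = A"
      using F_inv phi_space by (auto simp: A_def)
    define D where "D b x = emeasure N ({w \<in> space N. ((x, w) \<in> E) \<noteq> (w \<in> b)})" for b x
    define U where "U b = {x \<in> space M. D b x < ennreal (e / 2)}" for b
    have U[measurable]: "U b \<in> sets M" if b: "b \<in> B" for b
    proof -
      have [measurable]: "b \<in> sets N" using B(2) b by blast
      have R: "{p \<in> space (M \<Otimes>\<^sub>M N). (p \<in> E) \<noteq> (snd p \<in> b)} \<in> sets (M \<Otimes>\<^sub>M N)" (is "?R \<in> _")
        by measurable
      have "D b x = emeasure N (Pair x -` ?R)" if "x \<in> space M" for x
        unfolding D_def using that by (intro arg_cong[where f = "emeasure N"]) (auto simp: space_pair_measure)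
      moreover have "{x \<in> space M. emeasure N (Pair x -` ?R) < ennreal (e / 2)} \<in> sets M"
        using N.measurable_emeasure_Pair[OF R] by measurable
      ultimately show ?thesis unfolding U_def by (simp cong: conj_cong)
    qed
    have D_sets: "{w \<in> space N. ((x, w) \<in> E) \<noteq> (w \<in> b)} \<in> sets N" if "x \<in> space M" "b \<in> B" for x b
    proof -
      have [measurable]: "b \<in> sets N" using B(2) that by blast
      have [measurable]: "Pair x \<in> measurable N (M \<Otimes>\<^sub>M N)" using that by measurable
      show ?thesis by measurable
    qed
    have cover: "space M \<subseteq> (\<Union>b\<in>B. U b)"
    proof
      fix x assume x: "x \<in> space M"
      then obtain b where b: "b \<in> B" "measure N ((Pair x -` E - b) \<union> (b - Pair x -` E)) < e / 2"
        using B(3)[OF x, of "e / 2"] e by auto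
      have "{w \<in> space N. ((x, w) \<in> E) \<noteq> (w \<in> b)} = (Pair x -` E - b) \<union> (b - Pair x -` E)"
        using b(1) B(2) sets.sets_into_space[of b N] sets.sets_into_space[OF sets_Pair1[OF E, of x]]
        by auto
      then have "D b x < ennreal (e / 2)"
        unfolding D_def N.emeasure_eq_measure using b(2) e by (simp add: ennreal_lessI)
      then show "x \<in> (\<Union>b\<in>B. U b)" using x b(1) by (auto simp: U_def)
    qed
    have "\<exists>b\<in>B. emeasure M (U b) \<noteq> 0"
    proof (rule ccontr)
      assume "\<not> ?thesis"
      then have "(\<Union>b\<in>B. U b) \<in> null_sets M"
        using B(1) U by (intro null_sets_UN') (auto simp: null_sets_def)
      then have "space M \<in> null_sets M" using cover null_sets_subset[of "\<Union>b\<in>B. U b" M "space M"] by auto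
      then show False using M.emeasure_space_1 by auto
    qed
    then obtain b where b: "b \<in> B" "emeasure M (U b) \<noteq> 0" by blast
    have "U b \<times> U b \<subseteq> A"
    proof clarify
      fix x y assume x: "x \<in> U b" and y: "y \<in> U b"
      then have xy: "x \<in> space M" "y \<in> space M" by (auto simp: U_def)
      have "F (x, y) \<le> emeasure N ({w \<in> space N. ((x, w) \<in> E) \<noteq> (w \<in> b)} \<union>
          {w \<in> space N. ((y, w) \<in> E) \<noteq> (w \<in> b)})"
        unfolding F_def using xy D_sets b(1)
        by (intro emeasure_mono sets.Un) (auto simp: sec space_pair_measure)
      also have "\<dots> \<le> D b x + D b y"
        unfolding D_def using xy D_sets b(1) by (intro emeasure_subadditive)
      also have "\<dots> \<le> ennreal (e / 2) + ennreal (e / 2)"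
        using x y by (intro add_mono) (auto simp: U_def)
      also have "\<dots> = ennreal e" using e by (simp flip: ennreal_plus)
      finally show "(x, y) \<in> A" using xy by (auto simp: A_def space_pair_measure)
    qed
    then have "emeasure (M \<Otimes>\<^sub>M M) (U b \<times> U b) \<le> emeasure (M \<Otimes>\<^sub>M M) A"
      by (rule emeasure_mono[OF _ A])
    moreover have "emeasure (M \<Otimes>\<^sub>M M) (U b \<times> U b) = emeasure M (U b) * emeasure M (U b)"
      using U[OF b(1)] by (simp add: M.emeasure_pair_measure_Times)
    ultimately have "emeasure (M \<Otimes>\<^sub>M M) A \<noteq> 0" using b(2) by auto
    then have "emeasure (M \<Otimes>\<^sub>M M) (space (M \<Otimes>\<^sub>M M) - A) = 0"
      using wm A A_inv unfolding weakly_mixing_def ergodic_def by blast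
    moreover have "{p \<in> space (M \<Otimes>\<^sub>M M). \<not> F p \<le> ennreal e} = space (M \<Otimes>\<^sub>M M) - A"
      by (auto simp: A_def)
    ultimately show ?thesis using A by (subst AE_iff_measurable[OF _ refl]) auto
  qed
  have "AE p in M \<Otimes>\<^sub>M M. F p \<le> 0"
    by (rule AE_upper_bound_inf_ennreal) (use small in simp)
  with AE_space show ?thesis
  proof eventually_elim
    case (elim p)
    then have "emeasure N (Pair p -` Q) = 0" by (simp add: F_def)
    then show ?case using sec[OF elim(1)] sec_sets[of p]
      by (subst AE_iff_measurable[OF _ refl]) auto
  qed
qed

text \<open>For each coordinate \<open>i\<close>, the power splits as a product of \<open>M\<close> and the power over the other
  coordinates, and the previous lemma says that membership in \<open>E\<close> does not depend on coordinate
  \<open>i\<close>.\<close>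

lemma weakly_mixing_power_ergodic:
  assumes M: "prob_space M" and wm: "weakly_mixing L \<phi> M"
    and inv: "invariant_measure L \<phi> M" and I: "finite I"
    and E: "E \<in> sets (PiM I (\<lambda>_. M))"
    and E_inv: "\<And>g w. g \<in> L \<Longrightarrow> w \<in> space (PiM I (\<lambda>_. M)) \<Longrightarrow> (\<lambda>i\<in>I. \<phi> g (w i)) \<in> E \<longleftrightarrow> w \<in> E"
  shows "(AE w in PiM I (\<lambda>_. M). w \<in> E) \<or> (AE w in PiM I (\<lambda>_. M). w \<notin> E)"
proof (rule zero_one_coordinates[OF M I E])
  interpret M: prob_space M by fact
  have phi[measurable]: "\<phi> g \<in> measurable M M" and phi_distr: "distr M M (\<phi> g) = M" if "g \<in> L" for g
    using inv that by (auto simp: invariant_measure_def)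
  fix i assume i: "i \<in> I"
  define J where "J = I - {i}"
  have J: "finite J" "insert i J = I" "i \<notin> J" using I i by (auto simp: J_def)
  let ?P = "PiM J (\<lambda>_. M)"
  interpret J: prob_space ?P by (intro prob_space_PiM M)
  interpret pair_prob_space M ?P ..
  interpret MM: pair_prob_space M M ..
  interpret PM: product_prob_space "\<lambda>_. M" J by standard
  define \<psi> where "\<psi> g w = (\<lambda>j\<in>J. \<phi> g (w j))" for g w
  define E' where "E' = {p \<in> space (M \<Otimes>\<^sub>M ?P). (snd p)(i := fst p) \<in> E}"
  have upd: "(\<lambda>p. (snd p)(i := fst p)) \<in> measurable (M \<Otimes>\<^sub>M ?P) (PiM I (\<lambda>_. M))"
    unfolding J(2)[symmetric] by measurable
  have E': "E' \<in> sets (M \<Otimes>\<^sub>M ?P)"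
    using measurable_sets[OF upd E] by (simp add: E'_def vimage_def Collect_conj_eq Int_commute)
  have psi: "\<psi> g \<in> measurable ?P ?P \<and> distr ?P ?P (\<psi> g) = ?P" if g: "g \<in> L" for g
  proof
    show meas: "\<psi> g \<in> measurable ?P ?P"
      unfolding \<psi>_def using phi[OF g] by measurable
    show "distr ?P ?P (\<psi> g) = ?P"
    proof (rule PM.PiM_eqI[OF J(1)])
      fix A assume A: "\<And>j. j \<in> J \<Longrightarrow> A j \<in> sets M"
      then have "emeasure (distr ?P ?P (\<psi> g)) (Pi\<^sub>E J A) = emeasure ?P (\<psi> g -` Pi\<^sub>E J A \<inter> space ?P)"
        using J(1) by (intro emeasure_distr[OF meas] sets_PiM_I_finite) auto
      also have "\<psi> g -` Pi\<^sub>E J A \<inter> space ?P = (\<Pi>\<^sub>E j\<in>J. \<phi> g -` A j \<inter> space M)"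
        by (auto simp: \<psi>_def space_PiM PiE_iff extensional_def)
      also have "emeasure ?P (\<Pi>\<^sub>E j\<in>J. \<phi> g -` A j \<inter> space M) = (\<Prod>j\<in>J. emeasure M (\<phi> g -` A j \<inter> space M))"
        using J(1) A phi[OF g] by (intro PM.emeasure_PiM) auto
      also have "\<dots> = (\<Prod>j\<in>J. emeasure M (A j))"
        using phi_distr[OF g] A by (intro prod.cong refl) (metis emeasure_distr phi[OF g])
      finally show "emeasure (distr ?P ?P (\<psi> g)) (Pi\<^sub>E J A) = (\<Prod>j\<in>J. emeasure M (A j))" .
    qed simp
  qed
  have E'_inv: "(\<phi> g x, \<psi> g w) \<in> E' \<longleftrightarrow> (x, w) \<in> E'"
    if g: "g \<in> L" and x: "x \<in> space M" and w: "w \<in> space ?P" for g x w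
  proof -
    have "w(i := x) \<in> space (PiM I (\<lambda>_. M))"
      using measurable_space[OF upd, of "(x, w)"] x w by (simp add: space_pair_measure)
    moreover have "(\<psi> g w)(i := \<phi> g x) = (\<lambda>j\<in>I. \<phi> g ((w(i := x)) j))"
      using J(2,3) by (auto simp: \<psi>_def fun_eq_iff)
    moreover have "\<phi> g x \<in> space M" by (rule measurable_space[OF phi[OF g] x])
    moreover have "\<psi> g w \<in> space ?P" by (rule measurable_space[OF conjunct1[OF psi[OF g]] w])
    ultimately show ?thesis using E_inv[OF g, of "w(i := x)"] x w
      by (simp add: E'_def space_pair_measure del: fun_upd_apply)
  qed
  have "AE p in M \<Otimes>\<^sub>M M. AE w in ?P. (fst p, w) \<in> E' \<longleftrightarrow> (snd p, w) \<in> E'"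
    by (rule weakly_mixing_sections[OF M J.prob_space_axioms wm phi psi E' E'_inv])
  then have "AE x in M. AE y in M. AE w in ?P. (x, w) \<in> E' \<longleftrightarrow> (y, w) \<in> E'"
    using MM.AE_pair by fastforce
  then have swapped: "AE x in M. AE w in ?P. AE y in M. w(i := x) \<in> E \<longleftrightarrow> w(i := y) \<in> E"
    using AE_space
  proof eventually_elim
    case (elim x)
    have "AE w in ?P. AE y in M. (x, w) \<in> E' \<longleftrightarrow> (y, w) \<in> E'"
    proof (rule AE_commute[THEN iffD1, OF _ elim(1)])
      note E'[measurable]
      have [measurable]: "(\<lambda>p. (x, snd p)) \<in> measurable (M \<Otimes>\<^sub>M ?P) (M \<Otimes>\<^sub>M ?P)"
        using elim(2) by measurable
      have "{p \<in> space (M \<Otimes>\<^sub>M ?P). ((x, snd p) \<in> E') = (p \<in> E')} \<in> sets (M \<Otimes>\<^sub>M ?P)"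
        by measurable
      then show "{p \<in> space (M \<Otimes>\<^sub>M ?P). ((x, snd p) \<in> E') = ((fst p, snd p) \<in> E')} \<in> sets (M \<Otimes>\<^sub>M ?P)"
        by simp
    qed
    with AE_space show ?case
    proof eventually_elim
      case (elim w)
      from elim(2) AE_space show ?case
        by eventually_elim (use \<open>x \<in> space M\<close> elim(1) in \<open>simp add: E'_def space_pair_measure\<close>)
    qed
  qed
  have pred: "Measurable.pred (PiM I (\<lambda>_. M)) (\<lambda>w. AE y in M. w \<in> E \<longleftrightarrow> w(i := y) \<in> E)"
  proof (rule pred_AE)
    note E[measurable]
    have "(\<lambda>p. (fst p)(i := snd p)) \<in> measurable (PiM I (\<lambda>_. M) \<Otimes>\<^sub>M M) (PiM (insert i I) (\<lambda>_. M))"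
      by measurable
    then have [measurable]: "(\<lambda>p. (fst p)(i := snd p)) \<in> measurable (PiM I (\<lambda>_. M) \<Otimes>\<^sub>M M) (PiM I (\<lambda>_. M))"
      using i by (simp add: insert_absorb)
    show "Measurable.pred (PiM I (\<lambda>_. M) \<Otimes>\<^sub>M M) (\<lambda>p. fst p \<in> E \<longleftrightarrow> (fst p)(i := snd p) \<in> E)"
      by measurable
  qed (rule M.sigma_finite_measure_axioms)
  show "AE w in PiM I (\<lambda>_. M). AE y in M. w \<in> E \<longleftrightarrow> w(i := y) \<in> E"
    using AE_PiM_insert[OF M, where i = i and I = J] pred swapped unfolding J(2) by simp
qed


text \<open>A nonzero polynomial has finitely many roots, each of them attained by \<open>f\<close> on a null set only.\<close>

lemma AE_univariate_relation_trivial: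
  fixes f :: "'x \<Rightarrow> 'k::field"
  assumes S: "S \<in> sets M" "emeasure M S \<noteq> 0"
    and f: "\<And>a. {x \<in> S. f x = a} \<in> null_sets M"
    and rel: "AE x in M. x \<in> S \<longrightarrow> (\<Sum>e<d. c e * f x ^ e) = 0"
    and e: "e < d"
  shows "c e = 0"
proof (rule ccontr)
  assume "c e \<noteq> 0"
  define p where "p = (\<Sum>e<d. Polynomial.monom (c e) e)"
  have "Polynomial.coeff p e = c e"
    using e by (simp add: p_def coeff_sum if_distrib sum.delta' cong: if_cong)
  then have "p \<noteq> 0" using \<open>c e \<noteq> 0\<close> by auto
  have poly: "poly p y = (\<Sum>e<d. c e * y ^ e)" for y
    by (simp add: p_def poly_sum poly_monom)
  define R where "R = {y. poly p y = 0}"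
  have "finite R" unfolding R_def by (rule poly_roots_finite[OF \<open>p \<noteq> 0\<close>])
  then have null: "(\<Union>a\<in>R. {x \<in> S. f x = a}) \<in> null_sets M"
    using f by (intro null_sets_UN' countable_finite)
  from AE_not_in[OF null] rel have "AE x in M. x \<notin> S"
    by eventually_elim (auto simp: R_def poly)
  then show False using S AE_iff_null_sets[OF S(1)] by auto
qed

text \<open>Independent copies of a variable without atoms are algebraically independent: fix one variable,
  apply the induction hypothesis to the others, and what remains are relations in one variable.\<close>

lemma AE_polynomial_relation_trivial:
  fixes f :: "'x \<Rightarrow> 'k::field"
  assumes M: "prob_space M" and S: "S \<in> sets M" "emeasure M S \<noteq> 0"
    and f: "\<And>a. {x \<in> S. f x = a} \<in> null_sets M"
    and I: "finite I"
    and rel: "AE w in PiM I (\<lambda>_. M). (\<forall>i\<in>I. w i \<in> S) \<longrightarrow>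
      (\<Sum>a\<in>I \<rightarrow>\<^sub>E {..<d}. c a * (\<Prod>i\<in>I. f (w i) ^ a i)) = 0"
    and a: "a \<in> I \<rightarrow>\<^sub>E {..<d}"
  shows "c a = 0"
  using I rel a
proof (induction I arbitrary: c a)
  case empty
  interpret P: prob_space "PiM {} (\<lambda>_. M)" by (intro prob_space_PiM M)
  from empty(1) have "AE w in PiM {} (\<lambda>_. M). c (\<lambda>_. undefined) = 0" by simp
  then show ?case using empty(2) by simp
next
  case (insert i J)
  interpret M: prob_space M by fact
  let ?P = "PiM J (\<lambda>_. M)"
  interpret J: prob_space ?P by (intro prob_space_PiM M)
  interpret pair_prob_space M ?P ..
  let ?f = "\<lambda>(x, w). w(i := x)"
  have sum: "(\<Sum>a\<in>insert i J \<rightarrow>\<^sub>E {..<d}. c a * (\<Prod>j\<in>insert i J. f ((w(i := x)) j) ^ a j)) =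
      (\<Sum>b\<in>J \<rightarrow>\<^sub>E {..<d}. (\<Sum>e<d. c (b(i := e)) * f x ^ e) * (\<Prod>j\<in>J. f (w j) ^ b j))" for x w
  proof -
    have inj: "inj_on (\<lambda>(e, b). b(i := e)) ({..<d} \<times> (J \<rightarrow>\<^sub>E {..<d}))"
      using inj_combinator'[OF insert.hyps(2), of "\<lambda>_. {..<d}"] by (auto simp: inj_on_def)
    have prod: "(\<Prod>j\<in>insert i J. f ((w(i := x)) j) ^ (b(i := e)) j) = f x ^ e * (\<Prod>j\<in>J. f (w j) ^ b j)"
      for b e
    proof -
      have "(\<Prod>j\<in>J. f ((w(i := x)) j) ^ (b(i := e)) j) = (\<Prod>j\<in>J. f (w j) ^ b j)"
        using insert.hyps by (intro prod.cong) auto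
      then show ?thesis using insert.hyps by simp
    qed
    have "(\<Sum>a\<in>insert i J \<rightarrow>\<^sub>E {..<d}. c a * (\<Prod>j\<in>insert i J. f ((w(i := x)) j) ^ a j)) =
        (\<Sum>(e, b)\<in>{..<d} \<times> (J \<rightarrow>\<^sub>E {..<d}). c (b(i := e)) * (f x ^ e * (\<Prod>j\<in>J. f (w j) ^ b j)))"
      unfolding PiE_insert_eq sum.reindex[OF inj]
      by (intro sum.cong refl) (simp only: comp_def case_prod_beta prod)
    also have "\<dots> = (\<Sum>e<d. \<Sum>b\<in>J \<rightarrow>\<^sub>E {..<d}. c (b(i := e)) * f x ^ e * (\<Prod>j\<in>J. f (w j) ^ b j))"
      by (simp add: sum.cartesian_product mult.assoc)
    also have "\<dots> = (\<Sum>b\<in>J \<rightarrow>\<^sub>E {..<d}. \<Sum>e<d. c (b(i := e)) * f x ^ e * (\<Prod>j\<in>J. f (w j) ^ b j))"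
      by (rule sum.swap)
    finally show ?thesis by (simp only: sum_distrib_right)
  qed
  have "AE w in distr (M \<Otimes>\<^sub>M ?P) (PiM (insert i J) (\<lambda>_. M)) ?f. (\<forall>j\<in>insert i J. w j \<in> S) \<longrightarrow>
      (\<Sum>a\<in>insert i J \<rightarrow>\<^sub>E {..<d}. c a * (\<Prod>j\<in>insert i J. f (w j) ^ a j)) = 0"
    by (subst distr_pair_PiM_eq_PiM[of J "\<lambda>_. M" i]) (use M insert.prems(1) in simp_all)
  from AE_distrD[OF _ this] have "AE p in M \<Otimes>\<^sub>M ?P. (\<forall>j\<in>insert i J. ?f p j \<in> S) \<longrightarrow>
      (\<Sum>a\<in>insert i J \<rightarrow>\<^sub>E {..<d}. c a * (\<Prod>j\<in>insert i J. f (?f p j) ^ a j)) = 0"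
    by measurable
  from AE_pair[OF this] have "AE x in M. AE w in ?P. (\<forall>j\<in>insert i J. (w(i := x)) j \<in> S) \<longrightarrow>
      (\<Sum>b\<in>J \<rightarrow>\<^sub>E {..<d}. (\<Sum>e<d. c (b(i := e)) * f x ^ e) * (\<Prod>j\<in>J. f (w j) ^ b j)) = 0"
    unfolding prod.case sum .
  then have "AE x in M. x \<in> S \<longrightarrow> (\<forall>b\<in>J \<rightarrow>\<^sub>E {..<d}. (\<Sum>e<d. c (b(i := e)) * f x ^ e) = 0)"
  proof (rule AE_mp, intro AE_I2 impI ballI)
    fix x b assume rel: "AE w in ?P. (\<forall>j\<in>insert i J. (w(i := x)) j \<in> S) \<longrightarrow>
      (\<Sum>b\<in>J \<rightarrow>\<^sub>E {..<d}. (\<Sum>e<d. c (b(i := e)) * f x ^ e) * (\<Prod>j\<in>J. f (w j) ^ b j)) = 0"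
      and x: "x \<in> S" and b: "b \<in> J \<rightarrow>\<^sub>E {..<d}"
    from rel have "AE w in ?P. (\<forall>j\<in>J. w j \<in> S) \<longrightarrow>
      (\<Sum>b\<in>J \<rightarrow>\<^sub>E {..<d}. (\<Sum>e<d. c (b(i := e)) * f x ^ e) * (\<Prod>j\<in>J. f (w j) ^ b j)) = 0"
      by eventually_elim (use x in auto)
    then show "(\<Sum>e<d. c (b(i := e)) * f x ^ e) = 0" using b by (rule insert.IH)
  qed
  then have uni: "AE x in M. x \<in> S \<longrightarrow> (\<Sum>e<d. c (b(i := e)) * f x ^ e) = 0"
    if "b \<in> J \<rightarrow>\<^sub>E {..<d}" for b
    by eventually_elim (use that in blast)
  obtain e b where "e < d" "b \<in> J \<rightarrow>\<^sub>E {..<d}" "a = b(i := e)"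
    using insert.prems(2) unfolding PiE_insert_eq by auto
  then show ?case using AE_univariate_relation_trivial[OF S f uni] by (simp del: fun_upd_apply)
qed


section \<open>Limits in a valued field\<close>

locale valued =
  fixes v :: "'k::field \<Rightarrow> real"
  assumes absolute_value: "absolute_value v"
begin

lemma v_nonneg [simp]: "0 \<le> v x"
  and v_eq_0 [simp]: "v x = 0 \<longleftrightarrow> x = 0"
  and v_mult: "v (x * y) = v x * v y"
  and v_add: "v (x + y) \<le> v x + v y"
  using absolute_value unfolding absolute_value_def by blast+

lemma v_0 [simp]: "v 0 = 0"
  by simp

lemma v_minus_commute: "v (x - y) = v (y - x)"
proof -
  interpret Metric_space UNIV "val_dist v" by (rule Metric_space_val_dist[OF absolute_value])
  show ?thesis using commute[of x y] by (simp add: val_dist_def)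
qed

lemma v_triangle: "v (x - z) \<le> v (x - y) + v (y - z)"
  using v_add[of "x - y" "y - z"] by simp

lemma v_diff_abs: "\<bar>v x - v y\<bar> \<le> v (x - y)"
  using v_add[of "x - y" y] v_add[of "y - x" x] v_minus_commute[of x y] by simp

text \<open>Limits with respect to \<open>v\<close> are reduced to limits of real functions, since the type \<open>'k\<close> itself
  carries no topology.\<close>

definition vlim :: "'b filter \<Rightarrow> ('b \<Rightarrow> 'k) \<Rightarrow> 'k \<Rightarrow> bool" where
  "vlim F f a \<longleftrightarrow> ((\<lambda>y. v (f y - a)) \<longlongrightarrow> 0) F"

lemma vlim_bound:
  assumes "(h \<longlongrightarrow> 0) F" "eventually (\<lambda>y. v (f y - a) \<le> h y) F"
  shows "vlim F f a"
  unfolding vlim_def by (rule tendsto_sandwich[OF _ assms(2) tendsto_const assms(1)]) simp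

lemma vlim_less: "vlim F f a \<longleftrightarrow> (\<forall>e>0. eventually (\<lambda>y. v (f y - a) < e) F)"
  by (simp add: vlim_def tendsto_iff)

lemma vlim_mono: "vlim F f a \<Longrightarrow> G \<le> F \<Longrightarrow> vlim G f a"
  unfolding vlim_def by (rule tendsto_mono)

lemma vlim_cong: "eventually (\<lambda>y. f y = g y) F \<Longrightarrow> vlim F g a \<Longrightarrow> vlim F f a"
  unfolding vlim_less by (auto elim: eventually_elim2)

lemma vlim_const: "vlim F (\<lambda>_. a) a"
  by (simp add: vlim_def)

lemma vlim_add:
  assumes "vlim F f a" "vlim F g b"
  shows "vlim F (\<lambda>y. f y + g y) (a + b)"
proof (rule vlim_bound)
  show "((\<lambda>y. v (f y - a) + v (g y - b)) \<longlongrightarrow> 0) F"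
    using tendsto_add[OF assms[unfolded vlim_def]] by simp
  have "v (f y + g y - (a + b)) \<le> v (f y - a) + v (g y - b)" for y
    using v_add[of "f y - a" "g y - b"] by (simp add: algebra_simps)
  then show "eventually (\<lambda>y. v (f y + g y - (a + b)) \<le> v (f y - a) + v (g y - b)) F" by simp
qed

lemma vlim_mult:
  assumes "vlim F f a" "vlim F g b"
  shows "vlim F (\<lambda>y. f y * g y) (a * b)"
proof (rule vlim_bound)
  let ?h = "\<lambda>y. v (f y - a) * v (g y - b) + v a * v (g y - b) + v b * v (f y - a)"
  show "(?h \<longlongrightarrow> 0) F"
    using assms unfolding vlim_def by (auto intro!: tendsto_eq_intros)
  have "v (f y * g y - a * b) \<le> ?h y" for y
  proof -
    have "f y * g y - a * b = ((f y - a) * (g y - b) + a * (g y - b)) + b * (f y - a)"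
      by (simp add: algebra_simps)
    then show ?thesis
      using v_add[of "(f y - a) * (g y - b) + a * (g y - b)" "b * (f y - a)"]
        v_add[of "(f y - a) * (g y - b)" "a * (g y - b)"] by (simp add: v_mult)
  qed
  then show "eventually (\<lambda>y. v (f y * g y - a * b) \<le> ?h y) F" by simp
qed

lemma vlim_diff:
  assumes "vlim F f a" "vlim F g b"
  shows "vlim F (\<lambda>y. f y - g y) (a - b)"
  using vlim_add[OF assms(1) vlim_mult[OF vlim_const[of F "-1"] assms(2)]] by simp

lemma vlim_nonzero:
  assumes "vlim F f a" "a \<noteq> 0"
  shows "eventually (\<lambda>y. f y \<noteq> 0) F"
proof -
  have "v a > 0" using assms(2) by (simp add: order_less_le)
  then have "eventually (\<lambda>y. v (f y - a) < v a) F" using assms(1) by (auto simp: vlim_less)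
  then show ?thesis
    by eventually_elim (use v_minus_commute[of 0 a] in auto)
qed

lemma vlim_inverse:
  assumes "vlim F f a" "a \<noteq> 0"
  shows "vlim F (\<lambda>y. inverse (f y)) (inverse a)"
proof (rule vlim_bound)
  have "((\<lambda>y. v (f y) - v a) \<longlongrightarrow> 0) F"
    by (rule tendsto_rabs_zero_cancel, rule tendsto_sandwich[OF _ _ tendsto_const assms(1)[unfolded vlim_def]])
      (simp_all add: v_diff_abs)
  then have "((\<lambda>y. v (f y)) \<longlongrightarrow> v a) F" by (simp add: LIM_zero_iff)
  then show "((\<lambda>y. v (f y - a) * inverse (v (f y) * v a)) \<longlongrightarrow> 0) F"
    using assms unfolding vlim_def by (auto intro!: tendsto_eq_intros)
  have "v (inverse x - inverse a) = v (x - a) * inverse (v x * v a)" if "x \<noteq> 0" for x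
  proof -
    have "(inverse x - inverse a) * (x * a) = a - x" using that assms(2) by (simp add: field_simps)
    then have "v (inverse x - inverse a) * (v x * v a) = v (x - a)"
      unfolding v_mult[symmetric] by (simp add: v_minus_commute)
    moreover have "v x * v a \<noteq> 0" using that assms(2) by simp
    ultimately show ?thesis by (simp add: field_simps)
  qed
  with vlim_nonzero[OF assms]
  show "eventually (\<lambda>y. v (inverse (f y) - inverse a) \<le> v (f y - a) * inverse (v (f y) * v a)) F"
    by (simp add: eventually_mono)
qed

lemma vlim_divide:
  assumes "vlim F f a" "vlim F g b" "b \<noteq> 0"
  shows "vlim F (\<lambda>y. f y / g y) (a / b)"
  using vlim_mult[OF assms(1) vlim_inverse[OF assms(2,3)]] by (simp add: divide_inverse)

lemma vlim_sum:
  assumes "\<And>i. i \<in> A \<Longrightarrow> vlim F (f i) (a i)"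
  shows "vlim F (\<lambda>y. \<Sum>i\<in>A. f i y) (\<Sum>i\<in>A. a i)"
  using assms
  by (induction A rule: infinite_finite_induct) (auto intro!: vlim_const vlim_add)

lemma vlim_prod:
  assumes "\<And>i. i \<in> A \<Longrightarrow> vlim F (f i) (a i)"
  shows "vlim F (\<lambda>y. \<Prod>i\<in>A. f i y) (\<Prod>i\<in>A. a i)"
  using assms
  by (induction A rule: infinite_finite_induct) (auto intro!: vlim_const vlim_mult)

lemma vlim_power: "vlim F f a \<Longrightarrow> vlim F (\<lambda>y. f y ^ n) (a ^ n)"
  by (induction n) (auto intro!: vlim_const vlim_mult)

lemma vlim_polyfun:
  assumes "p \<in> polyfun m" "\<And>i. i < m \<Longrightarrow> vlim F (\<lambda>y. s y i) (a i)"
  shows "vlim F (\<lambda>y. p (s y)) (p a)"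
  using assms
  by (induction rule: polyfun.induct) (auto intro!: vlim_const vlim_add vlim_mult)

end


section \<open>Rational points in charts\<close>

text \<open>Membership in the set of rational points refers to some chart.  The next lemmas show that the
  coordinates of a rational point are rational in every chart containing it.\<close>

definition rational_in :: "('x, 'k::field) chart \<Rightarrow> 'x \<Rightarrow> bool" where
  "rational_in c x \<longleftrightarrow> x \<in> cdom c \<and> (\<forall>i<cdim c. coord c x i \<in> range to_ac)"

lemma rational_in_coord: "rational_in c x \<Longrightarrow> i < cdim c \<Longrightarrow> coord c x i = to_ac (k_coord c x i)"
  by (simp add: rational_in_def k_coord_def to_ac_of_ac)

lemma k_points_eq: "k_points V = {x \<in> pts V. \<exists>c\<in>charts V. rational_in c x}"
  by (simp add: k_points_def rational_in_def)

lemma mpoly_eval_rational: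
  assumes "p \<in> mpoly_ring (cdim c)" "rational_in c x"
  shows "mpoly_eval (coord c x) (mpoly_ac p) = to_ac (mpoly_eval (k_coord c x) p)"
  using assms by (intro mpoly_eval_mpoly_ac rational_in_coord) auto

lemma k_open_polyfun:
  assumes "k_open c W"
  obtains S where "S \<subseteq> polyfun (cdim c)"
    "\<And>x. rational_in c x \<Longrightarrow> x \<in> W \<longleftrightarrow> (\<exists>q\<in>S. q (k_coord c x) \<noteq> 0)"
proof -
  obtain S where S: "S \<subseteq> mpoly_ring (cdim c)"
    and W: "W = {x \<in> cdom c. \<exists>p\<in>S. mpoly_eval (coord c x) (mpoly_ac p) \<noteq> 0}"
    using assms unfolding k_open_def by blast
  show thesis
  proof
    show "(\<lambda>p y. mpoly_eval y p) ` S \<subseteq> polyfun (cdim c)"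
      using S polyfun_mpoly_eval by blast
    fix x assume x: "rational_in c x"
    then have "x \<in> cdom c" by (simp add: rational_in_def)
    then show "x \<in> W \<longleftrightarrow> (\<exists>q\<in>(\<lambda>p y. mpoly_eval y p) ` S. q (k_coord c x) \<noteq> 0)"
      using S mpoly_eval_rational[OF _ x] by (auto simp: W subset_iff)
  qed
qed

lemma k_regular_polyfun:
  assumes "k_regular c W f" "x \<in> W" "rational_in c x"
  obtains p q where "p \<in> polyfun (cdim c)" "q \<in> polyfun (cdim c)" "q (k_coord c x) \<noteq> 0"
    "\<And>y. y \<in> W \<Longrightarrow> rational_in c y \<Longrightarrow> q (k_coord c y) \<noteq> 0 \<Longrightarrow>
       f y = to_ac (p (k_coord c y) / q (k_coord c y))"
proof -
  from assms(1,2) obtain p q where p: "p \<in> mpoly_ring (cdim c)" and q: "q \<in> mpoly_ring (cdim c)"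
    and qx: "mpoly_eval (coord c x) (mpoly_ac q) \<noteq> 0"
    and f: "\<And>y. y \<in> W \<Longrightarrow> mpoly_eval (coord c y) (mpoly_ac q) \<noteq> 0 \<Longrightarrow>
      f y = mpoly_eval (coord c y) (mpoly_ac p) / mpoly_eval (coord c y) (mpoly_ac q)"
    unfolding k_regular_def by metis
  show thesis
  proof (rule that[OF polyfun_mpoly_eval[OF p] polyfun_mpoly_eval[OF q]])
    show "mpoly_eval (k_coord c x) q \<noteq> 0"
      using qx mpoly_eval_rational[OF q assms(3)] by simp
    fix y assume "y \<in> W" "rational_in c y" "mpoly_eval (k_coord c y) q \<noteq> 0"
    then show "f y = to_ac (mpoly_eval (k_coord c y) p / mpoly_eval (k_coord c y) q)"
      using f[of y] mpoly_eval_rational[OF p] mpoly_eval_rational[OF q] by simp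
  qed
qed

lemma k_morphism_charts_polyfun:
  assumes f: "k_morphism_charts c d f" and x: "rational_in c x" "f x \<in> cdom d" and j: "j < cdim d"
  obtains p q where "p \<in> polyfun (cdim c)" "q \<in> polyfun (cdim c)" "q (k_coord c x) \<noteq> 0"
    "\<And>y. rational_in c y \<Longrightarrow> f y \<in> cdom d \<Longrightarrow> q (k_coord c y) \<noteq> 0 \<Longrightarrow>
       coord d (f y) j = to_ac (p (k_coord c y) / q (k_coord c y))"
proof -
  have reg: "k_regular c {x \<in> cdom c. f x \<in> cdom d} (\<lambda>x. coord d (f x) j)"
    using f j by (simp add: k_morphism_charts_def)
  have "x \<in> {x \<in> cdom c. f x \<in> cdom d}" using x by (simp add: rational_in_def)
  from k_regular_polyfun[OF reg this x(1)] obtain p q where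
    "p \<in> polyfun (cdim c)" "q \<in> polyfun (cdim c)" "q (k_coord c x) \<noteq> 0"
    "\<And>y. y \<in> {x \<in> cdom c. f x \<in> cdom d} \<Longrightarrow> rational_in c y \<Longrightarrow> q (k_coord c y) \<noteq> 0 \<Longrightarrow>
       coord d (f y) j = to_ac (p (k_coord c y) / q (k_coord c y))" by blast
  then show thesis by (intro that[of p q]) (auto simp: rational_in_def)
qed

lemma k_morphism_charts_rational:
  assumes f: "k_morphism_charts c d f" and x: "rational_in c x" "f x \<in> cdom d"
  shows "rational_in d (f x)"
  unfolding rational_in_def
proof (intro conjI allI impI)
  fix j assume "j < cdim d"
  from k_morphism_charts_polyfun[OF f x this] show "coord d (f x) j \<in> range to_ac"
    using x by (metis rangeI)
qed (rule x(2))

lemma rational_in_k_point: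
  assumes V: "k_variety V" and "x \<in> k_points V" "c \<in> charts V" "x \<in> cdom c"
  shows "rational_in c x"
proof -
  obtain d where "d \<in> charts V" "rational_in d x" using assms(2) by (auto simp: k_points_eq)
  moreover then have "k_morphism_charts d c (\<lambda>x. x)"
    using V assms(3) by (simp add: k_variety_def)
  ultimately show ?thesis
    using k_morphism_charts_rational[of d c "\<lambda>x. x" x] assms(4) by simp
qed

lemma k_point_if_rational_in: "k_variety V \<Longrightarrow> c \<in> charts V \<Longrightarrow> rational_in c x \<Longrightarrow> x \<in> k_points V"
  by (auto simp: k_points_eq k_variety_def rational_in_def)

lemma k_point_chart:
  assumes "x \<in> k_points V"
  obtains c where "c \<in> charts V" "x \<in> cdom c"
  using assms by (auto simp: k_points_def)

lemma rational_in_prod_chart: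
  "rational_in e g \<Longrightarrow> rational_in d x \<Longrightarrow> rational_in (prod_chart e d) (g, x)"
  by (auto simp: rational_in_def prod_chart_def)

lemma cdim_prod_chart: "cdim (prod_chart e d) = cdim e + cdim d"
  by (simp add: prod_chart_def)

lemma k_coord_prod_chart:
  "i < cdim e + cdim d \<Longrightarrow> k_coord (prod_chart e d) (g, x) i =
     (if i < cdim e then k_coord e g i else k_coord d x (i - cdim e))"
  by (auto simp: k_coord_def prod_chart_def)

context valued
begin

text \<open>Morphisms are continuous at rational points, in the form needed for both changes of charts and the
  maps \<open>x \<mapsto> \<phi> g x\<close>: the variable point is \<open>s y\<close>, so that \<open>s\<close> may also be a slice of a product.\<close>

lemma k_morphism_charts_vlim:
  assumes f: "k_morphism_charts c d f" and x: "rational_in c x" "f x \<in> cdom d"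
    and rat: "eventually (\<lambda>y. rational_in c (s y)) F"
    and lim: "\<And>i. i < cdim c \<Longrightarrow> vlim F (\<lambda>y. k_coord c (s y) i) (k_coord c x i)"
  shows "eventually (\<lambda>y. f (s y) \<in> cdom d) F"
    and "\<And>j. j < cdim d \<Longrightarrow> vlim F (\<lambda>y. k_coord d (f (s y)) j) (k_coord d (f x) j)"
proof -
  have poly: "vlim F (\<lambda>y. p (k_coord c (s y))) (p (k_coord c x))" if "p \<in> polyfun (cdim c)" for p
    using that lim by (rule vlim_polyfun)
  have "k_open c {x \<in> cdom c. f x \<in> cdom d}" using f by (simp add: k_morphism_charts_def)
  then obtain S where S: "S \<subseteq> polyfun (cdim c)"
    and W: "\<And>x. rational_in c x \<Longrightarrow> x \<in> {x \<in> cdom c. f x \<in> cdom d} \<longleftrightarrow> (\<exists>q\<in>S. q (k_coord c x) \<noteq> 0)"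
    by (rule k_open_polyfun) (rule that; assumption)
  obtain q where q: "q \<in> S" "q (k_coord c x) \<noteq> 0" using W[OF x(1)] x by (auto simp: rational_in_def)
  from q S have "eventually (\<lambda>y. q (k_coord c (s y)) \<noteq> 0) F"
    by (intro vlim_nonzero[OF poly]) auto
  with rat show ev: "eventually (\<lambda>y. f (s y) \<in> cdom d) F"
    by eventually_elim (use W q(1) in blast)
  fix j assume j: "j < cdim d"
  obtain p q where pq: "p \<in> polyfun (cdim c)" "q \<in> polyfun (cdim c)" "q (k_coord c x) \<noteq> 0"
    and eq: "\<And>y. rational_in c y \<Longrightarrow> f y \<in> cdom d \<Longrightarrow> q (k_coord c y) \<noteq> 0 \<Longrightarrow>
       coord d (f y) j = to_ac (p (k_coord c y) / q (k_coord c y))"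
    using k_morphism_charts_polyfun[OF f x j] by blast
  have k_eq: "k_coord d (f y) j = p (k_coord c y) / q (k_coord c y)"
    if "rational_in c y" "f y \<in> cdom d" "q (k_coord c y) \<noteq> 0" for y
  proof -
    have "k_coord d (f y) j = of_ac (coord d (f y) j)" using j by (simp add: k_coord_def)
    then show ?thesis by (simp only: eq[OF that] of_ac_to_ac)
  qed
  have "eventually (\<lambda>y. q (k_coord c (s y)) \<noteq> 0) F"
    using pq by (intro vlim_nonzero[OF poly]) auto
  with rat ev have "eventually (\<lambda>y. k_coord d (f (s y)) j = p (k_coord c (s y)) / q (k_coord c (s y))) F"
    by eventually_elim (rule k_eq)
  moreover have "vlim F (\<lambda>y. p (k_coord c (s y)) / q (k_coord c (s y))) (k_coord d (f x) j)"
    unfolding k_eq[OF x pq(3)] using pq by (intro vlim_divide poly)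
  ultimately show "vlim F (\<lambda>y. k_coord d (f (s y)) j) (k_coord d (f x) j)" by (rule vlim_cong)
qed

end


section \<open>The topology on the rational points\<close>

context valued
begin

lemma openin_val_topology:
  "openin (val_topology v) U \<longleftrightarrow> (\<forall>x\<in>U. \<exists>e>0. \<forall>y. v (y - x) < e \<longrightarrow> y \<in> U)"
proof -
  interpret Metric_space UNIV "val_dist v" by (rule Metric_space_val_dist[OF absolute_value])
  have "mball x e = {y. v (y - x) < e}" for x e
    by (auto simp: val_dist_def v_minus_commute)
  then show ?thesis by (auto simp: val_topology_def openin_mtopology subset_iff)
qed

lemma countable_dense:
  assumes "separable_space (val_topology v)"
  obtains D where "countable D" "\<And>x e. e > 0 \<Longrightarrow> \<exists>q\<in>D. v (x - q) < e"
proof -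
  interpret Metric_space UNIV "val_dist v" by (rule Metric_space_val_dist[OF absolute_value])
  obtain D where D: "countable D" "mtopology closure_of D = UNIV"
    using assms unfolding separable_space_def val_topology_def by auto
  have "\<exists>q\<in>D. v (x - q) < e" if "e > 0" for x e
    using D(2) that by (auto simp: metric_closure_of val_dist_def)
  then show thesis using D(1) that by blast
qed

text \<open>The neighbourhoods of a rational point as seen in one chart.  That they are neighbourhoods in
  the topology glued from all charts rests on the continuity of the changes of charts.\<close>

definition chart_nhds :: "('x, 'k) atlas \<Rightarrow> ('x, 'k) chart \<Rightarrow> 'x \<Rightarrow> 'x filter" where
  "chart_nhds V c x = (INF e\<in>{0<..}. principal
     {y \<in> cdom c \<inter> k_points V. \<forall>i<cdim c. v (k_coord c y i - k_coord c x i) < e})"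

lemma eventually_chart_nhds:
  "eventually P (chart_nhds V c x) \<longleftrightarrow> (\<exists>e>0. \<forall>y\<in>cdom c \<inter> k_points V.
     (\<forall>i<cdim c. v (k_coord c y i - k_coord c x i) < e) \<longrightarrow> P y)"
  unfolding chart_nhds_def
proof (subst eventually_INF_base)
  fix a b :: real
  assume "a \<in> {0<..}" "b \<in> {0<..}"
  then show "\<exists>e\<in>{0<..}. principal {y \<in> cdom c \<inter> k_points V. \<forall>i<cdim c. v (k_coord c y i - k_coord c x i) < e} \<le>
      inf (principal {y \<in> cdom c \<inter> k_points V. \<forall>i<cdim c. v (k_coord c y i - k_coord c x i) < a})
        (principal {y \<in> cdom c \<inter> k_points V. \<forall>i<cdim c. v (k_coord c y i - k_coord c x i) < b})"
    by (intro bexI[of _ "min a b"]) auto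
qed (auto simp: eventually_principal Bex_def)

lemma openin_chart_topology:
  "openin (chart_topology v V c) U \<longleftrightarrow>
     U \<subseteq> cdom c \<inter> k_points V \<and> (\<forall>x\<in>U. eventually (\<lambda>y. y \<in> U) (chart_nhds V c x))"
proof
  assume "openin (chart_topology v V c) U"
  then obtain S where S: "openin (product_topology (\<lambda>_. val_topology v) {..<cdim c}) S"
    and U: "U = k_coord c -` S \<inter> (cdom c \<inter> k_points V)"
    by (auto simp: chart_topology_def openin_pullback_topology)
  have "eventually (\<lambda>y. y \<in> U) (chart_nhds V c x)" if "x \<in> U" for x
  proof -
    have "k_coord c x \<in> S" using that by (simp add: U)
    from S[unfolded openin_product_topology_alt, THEN bspec, OF this]
    obtain W where W: "\<forall>i\<in>{..<cdim c}. openin (val_topology v) (W i)"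
      "k_coord c x \<in> Pi\<^sub>E {..<cdim c} W" "Pi\<^sub>E {..<cdim c} W \<subseteq> S"
      by (elim exE conjE) (rule that; assumption)
    have "\<exists>e>0. \<forall>z. v (z - k_coord c x i) < e \<longrightarrow> z \<in> W i" if "i < cdim c" for i
      using W(1,2) that by (auto simp: openin_val_topology PiE_iff)
    then obtain e where e: "\<And>i. i < cdim c \<Longrightarrow> e i > 0"
      "\<And>i z. i < cdim c \<Longrightarrow> v (z - k_coord c x i) < e i \<Longrightarrow> z \<in> W i" by metis
    define r where "r = Min (insert 1 (e ` {..<cdim c}))"
    have r: "r > 0" "\<And>i. i < cdim c \<Longrightarrow> r \<le> e i"
      using e(1) by (auto simp: r_def)
    have "y \<in> U" if y: "y \<in> cdom c \<inter> k_points V" "\<forall>i<cdim c. v (k_coord c y i - k_coord c x i) < r" for y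
    proof -
      have "k_coord c y i \<in> W i" if "i < cdim c" for i
        using e(2)[OF that] y(2) r(2)[OF that] that by fastforce
      then have "k_coord c y \<in> Pi\<^sub>E {..<cdim c} W" by (auto simp: PiE_iff k_coord_def)
      then show ?thesis using W(3) y(1) by (auto simp: U)
    qed
    then show ?thesis using r(1) unfolding eventually_chart_nhds by blast
  qed
  then show "U \<subseteq> cdom c \<inter> k_points V \<and> (\<forall>x\<in>U. eventually (\<lambda>y. y \<in> U) (chart_nhds V c x))"
    using U by auto
next
  assume U: "U \<subseteq> cdom c \<inter> k_points V \<and> (\<forall>x\<in>U. eventually (\<lambda>y. y \<in> U) (chart_nhds V c x))"
  then have "\<forall>x\<in>U. \<exists>e>0. \<forall>y\<in>cdom c \<inter> k_points V.
      (\<forall>i<cdim c. v (k_coord c y i - k_coord c x i) < e) \<longrightarrow> y \<in> U"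
    by (simp add: eventually_chart_nhds)
  then obtain e where e: "\<And>x. x \<in> U \<Longrightarrow> e x > 0"
    "\<And>x y. x \<in> U \<Longrightarrow> y \<in> cdom c \<inter> k_points V \<Longrightarrow>
      \<forall>i<cdim c. v (k_coord c y i - k_coord c x i) < e x \<Longrightarrow> y \<in> U" by metis
  define B where "B x = (\<Pi>\<^sub>E i\<in>{..<cdim c}. {z. v (z - k_coord c x i) < e x})" for x
  have "openin (val_topology v) {z. v (z - a) < r}" for a r
    unfolding openin_val_topology
  proof (intro ballI exI conjI allI impI)
    fix z y assume "z \<in> {z. v (z - a) < r}"
    then show "r - v (z - a) > 0" by simp
    assume "v (y - z) < r - v (z - a)"
    then show "y \<in> {z. v (z - a) < r}" using v_triangle[of y a z] by simp
  qed
  then have "openin (product_topology (\<lambda>_. val_topology v) {..<cdim c}) (\<Union>x\<in>U. B x)"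
    unfolding B_def by (intro openin_Union ballI) (auto simp: openin_PiE)
  moreover have "U = k_coord c -` (\<Union>x\<in>U. B x) \<inter> (cdom c \<inter> k_points V)"
  proof
    show "U \<subseteq> k_coord c -` (\<Union>x\<in>U. B x) \<inter> (cdom c \<inter> k_points V)"
    proof
      fix x assume x: "x \<in> U"
      then have "k_coord c x \<in> B x" using e(1) by (auto simp: B_def PiE_iff k_coord_def)
      then show "x \<in> k_coord c -` (\<Union>x\<in>U. B x) \<inter> (cdom c \<inter> k_points V)" using x U by blast
    qed
    show "k_coord c -` (\<Union>x\<in>U. B x) \<inter> (cdom c \<inter> k_points V) \<subseteq> U"
    proof
      fix y assume y: "y \<in> k_coord c -` (\<Union>x\<in>U. B x) \<inter> (cdom c \<inter> k_points V)"
      then obtain x where "x \<in> U" "k_coord c y \<in> B x" by auto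
      then show "y \<in> U" using e(2)[of x y] y by (auto simp: B_def PiE_iff)
    qed
  qed
  ultimately show "openin (chart_topology v V c) U"
    unfolding chart_topology_def openin_pullback_topology by blast
qed

lemma openin_k_points_topology_iff:
  "openin (k_points_topology v V) U \<longleftrightarrow> U \<subseteq> k_points V \<and>
     (\<forall>c\<in>charts V. \<forall>x\<in>U \<inter> cdom c. eventually (\<lambda>y. y \<in> U) (chart_nhds V c x))"
proof -
  have "eventually (\<lambda>y. y \<in> cdom c \<inter> U) (chart_nhds V c x) \<longleftrightarrow> eventually (\<lambda>y. y \<in> U) (chart_nhds V c x)"
    for c x
    unfolding eventually_chart_nhds by blast
  then show ?thesis
    unfolding openin_k_points_topology openin_chart_topology by (auto simp: Int_commute)
qed

lemma chart_nhds_rational: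
  assumes "k_variety V" "c \<in> charts V"
  shows "eventually (\<lambda>y. rational_in c y) (chart_nhds V c x)"
  unfolding eventually_chart_nhds using rational_in_k_point[OF assms(1) _ assms(2)]
  by (intro exI[of _ 1]) auto

lemma chart_nhds_vlim:
  assumes "i < cdim c"
  shows "vlim (chart_nhds V c x) (\<lambda>y. k_coord c y i) (k_coord c x i)"
  unfolding vlim_less eventually_chart_nhds using assms by blast

lemma transition_vlim:
  assumes V: "k_variety V" "c \<in> charts V" "d \<in> charts V" and x: "x \<in> k_points V" "x \<in> cdom c" "x \<in> cdom d"
  shows "eventually (\<lambda>y. y \<in> cdom d) (chart_nhds V c x)"
    and "j < cdim d \<Longrightarrow> vlim (chart_nhds V c x) (\<lambda>y. k_coord d y j) (k_coord d x j)"
proof -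
  have f: "k_morphism_charts c d (\<lambda>x. x)" using V by (simp add: k_variety_def)
  have rat: "rational_in c x" by (rule rational_in_k_point[OF V(1) x(1) V(2) x(2)])
  note * = k_morphism_charts_vlim[OF f rat x(3) chart_nhds_rational[OF V(1,2)] chart_nhds_vlim]
  show "eventually (\<lambda>y. y \<in> cdom d) (chart_nhds V c x)" by (rule *(1))
  show "j < cdim d \<Longrightarrow> vlim (chart_nhds V c x) (\<lambda>y. k_coord d y j) (k_coord d x j)" by (rule *(2))
qed

lemma chart_nhds_k_points: "eventually (\<lambda>y. y \<in> k_points V) (chart_nhds V c x)"
  unfolding eventually_chart_nhds by (intro exI[of _ 1]) auto

text \<open>Openness has to be checked in every chart, and the coordinates of \<open>d\<close> are continuous in each.\<close>

lemma openin_box: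
  assumes V: "k_variety V" "d \<in> charts V"
  shows "openin (k_points_topology v V)
    {y \<in> cdom d \<inter> k_points V. \<forall>i<cdim d. v (k_coord d y i - a i) < e}" (is "openin _ ?B")
  unfolding openin_k_points_topology_iff
proof (intro conjI ballI)
  fix c x assume c: "c \<in> charts V" and "x \<in> ?B \<inter> cdom c"
  then have x: "x \<in> k_points V" "x \<in> cdom c" "x \<in> cdom d"
    and xe: "\<And>i. i < cdim d \<Longrightarrow> v (k_coord d x i - a i) < e" by auto
  note lim = transition_vlim[OF V(1) c V(2) x]
  have "eventually (\<lambda>y. v (k_coord d y i - a i) < e) (chart_nhds V c x)" if "i < cdim d" for i
  proof -
    have "e - v (k_coord d x i - a i) > 0" using xe[OF that] by simp
    then have "eventually (\<lambda>y. v (k_coord d y i - k_coord d x i) < e - v (k_coord d x i - a i)) (chart_nhds V c x)"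
      using lim(2)[OF that] unfolding vlim_less by blast
    then show ?thesis
    proof eventually_elim
      case (elim y)
      then show ?case using v_triangle[of "k_coord d y i" "a i" "k_coord d x i"] by simp
    qed
  qed
  then have "eventually (\<lambda>y. \<forall>i\<in>{..<cdim d}. v (k_coord d y i - a i) < e) (chart_nhds V c x)"
    by (intro eventually_ball_finite) auto
  with lim(1) chart_nhds_k_points show "eventually (\<lambda>y. y \<in> ?B) (chart_nhds V c x)"
    by eventually_elim auto
qed auto

lemma openin_chart_domain:
  assumes V: "k_variety V" "d \<in> charts V"
  shows "openin (k_points_topology v V) (cdom d \<inter> k_points V)"
  unfolding openin_k_points_topology_iff
proof (intro conjI ballI)
  fix c x assume c: "c \<in> charts V" and "x \<in> (cdom d \<inter> k_points V) \<inter> cdom c"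
  then have "eventually (\<lambda>y. y \<in> cdom d) (chart_nhds V c x)"
    by (intro transition_vlim[OF V(1) c V(2)]) auto
  with chart_nhds_k_points show "eventually (\<lambda>y. y \<in> cdom d \<inter> k_points V) (chart_nhds V c x)"
    by eventually_elim auto
qed auto

lemma nhdsin_le_chart_nhds:
  assumes V: "k_variety V" "c \<in> charts V" and x: "x \<in> k_points V" "x \<in> cdom c"
  shows "nhdsin (k_points_topology v V) x \<le> chart_nhds V c x"
proof (rule filter_leI)
  fix P assume "eventually P (chart_nhds V c x)"
  then obtain e where e: "e > 0" "\<And>y. y \<in> cdom c \<inter> k_points V \<Longrightarrow>
      \<forall>i<cdim c. v (k_coord c y i - k_coord c x i) < e \<Longrightarrow> P y"
    unfolding eventually_chart_nhds by blast
  let ?B = "{y \<in> cdom c \<inter> k_points V. \<forall>i<cdim c. v (k_coord c y i - k_coord c x i) < e}"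
  have "openin (k_points_topology v V) ?B" by (rule openin_box[OF V])
  moreover have "x \<in> ?B" using x e(1) by simp
  moreover have "\<forall>y\<in>?B. P y" using e(2) by blast
  ultimately show "eventually P (nhdsin (k_points_topology v V) x)"
    unfolding eventually_nhdsin by blast
qed

lemma countable_base:
  assumes V: "k_variety V" and sep: "separable_space (val_topology v)"
  obtains \<B> where "countable \<B>" "\<And>B. B \<in> \<B> \<Longrightarrow> openin (k_points_topology v V) B"
    "\<And>U x. openin (k_points_topology v V) U \<Longrightarrow> x \<in> U \<Longrightarrow> \<exists>B\<in>\<B>. x \<in> B \<and> B \<subseteq> U"
proof -
  obtain D where D: "countable D" "\<And>x e. e > 0 \<Longrightarrow> \<exists>q\<in>D. v (x - q) < e"
    using countable_dense[OF sep] by blast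
  define box where "box d a n = {y \<in> cdom d \<inter> k_points V. \<forall>i<cdim d. v (k_coord d y i - a i) < 1 / real (Suc n)}"
    for d a n
  define \<B> where "\<B> = (\<Union>d\<in>charts V. \<Union>a\<in>({..<cdim d} \<rightarrow>\<^sub>E D). range (box d a))"
  show thesis
  proof (rule that[of \<B>])
    have "finite (charts V)" using V by (simp add: k_variety_def)
    then show "countable \<B>" unfolding \<B>_def
    proof (rule countable_UN[OF countable_finite])
      fix d assume "d \<in> charts V"
      have "countable ({..<cdim d} \<rightarrow>\<^sub>E D)" using D(1) by (intro countable_PiE) auto
      then show "countable (\<Union>a\<in>({..<cdim d} \<rightarrow>\<^sub>E D). range (box d a))"
        by (rule countable_UN) simp
    qed
    show "openin (k_points_topology v V) B" if "B \<in> \<B>" for B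
      using that openin_box[OF V] by (auto simp: \<B>_def box_def)
    fix U x assume U: "openin (k_points_topology v V) U" "x \<in> U"
    then have x: "x \<in> k_points V" by (auto simp: openin_k_points_topology_iff)
    then obtain d where d: "d \<in> charts V" "x \<in> cdom d" by (rule k_point_chart)
    then have "eventually (\<lambda>y. y \<in> U) (chart_nhds V d x)"
      using U by (auto simp: openin_k_points_topology_iff)
    then obtain e where e: "e > 0" "\<And>y. y \<in> cdom d \<inter> k_points V \<Longrightarrow>
        \<forall>i<cdim d. v (k_coord d y i - k_coord d x i) < e \<Longrightarrow> y \<in> U"
      unfolding eventually_chart_nhds by blast
    obtain n where n: "1 / real (Suc n) < e / 2"
      using nat_approx_posE[of "e / 2"] e(1) by auto
    have "\<forall>i. \<exists>q\<in>D. v (k_coord d x i - q) < 1 / real (Suc n)" using D(2) by simp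
    then obtain q where q: "\<And>i. q i \<in> D" "\<And>i. v (k_coord d x i - q i) < 1 / real (Suc n)" by metis
    define a where "a = (\<lambda>i\<in>{..<cdim d}. q i)"
    have "a \<in> {..<cdim d} \<rightarrow>\<^sub>E D" using q(1) by (simp add: a_def)
    then have "box d a n \<in> \<B>" unfolding \<B>_def using d(1) by (intro UN_I) auto
    moreover
    have "x \<in> box d a n" using x d q(2) by (simp add: box_def a_def)
    moreover have "box d a n \<subseteq> U"
    proof
      fix y assume y: "y \<in> box d a n"
      have "v (k_coord d y i - k_coord d x i) < e" if i: "i < cdim d" for i
      proof -
        have "v (k_coord d y i - q i) < 1 / real (Suc n)" using y i by (simp add: box_def a_def)
        then show ?thesis
          using v_triangle[of "k_coord d y i" "k_coord d x i" "q i"] q(2)[of i] n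
            v_minus_commute[of "k_coord d x i" "q i"] by simp
      qed
      then show "y \<in> U" using y by (intro e(2)) (auto simp: box_def)
    qed
    ultimately show "\<exists>B\<in>\<B>. x \<in> B \<and> B \<subseteq> U" by blast
  qed
qed

end

section \<open>The action of rational points\<close>

lemma k_action_charts:
  assumes "k_action \<G> G V \<phi>" "e \<in> charts \<G>" "d \<in> charts V" "c \<in> charts V"
  shows "k_morphism_charts (prod_chart e d) c (\<lambda>(g, x). \<phi> g x)"
  using assms by (auto simp: k_action_def k_morphism_def prod_variety_def)

lemma k_action_rational:
  assumes act: "k_action \<G> G V \<phi>" and var: "k_variety \<G>" "k_variety V"
    and G: "carrier G = pts \<G>" and g: "g \<in> k_points \<G>" and x: "x \<in> k_points V"
  shows "\<phi> g x \<in> k_points V"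
proof -
  have "g \<in> carrier G" "x \<in> pts V" using g x G by (auto simp: k_points_def)
  moreover have "group_action G (pts V) \<phi>" using act by (simp add: k_action_def)
  ultimately have "\<phi> g x \<in> pts V" by (metis group_action.element_image)
  then obtain c where c: "c \<in> charts V" "\<phi> g x \<in> cdom c" using var by (auto simp: k_variety_def)
  obtain e d where ed: "e \<in> charts \<G>" "g \<in> cdom e" "d \<in> charts V" "x \<in> cdom d"
    using k_point_chart[OF g] k_point_chart[OF x] by metis
  have "rational_in (prod_chart e d) (g, x)"
    by (intro rational_in_prod_chart rational_in_k_point[OF var(1) g ed(1,2)]
      rational_in_k_point[OF var(2) x ed(3,4)])
  from k_morphism_charts_rational[OF k_action_charts[OF act ed(1,3) c(1)] this] c
  have "rational_in c (\<phi> g x)" by simp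
  then show ?thesis by (rule k_point_if_rational_in[OF var(2) c(1)])
qed

lemma (in valued) k_action_vlim:
  assumes act: "k_action \<G> G V \<phi>" and var: "k_variety \<G>" "k_variety V"
    and g: "g \<in> k_points \<G>" and x: "x \<in> k_points V" and c: "c \<in> charts V" "\<phi> g x \<in> cdom c"
  shows "eventually (\<lambda>y. \<phi> g y \<in> cdom c) (nhdsin (k_points_topology v V) x)"
    and "j < cdim c \<Longrightarrow> vlim (nhdsin (k_points_topology v V) x)
      (\<lambda>y. k_coord c (\<phi> g y) j) (k_coord c (\<phi> g x) j)"
proof -
  let ?F = "nhdsin (k_points_topology v V) x"
  obtain e d where ed: "e \<in> charts \<G>" "g \<in> cdom e" "d \<in> charts V" "x \<in> cdom d"
    using k_point_chart[OF g] k_point_chart[OF x] by metis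
  have f: "k_morphism_charts (prod_chart e d) c (\<lambda>(g, x). \<phi> g x)"
    by (rule k_action_charts[OF act ed(1,3) c(1)])
  have g_rat: "rational_in e g" by (rule rational_in_k_point[OF var(1) g ed(1,2)])
  have "rational_in d x" by (rule rational_in_k_point[OF var(2) x ed(3,4)])
  with g_rat have rat: "rational_in (prod_chart e d) (g, x)" by (rule rational_in_prod_chart)
  have le: "?F \<le> chart_nhds V d x" by (rule nhdsin_le_chart_nhds[OF var(2) ed(3) x ed(4)])
  have "eventually (\<lambda>y. rational_in d y) ?F"
    using chart_nhds_rational[OF var(2) ed(3)] le by (rule filter_leD[rotated])
  then have ev: "eventually (\<lambda>y. rational_in (prod_chart e d) (g, y)) ?F"
    by eventually_elim (rule rational_in_prod_chart[OF g_rat])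
  have lim: "vlim ?F (\<lambda>y. k_coord (prod_chart e d) (g, y) i) (k_coord (prod_chart e d) (g, x) i)"
    if "i < cdim (prod_chart e d)" for i
  proof -
    have i: "i < cdim e + cdim d" using that by (simp add: cdim_prod_chart)
    show ?thesis
    proof (cases "i < cdim e")
      case True
      then show ?thesis using i by (simp add: k_coord_prod_chart vlim_const)
    next
      case False
      then have "i - cdim e < cdim d" using i by simp
      from vlim_mono[OF chart_nhds_vlim[OF this] le] show ?thesis
        using i False by (simp add: k_coord_prod_chart)
    qed
  qed
  have cx: "(case (g, x) of (g, x) \<Rightarrow> \<phi> g x) \<in> cdom c" using c by simp
  note * = k_morphism_charts_vlim[OF f rat cx ev lim]
  show "eventually (\<lambda>y. \<phi> g y \<in> cdom c) ?F" using *(1) by simp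
  show "j < cdim c \<Longrightarrow> vlim ?F (\<lambda>y. k_coord c (\<phi> g y) j) (k_coord c (\<phi> g x) j)" using *(2) by simp
qed

lemma orbit_map_local:
  assumes act: "k_action \<G> G V \<phi>" and var: "k_variety \<G>" "k_variety V"
    and e: "e \<in> charts \<G>" and g: "g \<in> k_points \<G>" "g \<in> cdom e" and x: "x \<in> k_points V"
    and c: "c \<in> charts V" "\<phi> g x \<in> cdom c" and j: "j < cdim c"
  shows "\<exists>p q. p \<in> polyfun (cdim e) \<and> q \<in> polyfun (cdim e) \<and> q (k_coord e g) \<noteq> 0 \<and>
    (\<forall>h\<in>k_points \<G> \<inter> cdom e. \<phi> h x \<in> cdom c \<and> q (k_coord e h) \<noteq> 0 \<longrightarrow>
      k_coord c (\<phi> h x) j = p (k_coord e h) / q (k_coord e h))"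
proof -
  obtain d where d: "d \<in> charts V" "x \<in> cdom d" using k_point_chart[OF x] by blast
  let ?P = "prod_chart e d"
  let ?s = "\<lambda>y i. if i < cdim e then y i else k_coord d x (i - cdim e)"
  have f: "k_morphism_charts ?P c (\<lambda>(g, x). \<phi> g x)"
    by (rule k_action_charts[OF act e d(1) c(1)])
  have x_rat: "rational_in d x" by (rule rational_in_k_point[OF var(2) x d])
  have rat: "rational_in ?P (h, x)" if "h \<in> k_points \<G> \<inter> cdom e" for h
    using that rational_in_k_point[OF var(1), of h e] e x_rat by (intro rational_in_prod_chart) auto
  have cx: "(case (g, x) of (g, x) \<Rightarrow> \<phi> g x) \<in> cdom c" using c by simp
  obtain p q where pq: "p \<in> polyfun (cdim ?P)" "q \<in> polyfun (cdim ?P)" "q (k_coord ?P (g, x)) \<noteq> 0"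
    and eq: "\<And>y. rational_in ?P y \<Longrightarrow> (case y of (g, x) \<Rightarrow> \<phi> g x) \<in> cdom c \<Longrightarrow> q (k_coord ?P y) \<noteq> 0 \<Longrightarrow>
       coord c (case y of (g, x) \<Rightarrow> \<phi> g x) j = to_ac (p (k_coord ?P y) / q (k_coord ?P y))"
    using k_morphism_charts_polyfun[OF f rat cx j] g by blast
  have s: "r (k_coord ?P (h, x)) = r (?s (k_coord e h))" if "r \<in> polyfun (cdim ?P)" for r h
    using that by (rule polyfun_cong) (simp add: k_coord_prod_chart cdim_prod_chart)
  have slice: "(\<lambda>y. r (?s y)) \<in> polyfun (cdim e)" if "r \<in> polyfun (cdim ?P)" for r
    using that
  proof (rule polyfun_subst)
    fix i show "(\<lambda>y. ?s y i) \<in> polyfun (cdim e)"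
      by (cases "i < cdim e") (auto intro: polyfun.intros)
  qed
  have nonzero: "q (?s (k_coord e g)) \<noteq> 0" using pq(3) s[OF pq(2)] by simp
  have quotient: "\<forall>h\<in>k_points \<G> \<inter> cdom e. \<phi> h x \<in> cdom c \<and> q (?s (k_coord e h)) \<noteq> 0 \<longrightarrow>
      k_coord c (\<phi> h x) j = p (?s (k_coord e h)) / q (?s (k_coord e h))"
  proof (intro ballI impI)
    fix h assume h: "h \<in> k_points \<G> \<inter> cdom e" "\<phi> h x \<in> cdom c \<and> q (?s (k_coord e h)) \<noteq> 0"
    then have "coord c (\<phi> h x) j = to_ac (p (?s (k_coord e h)) / q (?s (k_coord e h)))"
      using eq[OF rat[OF h(1)]] s[OF pq(1)] s[OF pq(2)] by simp
    moreover have "k_coord c (\<phi> h x) j = of_ac (coord c (\<phi> h x) j)" using j by (simp add: k_coord_def)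
    ultimately show "k_coord c (\<phi> h x) j = p (?s (k_coord e h)) / q (?s (k_coord e h))"
      by (simp only: of_ac_to_ac)
  qed
  show ?thesis
    by (rule exI[of _ "\<lambda>y. p (?s y)"], rule exI[of _ "\<lambda>y. q (?s y)"])
      (use slice[OF pq(1)] slice[OF pq(2)] nonzero quotient in \<open>intro conjI\<close>)
qed

text \<open>The local quotients representing \<open>g \<mapsto> \<phi> g x\<close> could a priori be infinitely many; by
  quasi-compactness finitely many of them suffice.\<close>

lemma orbit_map_patches:
  assumes act: "k_action \<G> G V \<phi>" and var: "k_variety \<G>" "k_variety V"
    and e: "e \<in> charts \<G>" and x: "x \<in> k_points V" and c: "c \<in> charts V" and j: "j < cdim c"
  shows "\<exists>R. finite R \<and> R \<subseteq> polyfun (cdim e) \<times> polyfun (cdim e) \<and>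
    (\<forall>g\<in>k_points \<G> \<inter> cdom e. \<phi> g x \<in> cdom c \<longrightarrow> (\<exists>(p, q)\<in>R. q (k_coord e g) \<noteq> 0 \<and>
      k_coord c (\<phi> g x) j = p (k_coord e g) / q (k_coord e g)))"
proof -
  define R where "R = {(p, q) \<in> polyfun (cdim e) \<times> polyfun (cdim e).
    \<forall>h\<in>k_points \<G> \<inter> cdom e. \<phi> h x \<in> cdom c \<and> q (k_coord e h) \<noteq> 0 \<longrightarrow>
      k_coord c (\<phi> h x) j = p (k_coord e h) / q (k_coord e h)}"
  have "snd ` R \<subseteq> polyfun (cdim e)" by (auto simp: R_def)
  from polyfun_quasi_compact[OF this] obtain Q where Q: "finite Q" "Q \<subseteq> snd ` R"
    "\<And>y. \<exists>q\<in>snd ` R. q y \<noteq> 0 \<Longrightarrow> \<exists>q\<in>Q. q y \<noteq> 0" by auto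
  obtain R0 where R0: "R0 \<subseteq> R" "finite R0" "snd ` R0 = Q"
    using finite_subset_image[OF Q(1,2)] by metis
  show ?thesis
  proof (intro exI[of _ R0] conjI ballI impI)
    show "finite R0" by (rule R0)
    show "R0 \<subseteq> polyfun (cdim e) \<times> polyfun (cdim e)" using R0(1) by (auto simp: R_def)
    fix g assume g: "g \<in> k_points \<G> \<inter> cdom e" "\<phi> g x \<in> cdom c"
    from orbit_map_local[OF act var e _ _ x c g(2) j] g(1)
    obtain p q where "(p, q) \<in> R" "q (k_coord e g) \<noteq> 0" by (auto simp: R_def)
    then have "\<exists>q\<in>snd ` R. q (k_coord e g) \<noteq> 0" by force
    from Q(3)[OF this] obtain q' where "q' \<in> Q" "q' (k_coord e g) \<noteq> 0" by blast
    then obtain p' where "(p', q') \<in> R0" using R0(3) by force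
    with \<open>q' (k_coord e g) \<noteq> 0\<close> R0(1) g
    show "\<exists>(p, q)\<in>R0. q (k_coord e g) \<noteq> 0 \<and> k_coord c (\<phi> g x) j = p (k_coord e g) / q (k_coord e g)"
      by (intro bexI[of _ "(p', q')"]) (auto simp: R_def)
  qed
qed

text \<open>More points than the dimension of the group: the coordinates of their translates by \<open>g\<close> are
  functions of the at most \<open>m\<close> coordinates of \<open>g\<close>, and hence algebraically dependent.\<close>

lemma orbit_algebraic_dependence:
  assumes act: "k_action \<G> G V \<phi>" and var: "k_variety \<G>" "k_variety V"
    and dim: "\<And>e. e \<in> charts \<G> \<Longrightarrow> cdim e \<le> m"
    and x: "\<And>i. i < Suc m \<Longrightarrow> x i \<in> k_points V" and c: "c \<in> charts V" and j: "j < cdim c"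
  shows "\<exists>d a. (\<exists>b\<in>{..<Suc m} \<rightarrow>\<^sub>E {..<d}. a b \<noteq> 0) \<and>
    (\<forall>g\<in>k_points \<G>. (\<forall>i<Suc m. \<phi> g (x i) \<in> cdom c) \<longrightarrow>
      (\<Sum>b\<in>{..<Suc m} \<rightarrow>\<^sub>E {..<d}. a b * (\<Prod>i<Suc m. k_coord c (\<phi> g (x i)) j ^ b i)) = 0)"
proof -
  let ?n = "Suc m"
  define U where "U = {g \<in> k_points \<G>. \<forall>i<?n. \<phi> g (x i) \<in> cdom c}"
  define patches where "patches e i R \<longleftrightarrow> finite R \<and> R \<subseteq> polyfun (cdim e) \<times> polyfun (cdim e) \<and>
    (\<forall>g\<in>k_points \<G> \<inter> cdom e. \<phi> g (x i) \<in> cdom c \<longrightarrow> (\<exists>(p, q)\<in>R. q (k_coord e g) \<noteq> 0 \<and>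
      k_coord c (\<phi> g (x i)) j = p (k_coord e g) / q (k_coord e g)))" for e i R
  have "\<forall>e\<in>charts \<G>. \<forall>i\<in>{..<?n}. \<exists>R. patches e i R"
    unfolding patches_def using orbit_map_patches[OF act var _ x c j] by simp
  then have "\<exists>R. \<forall>e\<in>charts \<G>. \<forall>i\<in>{..<?n}. patches e i (R e i)"
    unfolding bchoice_iff .
  then obtain R where "\<forall>e\<in>charts \<G>. \<forall>i\<in>{..<?n}. patches e i (R e i)" ..
  then have R: "\<And>e i. e \<in> charts \<G> \<Longrightarrow> i < ?n \<Longrightarrow> finite (R e i)"
    "\<And>e i. e \<in> charts \<G> \<Longrightarrow> i < ?n \<Longrightarrow> R e i \<subseteq> polyfun (cdim e) \<times> polyfun (cdim e)"
    "\<And>e i g. e \<in> charts \<G> \<Longrightarrow> i < ?n \<Longrightarrow> g \<in> k_points \<G> \<inter> cdom e \<Longrightarrow> \<phi> g (x i) \<in> cdom c \<Longrightarrow>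
      \<exists>r\<in>R e i. snd r (k_coord e g) \<noteq> 0 \<and>
      k_coord c (\<phi> g (x i)) j = fst r (k_coord e g) / snd r (k_coord e g)"
    by (simp_all add: patches_def case_prod_beta)
  define T where "T = (SIGMA e:charts \<G>. Pi\<^sub>E {..<?n} (R e))"
  have T: "finite T"
    unfolding T_def using var(1) R(1)
    by (intro finite_SigmaI finite_PiE) (auto simp: k_variety_def)
  have "\<exists>d a. (\<exists>b\<in>{..<?n} \<rightarrow>\<^sub>E {..<d}. a b \<noteq> 0) \<and>
    (\<forall>g\<in>U. (\<Sum>b\<in>{..<?n} \<rightarrow>\<^sub>E {..<d}. a b * (\<Prod>i<?n. k_coord c (\<phi> g (x i)) j ^ b i)) = 0)"
  proof (rule algebraic_dependence[OF T, where P = "\<lambda>s i. fst (snd s i)" and Q = "\<lambda>s i. snd (snd s i)"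
        and y = "\<lambda>s. k_coord (fst s)"])
    fix s i assume s: "s \<in> T" and i: "i < ?n"
    obtain e r where "s = (e, r)" "e \<in> charts \<G>" "r \<in> Pi\<^sub>E {..<?n} (R e)" using s by (auto simp: T_def)
    then have "snd s i \<in> polyfun (cdim e) \<times> polyfun (cdim e)" "cdim e \<le> m"
      using R(2)[of e i] i dim by (auto simp: PiE_iff)
    then show "fst (snd s i) \<in> polyfun m \<and> snd (snd s i) \<in> polyfun m"
      by (simp add: mem_Times_iff polyfun_mono[of _ "cdim e" m])
  next
    fix g assume g: "g \<in> U"
    then obtain e where e: "e \<in> charts \<G>" "g \<in> k_points \<G> \<inter> cdom e"
      using k_point_chart[of g \<G>] by (auto simp: U_def)
    have "\<forall>i\<in>{..<?n}. \<exists>r. r \<in> R e i \<and> snd r (k_coord e g) \<noteq> 0 \<and>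
        k_coord c (\<phi> g (x i)) j = fst r (k_coord e g) / snd r (k_coord e g)"
      using R(3)[OF e(1) _ e(2)] g unfolding Bex_def[symmetric] by (simp add: U_def)
    from bchoice[OF this] obtain r where r: "\<forall>i\<in>{..<?n}. r i \<in> R e i \<and> snd (r i) (k_coord e g) \<noteq> 0 \<and>
        k_coord c (\<phi> g (x i)) j = fst (r i) (k_coord e g) / snd (r i) (k_coord e g)" ..
    then show "\<exists>s\<in>T. \<forall>i<?n. snd (snd s i) (k_coord (fst s) g) \<noteq> 0 \<and>
        k_coord c (\<phi> g (x i)) j = fst (snd s i) (k_coord (fst s) g) / snd (snd s i) (k_coord (fst s) g)"
      using e(1) by (intro bexI[of _ "(e, restrict r {..<?n})"]) (auto simp: T_def)
  qed
  then show ?thesis by (simp only: U_def Ball_def mem_Collect_eq imp_conjL)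
qed


section \<open>Linear relations along continuously varying sets\<close>

text \<open>To each \<open>x\<close> belongs a set \<open>orb x\<close> that varies lower semicontinuously: every point of it can be
  followed continuously to the sets of nearby \<open>y\<close>.  The functions \<open>M 0, M 1, ...\<close> are considered
  on these sets.  In the application the sets are orbits of an uncountable group, and openness is what makes
  conditions on a whole orbit measurable.\<close>

locale varying_family = valued v for v :: "'k::field \<Rightarrow> real" +
  fixes nhd :: "'z \<Rightarrow> 'z filter" and S :: "'z set"
    and orb :: "'z \<Rightarrow> 'z set" and M :: "nat \<Rightarrow> 'z \<Rightarrow> 'k"
  assumes nhd_self: "\<And>P x. x \<in> S \<Longrightarrow> eventually P (nhd x) \<Longrightarrow> P x"
    and moving_point: "\<And>x z. x \<in> S \<Longrightarrow> z \<in> orb x \<Longrightarrow> \<exists>s. s x = z \<and>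
      eventually (\<lambda>y. s y \<in> orb y) (nhd x) \<and> (\<forall>a. vlim (nhd x) (\<lambda>y. M a (s y)) (M a z))"
begin

text \<open>The least \<open>t\<close> for which \<open>M 0, ..., M t\<close> become dependent on \<open>orb x\<close> singles out one relation,
  with uniquely determined coefficients: \<open>M t\<close> is a combination of \<open>M 0, ..., M (t - 1)\<close>.\<close>

definition indep :: "nat \<Rightarrow> 'z \<Rightarrow> bool" where
  "indep t x \<longleftrightarrow> (\<forall>c. (\<forall>z\<in>orb x. (\<Sum>a<t. c a * M a z) = 0) \<longrightarrow> (\<forall>a<t. c a = 0))"

definition rel :: "nat \<Rightarrow> 'z \<Rightarrow> (nat \<Rightarrow> 'k) \<Rightarrow> bool" where
  "rel t x c \<longleftrightarrow> (\<forall>z\<in>orb x. M t z = (\<Sum>a<t. c a * M a z))"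

text \<open>The span of the vectors \<open>(M 0 z, M 1 z, ...)\<close> for \<open>z \<in> orb x\<close>, described by the relations that
  hold on \<open>orb x\<close>.  Relations can be tested on any of its elements.\<close>

definition point_span :: "'z \<Rightarrow> (nat \<Rightarrow> 'k) set" where
  "point_span x = {w. \<forall>t c. (\<forall>z\<in>orb x. (\<Sum>a<t. c a * M a z) = 0) \<longrightarrow> (\<Sum>a<t. c a * w a) = 0}"

definition selection :: "'z \<Rightarrow> ('z \<Rightarrow> nat \<Rightarrow> 'k) \<Rightarrow> bool" where
  "selection x u \<longleftrightarrow> eventually (\<lambda>y. u y \<in> point_span y) (nhd x) \<and> (\<forall>a. vlim (nhd x) (\<lambda>y. u y a) (u x a))"

lemma point_span_point: "z \<in> orb x \<Longrightarrow> (\<lambda>a. M a z) \<in> point_span x"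
  by (simp add: point_span_def)

lemma point_span_diff:
  assumes "w \<in> point_span x" "w' \<in> point_span x"
  shows "(\<lambda>a. w a - w' a) \<in> point_span x"
  using assms by (simp add: point_span_def right_diff_distrib sum_subtractf)

lemma point_span_scale:
  assumes "w \<in> point_span x"
  shows "(\<lambda>a. r * w a) \<in> point_span x"
proof -
  have "(\<Sum>a<t. c a * (r * w a)) = r * (\<Sum>a<t. c a * w a)" for c :: "nat \<Rightarrow> 'k" and t
    by (simp add: sum_distrib_left mult.left_commute)
  then show ?thesis using assms by (simp add: point_span_def)
qed

lemma point_span_sum:
  assumes "\<And>i. i \<in> A \<Longrightarrow> w i \<in> point_span x"
  shows "(\<lambda>a. \<Sum>i\<in>A. w i a) \<in> point_span x"
proof -
  have "(\<Sum>a<t. c a * (\<Sum>i\<in>A. w i a)) = (\<Sum>i\<in>A. \<Sum>a<t. c a * w i a)" for c :: "nat \<Rightarrow> 'k" and t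
    unfolding sum_distrib_left by (rule sum.swap)
  then show ?thesis using assms by (simp add: point_span_def)
qed

lemma selection_diff: "selection x u \<Longrightarrow> selection x w \<Longrightarrow> selection x (\<lambda>y a. u y a - w y a)"
  unfolding selection_def by (auto intro: vlim_diff point_span_diff elim: eventually_elim2)

lemma selection_scale:
  assumes "selection x u" "vlim (nhd x) r (r x)"
  shows "selection x (\<lambda>y a. r y * u y a)"
  using assms unfolding selection_def
  by (auto intro: vlim_mult point_span_scale elim: eventually_mono)

lemma selection_sum:
  assumes "finite A" "\<And>i. i \<in> A \<Longrightarrow> selection x (u i)"
  shows "selection x (\<lambda>y a. \<Sum>i\<in>A. u i y a)"
proof -
  have "eventually (\<lambda>y. \<forall>i\<in>A. u i y \<in> point_span y) (nhd x)"
    using assms by (auto simp: selection_def eventually_ball_finite_distrib)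
  then have "eventually (\<lambda>y. (\<lambda>a. \<Sum>i\<in>A. u i y a) \<in> point_span y) (nhd x)"
    by eventually_elim (simp add: point_span_sum)
  then show ?thesis using assms(2) by (auto simp: selection_def intro: vlim_sum)
qed

lemma indep_Suc: "indep (Suc t) x \<Longrightarrow> indep t x"
  unfolding indep_def
proof (intro allI impI)
  fix c a
  assume ind: "\<forall>c. (\<forall>z\<in>orb x. (\<Sum>a<Suc t. c a * M a z) = 0) \<longrightarrow> (\<forall>a<Suc t. c a = 0)"
    and c: "\<forall>z\<in>orb x. (\<Sum>a<t. c a * M a z) = 0" and a: "a < t"
  have "(\<Sum>a<Suc t. (c(t := 0)) a * M a z) = (\<Sum>a<t. c a * M a z)" for z
    by simp
  then have "\<forall>a<Suc t. (c(t := 0)) a = 0"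
    using ind[THEN spec, of "c(t := 0)"] c by (simp del: sum.lessThan_Suc fun_upd_apply)
  then have "(c(t := 0)) a = 0" using a less_SucI by blast
  then show "c a = 0" using a by simp
qed

text \<open>A Gram-Schmidt process with continuous coefficients.  Given dual vectors for \<open>M 0, ..., M (t - 1)\<close>,
  independence of \<open>M t\<close> provides a point of \<open>orb x\<close> at which \<open>M t\<close> differs from the combination of
  the earlier functions that the dual vectors predict; subtracting the prediction and normalising gives
  the next dual vector.  All divisors are nonzero at \<open>x\<close> and hence nearby.\<close>

lemma continuous_dual_basis:
  assumes x: "x \<in> S" and "indep t x"
  shows "\<exists>u. (\<forall>a<t. selection x (u a)) \<and>
    eventually (\<lambda>y. \<forall>a<t. \<forall>b<t. u a y b = (if a = b then 1 else 0)) (nhd x)"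
  using assms(2)
proof (induction t)
  case (Suc t)
  obtain u where u: "\<And>a. a < t \<Longrightarrow> selection x (u a)"
    and dual: "eventually (\<lambda>y. \<forall>a<t. \<forall>b<t. u a y b = (if a = b then 1 else 0)) (nhd x)"
    using Suc.IH[OF indep_Suc[OF Suc.prems]] by blast
  have u_lim: "vlim (nhd x) (\<lambda>y. u a y b) (u a x b)" if "a < t" for a b
    using u[OF that] by (simp add: selection_def)
  \<comment> \<open>By independence, some point of the family violates the relation suggested by the dual basis.\<close>
  obtain z where z: "z \<in> orb x" and rz: "M t z - (\<Sum>a<t. M a z * u a x t) \<noteq> 0"
  proof -
    define c where "c a = (if a = t then 1 else - u a x t)" for a
    have "c t \<noteq> 0" by (simp add: c_def)
    then obtain z where z: "z \<in> orb x" "(\<Sum>a<Suc t. c a * M a z) \<noteq> 0"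
      using Suc.prems unfolding indep_def by blast
    have "(\<Sum>a<t. c a * M a z) = - (\<Sum>a<t. M a z * u a x t)"
      unfolding sum_negf[symmetric] by (intro sum.cong) (auto simp: c_def)
    with z that[of z] show thesis by (simp add: c_def)
  qed
  obtain s where s: "s x = z" "eventually (\<lambda>y. s y \<in> orb y) (nhd x)"
    "\<And>a. vlim (nhd x) (\<lambda>y. M a (s y)) (M a z)" using moving_point[OF x z] by blast
  define w where "w y b = M b (s y) - (\<Sum>a<t. M a (s y) * u a y b)" for y b
  have w: "selection x w" unfolding w_def
  proof (intro selection_diff selection_sum selection_scale u)
    show "selection x (\<lambda>y b. M b (s y))"
      using s by (auto simp: selection_def point_span_point elim: eventually_mono)
  qed (use s in auto)
  then have w_lim: "vlim (nhd x) (\<lambda>y. w y b) (w x b)" for b by (simp add: selection_def)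
  have wt: "w x t \<noteq> 0" using rz s(1) by (simp add: w_def)
  have w_zero: "eventually (\<lambda>y. \<forall>b<t. w y b = 0) (nhd x)"
    using dual
  proof eventually_elim
    case (elim y)
    have "(\<Sum>a<t. M a (s y) * u a y b) = M b (s y)" if b: "b < t" for b
    proof -
      have "(\<Sum>a<t. M a (s y) * u a y b) = (\<Sum>a<t. if a = b then M a (s y) else 0)"
        using elim b by (intro sum.cong) auto
      then show ?thesis using b by (simp add: sum.delta)
    qed
    then show ?case by (simp add: w_def)
  qed
  define p where "p y b = inverse (w y t) * w y b" for y b
  have p: "selection x p"
    unfolding p_def using w vlim_inverse[OF w_lim wt] by (rule selection_scale)
  have p_dual: "eventually (\<lambda>y. p y t = 1 \<and> (\<forall>b<t. p y b = 0)) (nhd x)"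
    using w_zero vlim_nonzero[OF w_lim wt] by eventually_elim (simp add: p_def)
  define u' where "u' a = (if a = t then p else (\<lambda>y b. u a y b - u a y t * p y b))" for a
  have "selection x (u' a)" if "a < Suc t" for a
    using that u p u_lim by (cases "a = t") (auto simp: u'_def intro!: selection_diff selection_scale)
  moreover have "eventually (\<lambda>y. \<forall>a<Suc t. \<forall>b<Suc t. u' a y b = (if a = b then 1 else 0)) (nhd x)"
    using dual p_dual by eventually_elim (auto simp: u'_def less_Suc_eq)
  ultimately show ?case by blast
qed simp

lemma indep_eventually:
  assumes x: "x \<in> S" and "indep t x"
  shows "eventually (indep t) (nhd x)"
proof -
  obtain u where u: "\<And>a. a < t \<Longrightarrow> selection x (u a)"
    and dual: "eventually (\<lambda>y. \<forall>a<t. \<forall>b<t. u a y b = (if a = b then 1 else 0)) (nhd x)"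
    using continuous_dual_basis[OF assms] by blast
  have "eventually (\<lambda>y. \<forall>a\<in>{..<t}. u a y \<in> point_span y) (nhd x)"
    using u by (intro eventually_ball_finite) (auto simp: selection_def)
  with dual show ?thesis
  proof eventually_elim
    case (elim y)
    show ?case unfolding indep_def
    proof (intro allI impI)
      fix c a assume c: "\<forall>z\<in>orb y. (\<Sum>b<t. c b * M b z) = 0" and a: "a < t"
      then have "(\<Sum>b<t. c b * u a y b) = 0" using elim(2) by (simp add: point_span_def)
      moreover have "(\<Sum>b<t. c b * u a y b) = (\<Sum>b<t. if b = a then c b else 0)"
        using elim(1) a by (intro sum.cong) auto
      ultimately show "c a = 0" using a by (simp add: sum.delta)
    qed
  qed
qed

lemma rel_exists:
  assumes "indep t x" "\<not> indep (Suc t) x"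
  shows "\<exists>c. rel t x c"
proof -
  obtain c where c: "\<And>z. z \<in> orb x \<Longrightarrow> (\<Sum>a<Suc t. c a * M a z) = 0" and "\<exists>a<Suc t. c a \<noteq> 0"
    using assms(2) unfolding indep_def by blast
  moreover have "\<forall>a<Suc t. c a = 0" if "c t = 0"
  proof -
    have "\<forall>z\<in>orb x. (\<Sum>a<t. c a * M a z) = 0" using c that by simp
    then have "\<forall>a<t. c a = 0" using assms(1) by (simp add: indep_def)
    then show ?thesis using that by (auto simp: less_Suc_eq)
  qed
  ultimately have "c t \<noteq> 0" by blast
  have "M t z = (\<Sum>a<t. (- c a / c t) * M a z)" if "z \<in> orb x" for z
  proof -
    have "c t * M t z = - (\<Sum>a<t. c a * M a z)" using c[OF that] by (simp add: eq_neg_iff_add_eq_0 add.commute)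
    then have "M t z = - (\<Sum>a<t. c a * M a z) / c t" using \<open>c t \<noteq> 0\<close> by (simp add: field_simps)
    then show ?thesis by (simp add: sum_divide_distrib sum_negf)
  qed
  then show ?thesis unfolding rel_def by (intro exI[of _ "\<lambda>a. - c a / c t"] ballI)
qed

text \<open>Where the coefficients are defined they are the \<open>t\<close>-th entries of the dual vectors, and these
  are continuous.\<close>

lemma rel_eventually:
  assumes x: "x \<in> S" and ind: "indep t x" and c: "rel t x c" and a: "a < t" and e: "e > 0"
  shows "eventually (\<lambda>y. \<forall>c'. rel t y c' \<longrightarrow> v (c' a - c a) < e) (nhd x)"
proof -
  obtain u where u: "\<And>a. a < t \<Longrightarrow> selection x (u a)"
    and dual: "eventually (\<lambda>y. \<forall>a<t. \<forall>b<t. u a y b = (if a = b then 1 else 0)) (nhd x)"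
    using continuous_dual_basis[OF x ind] by blast
  have "eventually (\<lambda>y. u a y \<in> point_span y) (nhd x)" using u[OF a] by (simp add: selection_def)
  with dual have eq: "eventually (\<lambda>y. \<forall>c'. rel t y c' \<longrightarrow> c' a = u a y t) (nhd x)"
  proof eventually_elim
    case (elim y)
    show ?case
    proof (intro allI impI)
      fix c' assume c': "rel t y c'"
      define k where "k b = (if b = t then 1 else - c' b)" for b
      have "(\<Sum>b<t. k b * w b) = - (\<Sum>b<t. c' b * w b)" for w :: "nat \<Rightarrow> 'k"
        unfolding sum_negf[symmetric] by (intro sum.cong) (auto simp: k_def)
      then have k: "(\<Sum>b<Suc t. k b * w b) = w t - (\<Sum>b<t. c' b * w b)" for w :: "nat \<Rightarrow> 'k"
        by (simp add: k_def)
      have "\<forall>z\<in>orb y. (\<Sum>b<Suc t. k b * M b z) = 0"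
        using c' unfolding k by (simp add: rel_def)
      then have "(\<Sum>b<Suc t. k b * u a y b) = 0" using elim(2) unfolding point_span_def by blast
      moreover have "(\<Sum>b<t. c' b * u a y b) = (\<Sum>b<t. if b = a then c' b else 0)"
        using elim(1) a by (intro sum.cong) auto
      ultimately show "c' a = u a y t" using a unfolding k by (simp add: sum.delta)
    qed
  qed
  have "u a x t = c a" using nhd_self[OF x eq] c by simp
  moreover have "vlim (nhd x) (\<lambda>y. u a y t) (u a x t)" using u[OF a] by (simp add: selection_def)
  ultimately have "eventually (\<lambda>y. v (u a y t - c a) < e) (nhd x)" using e by (simp add: vlim_less)
  with eq show ?thesis
    by eventually_elim (metis (no_types))
qed

end


section \<open>Weakly mixing measures\<close>

locale weakly_mixing_k_action = valued v for v :: "'k::field \<Rightarrow> real" +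
  fixes \<G> :: "('g, 'k) atlas" and G :: "'g monoid"
    and V :: "('x, 'k) atlas" and \<phi> :: "'g \<Rightarrow> 'x \<Rightarrow> 'x"
    and L :: "'g set" and \<mu> :: "'x measure"
  assumes separable: "separable_space (val_topology v)"
    and group: "k_algebraic_group \<G> G"
    and variety: "k_variety V"
    and action: "k_action \<G> G V \<phi>"
    and subgroup: "subgroup L (G\<lparr>carrier := k_points \<G>\<rparr>)"
    and sets_mu: "sets \<mu> = sets (borel_measurable_space (k_points_topology v V))"
    and prob: "prob_space \<mu>"
    and invariant: "invariant_measure L \<phi> \<mu>"
    and mixing: "weakly_mixing L \<phi> \<mu>"

sublocale weakly_mixing_k_action \<subseteq> prob_space \<mu> by (rule prob)

context weakly_mixing_k_action
begin

abbreviation T where "T \<equiv> k_points_topology v V"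

lemma group_variety: "k_variety \<G>" and carrier_eq: "carrier G = pts \<G>" and G_group: "Group.group G"
  using group by (auto simp: k_algebraic_group_def)

lemma L_k_points: "g \<in> L \<Longrightarrow> g \<in> k_points \<G>"
  using subgroup.subset[OF subgroup] by auto

lemma L_carrier: "g \<in> L \<Longrightarrow> g \<in> carrier G"
  using L_k_points by (auto simp: carrier_eq k_points_def)

lemma L_one: "\<one>\<^bsub>G\<^esub> \<in> L"
  using subgroup.one_closed[OF subgroup] by simp

lemma L_mult: "g \<in> L \<Longrightarrow> h \<in> L \<Longrightarrow> g \<otimes>\<^bsub>G\<^esub> h \<in> L"
  using subgroup.m_closed[OF subgroup] by simp

text \<open>The subgroup axioms for \<open>L\<close> refer to inverses in the group of rational points.  Since inversion is a
  morphism, these are the inverses in \<open>G\<close>.\<close>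

lemma L_inverse:
  assumes "h \<in> L"
  shows "\<exists>h'\<in>L. h' \<otimes>\<^bsub>G\<^esub> h = \<one>\<^bsub>G\<^esub>"
proof -
  interpret G: Group.group G by (rule G_group)
  let ?H = "G\<lparr>carrier := k_points \<G>\<rparr>"
  let ?h' = "inv\<^bsub>G\<^esub> h"
  have h: "h \<in> carrier G" by (rule L_carrier[OF assms])
  have mor: "k_morphism \<G> \<G> (\<lambda>g. inv\<^bsub>G\<^esub> g)" using group by (simp add: k_algebraic_group_def)
  \<comment> \<open>The inverse taken in the group of rational points is the one taken in \<open>G\<close>.\<close>
  have rat: "?h' \<in> k_points \<G>"
  proof -
    obtain c where c: "c \<in> charts \<G>" "h \<in> cdom c" using k_point_chart[OF L_k_points[OF assms]] by blast
    have "?h' \<in> pts \<G>" using h carrier_eq G.inv_closed by blast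
    then obtain d where d: "d \<in> charts \<G>" "?h' \<in> cdom d"
      using group_variety by (auto simp: k_variety_def)
    have "k_morphism_charts c d (\<lambda>g. inv\<^bsub>G\<^esub> g)" using mor c(1) d(1) by (simp add: k_morphism_def)
    moreover have "rational_in c h"
      by (rule rational_in_k_point[OF group_variety L_k_points[OF assms] c])
    ultimately have "rational_in d ?h'" using d(2) by (rule k_morphism_charts_rational)
    then show ?thesis by (rule k_point_if_rational_in[OF group_variety d(1)])
  qed
  have "inv\<^bsub>?H\<^esub> h = ?h'"
    unfolding m_inv_def[of ?H]
  proof (rule the_equality)
    show "?h' \<in> carrier ?H \<and> h \<otimes>\<^bsub>?H\<^esub> ?h' = \<one>\<^bsub>?H\<^esub> \<and> ?h' \<otimes>\<^bsub>?H\<^esub> h = \<one>\<^bsub>?H\<^esub>"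
      using rat h by simp
    fix y assume y: "y \<in> carrier ?H \<and> h \<otimes>\<^bsub>?H\<^esub> y = \<one>\<^bsub>?H\<^esub> \<and> y \<otimes>\<^bsub>?H\<^esub> h = \<one>\<^bsub>?H\<^esub>"
    then have "y \<in> carrier G" by (auto simp: carrier_eq k_points_def)
    then show "y = ?h'" using y h G.inv_equality[of y h] by simp
  qed
  then have "?h' \<in> L" using subgroup.m_inv_closed[OF subgroup assms] by simp
  moreover have "?h' \<otimes>\<^bsub>G\<^esub> h = \<one>\<^bsub>G\<^esub>" using h by simp
  ultimately show ?thesis by blast
qed

lemma k_points_pts: "x \<in> k_points V \<Longrightarrow> x \<in> pts V"
  by (simp add: k_points_def)

lemma group_action: "group_action G (pts V) \<phi>"
  using action by (simp add: k_action_def)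

lemma phi_one: "x \<in> k_points V \<Longrightarrow> \<phi> \<one>\<^bsub>G\<^esub> x = x"
  using group_action.id_eq_one[OF group_action] k_points_pts by (metis restrict_apply)

lemma phi_mult: "g \<in> L \<Longrightarrow> h \<in> L \<Longrightarrow> x \<in> k_points V \<Longrightarrow> \<phi> (g \<otimes>\<^bsub>G\<^esub> h) x = \<phi> g (\<phi> h x)"
  using group_action.composition_rule[OF group_action] k_points_pts L_carrier by metis

lemma phi_closed: "g \<in> L \<Longrightarrow> x \<in> k_points V \<Longrightarrow> \<phi> g x \<in> k_points V"
  by (rule k_action_rational[OF action group_variety variety carrier_eq L_k_points])

lemma phi_inj:
  assumes "g \<in> L" "x \<in> k_points V" "y \<in> k_points V" "\<phi> g x = \<phi> g y"
  shows "x = y"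
proof -
  obtain h where "h \<in> L" "h \<otimes>\<^bsub>G\<^esub> g = \<one>\<^bsub>G\<^esub>" using L_inverse[OF assms(1)] by blast
  then show ?thesis using assms phi_mult phi_one by metis
qed

lemma topspace_T: "topspace T = k_points V"
  by (rule topspace_k_points_topology[OF absolute_value])

lemma space_mu: "space \<mu> = k_points V"
  using sets_eq_imp_space_eq[OF sets_mu] openin_subset[of T]
  by (simp add: borel_measurable_space_def topspace_T space_measure_of_conv)

lemma open_sets: "openin T U \<Longrightarrow> U \<in> sets \<mu>"
  unfolding sets_mu borel_measurable_space_def
  by (subst sets_measure_of) (auto dest: openin_subset)

lemma chart_sets: "c \<in> charts V \<Longrightarrow> cdom c \<inter> k_points V \<in> sets \<mu>"
  by (intro open_sets openin_chart_domain variety)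

lemma coordinate_sets:
  assumes c: "c \<in> charts V" and j: "j < cdim c"
  shows "{x \<in> cdom c \<inter> k_points V. k_coord c x j = a} \<in> sets \<mu>"
proof -
  let ?U = "{x \<in> cdom c \<inter> k_points V. k_coord c x j \<noteq> a}"
  have "openin T ?U"
    unfolding openin_k_points_topology_iff
  proof (intro conjI ballI)
    fix d x assume d: "d \<in> charts V" and "x \<in> ?U \<inter> cdom d"
    then have x: "x \<in> k_points V" "x \<in> cdom d" "x \<in> cdom c" "k_coord c x j - a \<noteq> 0" by auto
    note lim = transition_vlim[OF variety d c x(1-3)]
    from lim(1) chart_nhds_k_points vlim_nonzero[OF vlim_diff[OF lim(2)[OF j] vlim_const] x(4)]
    show "eventually (\<lambda>y. y \<in> ?U) (chart_nhds V d x)" by eventually_elim auto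
  qed auto
  then have "(cdom c \<inter> k_points V) - ?U \<in> sets \<mu>" using chart_sets[OF c] open_sets by blast
  moreover have "(cdom c \<inter> k_points V) - ?U = {x \<in> cdom c \<inter> k_points V. k_coord c x j = a}" by auto
  ultimately show ?thesis by simp
qed

lemma k_coord_inj:
  assumes c: "c \<in> charts V" and x: "x \<in> cdom c" "x \<in> k_points V" and y: "y \<in> cdom c" "y \<in> k_points V"
    and eq: "\<And>j. j < cdim c \<Longrightarrow> k_coord c x j = k_coord c y j"
  shows "x = y"
proof -
  have inj: "inj_on (coord c) (cdom c)" and "affine_k_variety (cdim c) (coord c ` cdom c)"
    using variety c by (auto simp: k_variety_def)
  then have "coord c ` cdom c \<subseteq> affine_space (cdim c)" unfolding affine_k_variety_def by blast
  then have "coord c x \<in> affine_space (cdim c)" "coord c y \<in> affine_space (cdim c)" using x y by auto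
  moreover have "coord c x j = coord c y j" if "j < cdim c" for j
    using rational_in_coord[OF rational_in_k_point[OF variety x(2) c x(1)] that]
      rational_in_coord[OF rational_in_k_point[OF variety y(2) c y(1)] that] eq[OF that] by simp
  ultimately have "coord c x = coord c y"
    unfolding affine_space_def by (intro PiE_ext) auto
  then show ?thesis using inj_onD[OF inj _ x(1) y(1)] by blast
qed

lemma singleton_sets:
  assumes "x \<in> k_points V"
  shows "{x} \<in> sets \<mu>"
proof -
  obtain c where c: "c \<in> charts V" "x \<in> cdom c" using k_point_chart[OF assms] by blast
  have "(\<Inter>j<cdim c. {y \<in> cdom c \<inter> k_points V. k_coord c y j = k_coord c x j}) \<inter> (cdom c \<inter> k_points V) \<in> sets \<mu>"
  proof (cases "cdim c = 0")
    case True
    then show ?thesis using chart_sets[OF c(1)] by simp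
  next
    case False
    then have "(\<Inter>j<cdim c. {y \<in> cdom c \<inter> k_points V. k_coord c y j = k_coord c x j}) \<in> sets \<mu>"
      using coordinate_sets[OF c(1)] by (intro sets.finite_INT) (simp_all add: lessThan_empty_iff)
    then show ?thesis using chart_sets[OF c(1)] by (rule sets.Int)
  qed
  moreover have "(\<Inter>j<cdim c. {y \<in> cdom c \<inter> k_points V. k_coord c y j = k_coord c x j}) \<inter> (cdom c \<inter> k_points V) = {x}"
    using assms c k_coord_inj[OF c] by fastforce
  ultimately show ?thesis by simp
qed

subsection \<open>Powers of the space\<close>

context
  fixes n :: nat
begin

abbreviation Tn where "Tn \<equiv> product_topology (\<lambda>_. T) {..<n}"
abbreviation Pn where "Pn \<equiv> PiM {..<n} (\<lambda>_. \<mu>)"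

definition act :: "'g \<Rightarrow> (nat \<Rightarrow> 'x) \<Rightarrow> nat \<Rightarrow> 'x" where
  "act g x = (\<lambda>i\<in>{..<n}. \<phi> g (x i))"

lemma space_Pn: "space Pn = {..<n} \<rightarrow>\<^sub>E k_points V"
  by (simp add: space_PiM space_mu)

lemma topspace_Tn: "topspace Tn = space Pn"
  by (simp add: space_Pn topspace_T)

lemma open_sets_Pn:
  assumes U: "openin Tn U"
  shows "U \<in> sets Pn"
proof -
  obtain \<B> where \<B>: "countable \<B>" "\<And>B. B \<in> \<B> \<Longrightarrow> openin T B"
    "\<And>U x. openin T U \<Longrightarrow> x \<in> U \<Longrightarrow> \<exists>B\<in>\<B>. x \<in> B \<and> B \<subseteq> U"
    using countable_base[OF variety separable] by blast
  define K where "K = {b \<in> {..<n} \<rightarrow>\<^sub>E \<B>. Pi\<^sub>E {..<n} b \<subseteq> U}"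
  have "countable ({..<n} \<rightarrow>\<^sub>E \<B>)" using \<B>(1) by (intro countable_PiE) auto
  then have "countable K" unfolding K_def by (rule countable_subset[rotated]) auto
  moreover have "Pi\<^sub>E {..<n} b \<in> sets Pn" if "b \<in> K" for b
    using that \<B>(2) open_sets by (intro sets_PiM_I_finite) (auto simp: K_def)
  ultimately have "(\<Union>b\<in>K. Pi\<^sub>E {..<n} b) \<in> sets Pn" by (intro sets.countable_UN') auto
  moreover have "U = (\<Union>b\<in>K. Pi\<^sub>E {..<n} b)"
  proof
    show "U \<subseteq> (\<Union>b\<in>K. Pi\<^sub>E {..<n} b)"
    proof
      fix x assume "x \<in> U"
      from U[unfolded openin_product_topology_alt, THEN bspec, OF this]
      obtain W where W: "\<forall>i\<in>{..<n}. openin T (W i)" "x \<in> Pi\<^sub>E {..<n} W" "Pi\<^sub>E {..<n} W \<subseteq> U"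
        by (elim exE conjE) (rule that; assumption)
      have "\<forall>i\<in>{..<n}. \<exists>B. B \<in> \<B> \<and> x i \<in> B \<and> B \<subseteq> W i"
        using W(1,2) \<B>(3) unfolding Bex_def[symmetric] by (simp add: PiE_iff)
      from bchoice[OF this] obtain b where b: "\<forall>i\<in>{..<n}. b i \<in> \<B> \<and> x i \<in> b i \<and> b i \<subseteq> W i" ..
      then have "Pi\<^sub>E {..<n} (restrict b {..<n}) \<subseteq> Pi\<^sub>E {..<n} W" by (intro PiE_mono) auto
      then have "restrict b {..<n} \<in> K" using b W(3) by (auto simp: K_def)
      moreover have "x \<in> Pi\<^sub>E {..<n} (restrict b {..<n})" using b W(2) by (auto simp: PiE_iff)
      ultimately show "x \<in> (\<Union>b\<in>K. Pi\<^sub>E {..<n} b)" by blast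
    qed
  qed (auto simp: K_def)
  ultimately show ?thesis by simp
qed

text \<open>The sets that are open relative to a measurable set are measurable, since the topology of the
  power has a countable base of boxes.\<close>

lemma locally_determined_sets:
  assumes A: "A \<in> sets Pn" and S: "S \<subseteq> A"
    and loc: "\<And>x. x \<in> S \<Longrightarrow> eventually (\<lambda>y. y \<in> A \<longrightarrow> y \<in> S) (nhdsin Tn x)"
  shows "S \<in> sets Pn"
proof -
  define W where "W = \<Union> {U. openin Tn U \<and> U \<inter> A \<subseteq> S}"
  have "openin Tn W" unfolding W_def by (intro openin_Union) auto
  then have "A \<inter> W \<in> sets Pn" using A open_sets_Pn by blast
  moreover have "A \<inter> W = S"
  proof
    show "A \<inter> W \<subseteq> S" by (auto simp: W_def)
    show "S \<subseteq> A \<inter> W"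
    proof
      fix x assume x: "x \<in> S"
      then have "x \<in> topspace Tn" using S sets.sets_into_space[OF A] unfolding topspace_Tn by blast
      then obtain U where "openin Tn U" "x \<in> U" "\<forall>y\<in>U. y \<in> A \<longrightarrow> y \<in> S"
        using loc[OF x] unfolding eventually_nhdsin by blast
      then show "x \<in> A \<inter> W" using x S unfolding W_def by blast
    qed
  qed
  ultimately show ?thesis by simp
qed

lemma eventually_component:
  assumes i: "i < n" and x: "x \<in> space Pn" and ev: "eventually P (nhdsin T (x i))"
  shows "eventually (\<lambda>y. P (y i)) (nhdsin Tn x)"
proof -
  have "x i \<in> topspace T" using x i by (auto simp: space_Pn topspace_T PiE_iff)
  then obtain U where U: "openin T U" "x i \<in> U" "\<forall>y\<in>U. P y"
    using ev unfolding eventually_nhdsin by blast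
  have "continuous_map Tn T (\<lambda>y. y i)" using i by (intro continuous_map_product_projection) auto
  then have "openin Tn {y \<in> topspace Tn. y i \<in> U}" using U(1) by (rule openin_continuous_map_preimage)
  moreover have "x \<in> {y \<in> topspace Tn. y i \<in> U}" using x U(2) by (simp only: topspace_Tn mem_Collect_eq)
  moreover have "\<forall>y\<in>{y \<in> topspace Tn. y i \<in> U}. P (y i)" using U(3) by blast
  ultimately show ?thesis unfolding eventually_nhdsin by blast
qed

lemma vlim_component:
  assumes "i < n" "x \<in> space Pn" "vlim (nhdsin T (x i)) h a"
  shows "vlim (nhdsin Tn x) (\<lambda>y. h (y i)) a"
  using assms(3) eventually_component[OF assms(1,2)] unfolding vlim_less by blast

lemma act_closed: "g \<in> L \<Longrightarrow> x \<in> space Pn \<Longrightarrow> act g x \<in> space Pn"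
  by (auto simp: act_def space_Pn PiE_iff phi_closed)

lemma act_mult: "g \<in> L \<Longrightarrow> h \<in> L \<Longrightarrow> x \<in> space Pn \<Longrightarrow> act (g \<otimes>\<^bsub>G\<^esub> h) x = act g (act h x)"
  by (auto simp: act_def space_Pn PiE_iff phi_mult fun_eq_iff)

lemma act_one: "x \<in> space Pn \<Longrightarrow> act \<one>\<^bsub>G\<^esub> x = x"
  by (auto simp: act_def space_Pn PiE_iff phi_one fun_eq_iff extensional_def)

lemma ergodic_power:
  assumes "E \<in> sets Pn" "\<And>g x. g \<in> L \<Longrightarrow> x \<in> space Pn \<Longrightarrow> act g x \<in> E \<longleftrightarrow> x \<in> E"
  shows "(AE x in Pn. x \<in> E) \<or> (AE x in Pn. x \<notin> E)"
  using weakly_mixing_power_ergodic[OF prob mixing invariant _ assms(1)] assms(2)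
  by (auto simp: act_def)

text \<open>Restricting the orbit to one chart makes coordinates available on it.  The set depends on the orbit
  of \<open>x\<close> alone, and so does everything that is defined from it.\<close>

definition chart_orbit :: "('x, 'k) chart \<Rightarrow> (nat \<Rightarrow> 'x) \<Rightarrow> (nat \<Rightarrow> 'x) set" where
  "chart_orbit c x = {z. (\<exists>g\<in>L. z = act g x) \<and> (\<forall>i<n. z i \<in> cdom c)}"

lemma chart_orbit_act:
  assumes h: "h \<in> L" and x: "x \<in> space Pn"
  shows "chart_orbit c (act h x) = chart_orbit c x"
proof -
  have "(\<exists>g\<in>L. z = act g (act h x)) \<longleftrightarrow> (\<exists>g\<in>L. z = act g x)" for z
  proof
    assume "\<exists>g\<in>L. z = act g (act h x)"
    then show "\<exists>g\<in>L. z = act g x" using act_mult[OF _ h x] L_mult[OF _ h] by metis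
  next
    assume "\<exists>g\<in>L. z = act g x"
    then obtain g where g: "g \<in> L" "z = act g x" by blast
    obtain h' where h': "h' \<in> L" "h' \<otimes>\<^bsub>G\<^esub> h = \<one>\<^bsub>G\<^esub>" using L_inverse[OF h] by blast
    have "act (g \<otimes>\<^bsub>G\<^esub> h') (act h x) = act g (act h' (act h x))"
      by (rule act_mult[OF g(1) h'(1) act_closed[OF h x]])
    also have "\<dots> = act g (act (h' \<otimes>\<^bsub>G\<^esub> h) x)" by (simp only: act_mult[OF h'(1) h x])
    finally have "act (g \<otimes>\<^bsub>G\<^esub> h') (act h x) = act g (act (h' \<otimes>\<^bsub>G\<^esub> h) x)" .
    then show "\<exists>g\<in>L. z = act g (act h x)"
      using g h' x act_one L_mult[OF g(1) h'(1)] by (intro bexI[of _ "g \<otimes>\<^bsub>G\<^esub> h'"]) simp_all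
  qed
  then show ?thesis by (simp add: chart_orbit_def)
qed

end

end


section \<open>From relations on orbits to atoms\<close>

context weakly_mixing_k_action
begin

text \<open>The point \<open>g x\<close> of the orbit of \<open>x\<close> is followed by the points \<open>g y\<close>.\<close>

lemma varying_family_chart_orbit:
  assumes c: "c \<in> charts V" and j: "j < cdim c"
  shows "varying_family v (nhdsin (Tn n)) (space (Pn n)) (chart_orbit n c)
    (\<lambda>a z. \<Prod>i<n. k_coord c (z i) j ^ ex a i)"
proof unfold_locales
  fix P x assume x: "x \<in> space (Pn n)" and "eventually P (nhdsin (Tn n) x)"
  then have "\<exists>S. openin (Tn n) S \<and> x \<in> S \<and> (\<forall>y\<in>S. P y)"
    unfolding eventually_nhdsin topspace_Tn by blast
  then show "P x" by blast
next
  fix x z assume x: "x \<in> space (Pn n)" and z: "z \<in> chart_orbit n c x"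
  then obtain g where g: "g \<in> L" "z = act n g x" and "\<And>i. i < n \<Longrightarrow> z i \<in> cdom c"
    by (auto simp: chart_orbit_def)
  then have gx: "\<phi> g (x i) \<in> cdom c" if "i < n" for i using that by (auto simp: act_def)
  have xi: "x i \<in> k_points V" if "i < n" for i using x that by (auto simp: space_Pn PiE_iff)
  note act_i = k_action_vlim[OF action group_variety variety L_k_points[OF g(1)] xi c gx]
  have "eventually (\<lambda>y. \<forall>i\<in>{..<n}. \<phi> g (y i) \<in> cdom c) (nhdsin (Tn n) x)"
    using eventually_component[OF _ x act_i(1)] by (intro eventually_ball_finite) auto
  then have "eventually (\<lambda>y. act n g y \<in> chart_orbit n c y) (nhdsin (Tn n) x)"
    by eventually_elim (use g(1) in \<open>auto simp: chart_orbit_def act_def\<close>)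
  moreover have "vlim (nhdsin (Tn n) x) (\<lambda>y. \<Prod>i<n. k_coord c (act n g y i) j ^ ex a i)
      (\<Prod>i<n. k_coord c (z i) j ^ ex a i)" for a
  proof (intro vlim_prod vlim_power)
    fix i assume "i \<in> {..<n}"
    then have i: "i < n" by simp
    have "vlim (nhdsin (Tn n) x) (\<lambda>y. k_coord c (\<phi> g (y i)) j) (k_coord c (\<phi> g (x i)) j)"
      by (rule vlim_component[OF i x act_i(2)[OF i i j]])
    then show "vlim (nhdsin (Tn n) x) (\<lambda>y. k_coord c (act n g y i) j) (k_coord c (z i) j)"
      using i by (simp add: act_def g(2))
  qed
  ultimately show "\<exists>s. s x = z \<and> eventually (\<lambda>y. s y \<in> chart_orbit n c y) (nhdsin (Tn n) x) \<and>
      (\<forall>a. vlim (nhdsin (Tn n) x) (\<lambda>y. \<Prod>i<n. k_coord c (s y i) j ^ ex a i)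
        (\<Prod>i<n. k_coord c (z i) j ^ ex a i))"
    using g(2) by (intro exI[of _ "act n g"]) simp
qed

text \<open>The points at which the first relation has a given index \<open>t\<close> form a strictly invariant measurable
  set, and so do, inside it, the points at which a coefficient lies in a given ball.  By ergodicity of the
  power these sets are null or conull; countably many balls determine the coefficients.\<close>

lemma AE_constant_relation:
  fixes M :: "nat \<Rightarrow> (nat \<Rightarrow> 'x) \<Rightarrow> 'k"
  assumes fam: "varying_family v (nhdsin (Tn n)) (space (Pn n)) (chart_orbit n c) M"
  defines "indep \<equiv> varying_family.indep (chart_orbit n c) M"
    and "rel \<equiv> varying_family.rel (chart_orbit n c) M"
  assumes pos: "\<not> (AE x in Pn n. \<not> (indep t x \<and> \<not> indep (Suc t) x))"
  shows "\<exists>k. AE x in Pn n. rel t x k"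
proof -
  interpret F: varying_family v "nhdsin (Tn n)" "space (Pn n)" "chart_orbit n c" M by (rule fam)
  interpret Pn: prob_space "Pn n" by (intro prob_space_PiM prob)
  have indep_sets: "{x \<in> space (Pn n). indep s x} \<in> sets (Pn n)" for s
  proof (rule locally_determined_sets[OF sets.top])
    fix x assume "x \<in> {x \<in> space (Pn n). indep s x}"
    then have "eventually (indep s) (nhdsin (Tn n) x)"
      unfolding indep_def by (intro F.indep_eventually) auto
    then show "eventually (\<lambda>y. y \<in> space (Pn n) \<longrightarrow> y \<in> {x \<in> space (Pn n). indep s x}) (nhdsin (Tn n) x)"
      by eventually_elim simp
  qed auto
  have indep_act: "indep s (act n g x) \<longleftrightarrow> indep s x" if "g \<in> L" "x \<in> space (Pn n)" for s g x
    unfolding indep_def F.indep_def chart_orbit_act[OF that] ..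
  have rel_act: "rel s (act n g x) = rel s x" if "g \<in> L" "x \<in> space (Pn n)" for s g x
    unfolding rel_def F.rel_def chart_orbit_act[OF that] ..
  define E where "E = {x \<in> space (Pn n). indep t x \<and> \<not> indep (Suc t) x}"
  have "E = {x \<in> space (Pn n). indep t x} - {x \<in> space (Pn n). indep (Suc t) x}"
    by (auto simp: E_def)
  then have E: "E \<in> sets (Pn n)" using indep_sets by simp
  have E_act: "act n g x \<in> E \<longleftrightarrow> x \<in> E" if "g \<in> L" "x \<in> space (Pn n)" for g x
    using indep_act[OF that] act_closed[OF that] that by (simp add: E_def)
  have "\<not> (AE x in Pn n. x \<notin> E)"
  proof
    assume "AE x in Pn n. x \<notin> E"
    with AE_space have "AE x in Pn n. \<not> (indep t x \<and> \<not> indep (Suc t) x)"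
      by eventually_elim (simp add: E_def)
    with pos show False ..
  qed
  then have AE_E: "AE x in Pn n. x \<in> E" using ergodic_power[OF E E_act] by blast
  define k where "k x = (SOME k. rel t x k)" for x
  have k: "rel t x (k x)" if "x \<in> E" for x
  proof -
    have "\<exists>k. rel t x k"
      using that F.rel_exists[of t x] by (simp add: E_def indep_def rel_def)
    then show ?thesis unfolding k_def by (rule someI_ex)
  qed
  obtain D where D: "countable D" "\<And>x e. e > 0 \<Longrightarrow> \<exists>q\<in>D. v (x - q) < e"
    using countable_dense[OF separable] by blast
  define B where "B a q m = {x \<in> E. v (k x a - q) < 1 / real (Suc m)}" for a q m
  have B: "B a q m \<in> sets (Pn n)" if a: "a < t" for a q m
  proof (rule locally_determined_sets[OF E])
    fix x assume x: "x \<in> B a q m"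
    define e where "e = 1 / real (Suc m) - v (k x a - q)"
    have "e > 0" and xE: "x \<in> E" using x by (auto simp: B_def e_def)
    have "eventually (\<lambda>y. \<forall>k'. rel t y k' \<longrightarrow> v (k' a - k x a) < e) (nhdsin (Tn n) x)"
      using xE k[OF xE] a \<open>e > 0\<close> unfolding indep_def rel_def
      by (intro F.rel_eventually) (auto simp: E_def indep_def)
    then show "eventually (\<lambda>y. y \<in> E \<longrightarrow> y \<in> B a q m) (nhdsin (Tn n) x)"
    proof eventually_elim
      case (elim y)
      show ?case
      proof
        assume y: "y \<in> E"
        then have "v (k y a - k x a) < e" using elim k by blast
        then show "y \<in> B a q m"
          using y v_triangle[of "k y a" q "k x a"] by (simp add: B_def e_def)
      qed
    qed
  qed (auto simp: B_def)
  have B_act: "act n g x \<in> B a q m \<longleftrightarrow> x \<in> B a q m" if "g \<in> L" "x \<in> space (Pn n)" for g x a q m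
    unfolding B_def k_def using E_act[OF that] rel_act[OF that] by simp
  have dichotomy: "AE x in Pn n. x \<in> B a q m \<longleftrightarrow> (AE y in Pn n. y \<in> B a q m)" if "a < t" for a q m
    using ergodic_power[OF B[OF that] B_act, of q m]
  proof
    assume "AE x in Pn n. x \<in> B a q m"
    then show ?thesis by simp
  next
    assume out: "AE x in Pn n. x \<notin> B a q m"
    have "\<not> (AE x in Pn n. x \<in> B a q m)"
    proof
      assume "AE x in Pn n. x \<in> B a q m"
      with out have "AE x in Pn n. False" by eventually_elim simp
      then show False by simp
    qed
    with out show ?thesis by simp
  qed
  define good where "good x \<longleftrightarrow> x \<in> E \<and>
    (\<forall>a\<in>{..<t}. \<forall>q\<in>D. \<forall>m::nat. x \<in> B a q m \<longleftrightarrow> (AE y in Pn n. y \<in> B a q m))" for x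
  have "AE x in Pn n. \<forall>a\<in>{..<t}. \<forall>q\<in>D. \<forall>m::nat. x \<in> B a q m \<longleftrightarrow> (AE y in Pn n. y \<in> B a q m)"
    using dichotomy D(1) by (simp add: AE_ball_countable AE_all_countable)
  with AE_E have AE_good: "AE x in Pn n. good x" by eventually_elim (simp add: good_def)
  then obtain x0 where x0: "good x0" using eventually_happens'[OF Pn.ae_filter_bot] by blast
  have const: "k x a = k x0 a" if x: "good x" and a: "a < t" for x a
  proof -
    have "v (k x a - k x0 a) < 2 / real (Suc m)" for m
    proof -
      obtain q where q: "q \<in> D" "v (k x0 a - q) < 1 / real (Suc m)" using D(2)[of "1 / real (Suc m)"] by auto
      then have "x0 \<in> B a q m" using x0 by (simp add: B_def good_def)
      then have "x \<in> B a q m" using x x0 a q(1) by (auto simp: good_def)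
      then have "v (k x a - q) < 1 / real (Suc m)" by (simp add: B_def)
      then have "v (k x a - k x0 a) < 1 / real (Suc m) + 1 / real (Suc m)"
        using q(2) v_triangle[of "k x a" "k x0 a" q] v_minus_commute[of q "k x0 a"] by linarith
      then show ?thesis by (simp only: add_divide_distrib[symmetric] one_add_one)
    qed
    then have "v (k x a - k x0 a) / 2 < 1 / real (Suc m)" for m by (simp add: field_simps)
    then have "\<not> v (k x a - k x0 a) / 2 > 0" using nat_approx_posE by (metis less_asym)
    then show ?thesis using v_nonneg[of "k x a - k x0 a"] v_eq_0[of "k x a - k x0 a"] by simp
  qed
  from AE_good have "AE x in Pn n. rel t x (k x0)"
  proof eventually_elim
    case (elim x)
    then have "rel t x (k x)" using k by (simp add: good_def)
    moreover have "(\<Sum>a<t. k x a * M a z) = (\<Sum>a<t. k x0 a * M a z)" for z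
      using const[OF elim] by (intro sum.cong) auto
    ultimately show ?case by (simp add: rel_def F.rel_def)
  qed
  then show ?thesis by blast
qed

text \<open>A point of \<open>V\<^sup>n\<close> all of whose entries lie in the domain of \<open>c\<close> belongs to its own restricted
  orbit.  So the almost surely constant relation between the monomials on orbits holds at almost all such points.\<close>

lemma AE_chart_coordinate_relation:
  assumes c: "c \<in> charts V" and j: "j < cdim c"
  shows "\<exists>(n::nat) d a. (\<exists>b\<in>{..<n} \<rightarrow>\<^sub>E {..<d}. a b \<noteq> 0) \<and> (AE x in PiM {..<n} (\<lambda>_. \<mu>).
    (\<forall>i<n. x i \<in> cdom c) \<longrightarrow> (\<Sum>b\<in>{..<n} \<rightarrow>\<^sub>E {..<d}. a b * (\<Prod>i<n. k_coord c (x i) j ^ b i)) = 0)"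
proof -
  define m where "m = Max (insert 0 (cdim ` charts \<G>))"
  have m: "cdim e \<le> m" if "e \<in> charts \<G>" for e
    using that group_variety unfolding m_def k_variety_def by (intro Max_ge) auto
  define n where "n = Suc m"
  define expo where "expo d = {..<n} \<rightarrow>\<^sub>E {..<d::nat}" for d
  have fin: "finite (expo d)" for d unfolding expo_def by (rule finite_exponents)
  have "\<exists>h. bij_betw h {..<card (expo d)} (expo d)" for d
    using ex_bij_betw_nat_finite[OF fin] by (simp add: atLeast0LessThan)
  then obtain ex where ex: "\<And>d. bij_betw (ex d) {..<card (expo d)} (expo d)" by metis
  define M where "M d a z = (\<Prod>i<n. k_coord c (z i) j ^ ex d a i)" for d a z
  define indep where "indep d = varying_family.indep (chart_orbit n c) (M d)" for d
  define rel where "rel d = varying_family.rel (chart_orbit n c) (M d)" for d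
  have fam: "varying_family v (nhdsin (Tn n)) (space (Pn n)) (chart_orbit n c) (M d)" for d
    unfolding M_def[abs_def] by (rule varying_family_chart_orbit[OF c j])
  interpret Pn: prob_space "Pn n" by (intro prob_space_PiM prob)
  have sum_ex: "(\<Sum>s<card (expo d). f (ex d s)) = (\<Sum>b\<in>expo d. f b)" for d and f :: "_ \<Rightarrow> 'k"
    by (rule sum.reindex_bij_betw[OF ex])
  \<comment> \<open>By counting dimensions, every orbit satisfies some relation.\<close>
  have dep: "\<exists>d t. t < card (expo d) \<and> indep d t x \<and> \<not> indep d (Suc t) x" if x: "x \<in> space (Pn n)" for x
  proof -
    have xi: "x i \<in> k_points V" if "i < Suc m" for i
      using x that by (auto simp: space_Pn PiE_iff n_def)
    have "\<exists>d a. (\<exists>b\<in>expo d. a b \<noteq> 0) \<and> (\<forall>g\<in>k_points \<G>. (\<forall>i<n. \<phi> g (x i) \<in> cdom c) \<longrightarrow>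
      (\<Sum>b\<in>expo d. a b * (\<Prod>i<n. k_coord c (\<phi> g (x i)) j ^ b i)) = 0)"
      unfolding n_def expo_def
      by (rule orbit_algebraic_dependence[OF action group_variety variety _ _ c j]) (fact m, fact xi)
    then obtain d a where a: "\<exists>b\<in>expo d. a b \<noteq> 0" and rel0: "\<forall>g\<in>k_points \<G>. (\<forall>i<n. \<phi> g (x i) \<in> cdom c) \<longrightarrow>
      (\<Sum>b\<in>expo d. a b * (\<Prod>i<n. k_coord c (\<phi> g (x i)) j ^ b i)) = 0"
      by (elim exE conjE) (rule that; assumption)
    interpret F: varying_family v "nhdsin (Tn n)" "space (Pn n)" "chart_orbit n c" "M d" by (rule fam)
    have zero: "(\<Sum>s<card (expo d). a (ex d s) * M d s z) = 0" if z: "z \<in> chart_orbit n c x" for z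
    proof -
      obtain g where g: "g \<in> L" "z = act n g x" "\<forall>i<n. z i \<in> cdom c"
        using z by (auto simp: chart_orbit_def)
      then have "(\<Sum>b\<in>expo d. a b * (\<Prod>i<n. k_coord c (\<phi> g (x i)) j ^ b i)) = 0"
        using rel0 L_k_points by (auto simp: act_def)
      moreover have "(\<Prod>i<n. k_coord c (\<phi> g (x i)) j ^ b i) = (\<Prod>i<n. k_coord c (z i) j ^ b i)" for b
        using g by (intro prod.cong) (auto simp: act_def)
      ultimately show ?thesis
        unfolding M_def using sum_ex[of "\<lambda>b. a b * (\<Prod>i<n. k_coord c (z i) j ^ b i)" d] by simp
    qed
    obtain s where s: "s < card (expo d)" "a (ex d s) \<noteq> 0"
      using a bij_betw_imp_surj_on[OF ex[of d]] by (metis imageE lessThan_iff)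
    have not_indep: "\<not> indep d (card (expo d)) x"
    proof
      assume "indep d (card (expo d)) x"
      from this[unfolded indep_def F.indep_def, THEN spec, of "\<lambda>s. a (ex d s)"] zero s
      show False by simp
    qed
    have "indep d 0 x" by (simp add: indep_def F.indep_def)
    have "\<exists>t<card (expo d). indep d t x \<and> \<not> indep d (Suc t) x"
    proof (rule ccontr)
      assume no: "\<not> ?thesis"
      have "t \<le> card (expo d) \<Longrightarrow> indep d t x" for t
        by (induction t) (use \<open>indep d 0 x\<close> no in auto)
      with not_indep show False by blast
    qed
    then show ?thesis by blast
  qed
  have "\<exists>d t. t < card (expo d) \<and> \<not> (AE x in Pn n. \<not> (indep d t x \<and> \<not> indep d (Suc t) x))"
  proof (rule ccontr)
    assume no: "\<not> ?thesis"
    have "AE x in Pn n. \<forall>d t. t < card (expo d) \<longrightarrow> \<not> (indep d t x \<and> \<not> indep d (Suc t) x)"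
      unfolding AE_all_countable
    proof (intro allI)
      fix d t show "AE x in Pn n. t < card (expo d) \<longrightarrow> \<not> (indep d t x \<and> \<not> indep d (Suc t) x)"
        using no by (cases "t < card (expo d)") auto
    qed
    with AE_space have "AE x in Pn n. False"
      by eventually_elim (use dep in blast)
    then show False by simp
  qed
  then obtain d t where t: "t < card (expo d)"
    and pos: "\<not> (AE x in Pn n. \<not> (indep d t x \<and> \<not> indep d (Suc t) x))" by blast
  interpret F: varying_family v "nhdsin (Tn n)" "space (Pn n)" "chart_orbit n c" "M d" by (rule fam)
  obtain k where k: "AE x in Pn n. rel d t x k"
    using AE_constant_relation[OF fam pos[unfolded indep_def]] unfolding rel_def by blast
  define h where "h s = (if s < t then - k s else if s = t then 1 else 0)" for s
  define a where "a b = h (the_inv_into {..<card (expo d)} (ex d) b)" for b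
  have a_ex: "a (ex d s) = h s" if "s < card (expo d)" for s
    unfolding a_def using that ex[of d] by (simp add: the_inv_into_f_f bij_betw_imp_inj_on)
  have sum_a: "(\<Sum>b\<in>expo d. a b * (\<Prod>i<n. k_coord c (z i) j ^ b i)) = M d t z - (\<Sum>s<t. k s * M d s z)" for z
  proof -
    have "(\<Sum>b\<in>expo d. a b * (\<Prod>i<n. k_coord c (z i) j ^ b i)) = (\<Sum>s<card (expo d). h s * M d s z)"
      unfolding sum_ex[symmetric] by (intro sum.cong) (auto simp: a_ex M_def)
    also have "\<dots> = (\<Sum>s<Suc t. h s * M d s z)"
      using t by (intro sum.mono_neutral_right) (auto simp: h_def)
    also have "(\<Sum>s<Suc t. h s * M d s z) = M d t z + (\<Sum>s<t. h s * M d s z)"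
      by (simp add: h_def)
    also have "(\<Sum>s<t. h s * M d s z) = - (\<Sum>s<t. k s * M d s z)"
      unfolding sum_negf[symmetric] by (intro sum.cong) (auto simp: h_def)
    finally show ?thesis by simp
  qed
  have "\<exists>b\<in>expo d. a b \<noteq> 0"
    using t a_ex[OF t] bij_betwE[OF ex[of d]] by (intro bexI[of _ "ex d t"]) (auto simp: h_def)
  moreover have "AE x in Pn n. (\<forall>i<n. x i \<in> cdom c) \<longrightarrow>
      (\<Sum>b\<in>expo d. a b * (\<Prod>i<n. k_coord c (x i) j ^ b i)) = 0"
    using k AE_space
  proof eventually_elim
    case (elim x)
    show ?case
    proof
      assume "\<forall>i<n. x i \<in> cdom c"
      then have "x \<in> chart_orbit n c x"
        using L_one act_one[OF elim(2)] unfolding chart_orbit_def by force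
      then show "(\<Sum>b\<in>expo d. a b * (\<Prod>i<n. k_coord c (x i) j ^ b i)) = 0"
        using elim(1) by (simp add: sum_a rel_def F.rel_def)
    qed
  qed
  ultimately show ?thesis
    unfolding expo_def by - (intro exI[of _ n] exI[of _ d] exI[of _ a] conjI)
qed

lemma coordinate_atom:
  assumes c: "c \<in> charts V" and j: "j < cdim c"
    and S: "S \<in> sets \<mu>" "S \<subseteq> cdom c" "emeasure \<mu> S \<noteq> 0"
  shows "\<exists>r. {x \<in> S. k_coord c x j = r} \<in> sets \<mu> \<and> emeasure \<mu> {x \<in> S. k_coord c x j = r} \<noteq> 0"
proof (rule ccontr)
  assume no: "\<not> ?thesis"
  have "{x \<in> S. k_coord c x j = r} \<in> sets \<mu>" for r
  proof -
    have "{x \<in> S. k_coord c x j = r} = S \<inter> {x \<in> cdom c \<inter> k_points V. k_coord c x j = r}"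
      using S(2) sets.sets_into_space[OF S(1)] by (auto simp: space_mu)
    then show ?thesis using S(1) coordinate_sets[OF c j] by simp
  qed
  then have null: "{x \<in> S. k_coord c x j = r} \<in> null_sets \<mu>" for r
    using no by (auto simp: null_sets_def)
  obtain n :: nat and d a where a: "\<exists>b\<in>{..<n} \<rightarrow>\<^sub>E {..<d}. a b \<noteq> 0"
    and rel: "AE x in PiM {..<n} (\<lambda>_. \<mu>). (\<forall>i<n. x i \<in> cdom c) \<longrightarrow>
      (\<Sum>b\<in>{..<n} \<rightarrow>\<^sub>E {..<d}. a b * (\<Prod>i<n. k_coord c (x i) j ^ b i)) = 0"
    using AE_chart_coordinate_relation[OF c j] by blast
  have "AE x in PiM {..<n} (\<lambda>_. \<mu>). (\<forall>i\<in>{..<n}. x i \<in> S) \<longrightarrow>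
      (\<Sum>b\<in>{..<n} \<rightarrow>\<^sub>E {..<d}. a b * (\<Prod>i\<in>{..<n}. k_coord c (x i) j ^ b i)) = 0"
    using rel by eventually_elim (use S(2) in auto)
  from AE_polynomial_relation_trivial[OF prob S(1,3) null _ this] a show False by auto
qed

text \<open>Starting from a chart domain of positive measure, the coordinates are made constant one after the
  other on sets of positive measure.  The final set is a single point, as the coordinates separate points.\<close>

lemma atom_exists: "\<exists>x\<in>k_points V. emeasure \<mu> {x} \<noteq> 0"
proof -
  have "\<exists>c\<in>charts V. emeasure \<mu> (cdom c \<inter> k_points V) \<noteq> 0"
  proof (rule ccontr)
    assume "\<not> ?thesis"
    then have "(\<Union>c\<in>charts V. cdom c \<inter> k_points V) \<in> null_sets \<mu>"
      using variety chart_sets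
      by (intro null_sets_UN' countable_finite) (auto simp: k_variety_def null_sets_def)
    moreover have "(\<Union>c\<in>charts V. cdom c \<inter> k_points V) = space \<mu>"
      by (auto simp: space_mu elim: k_point_chart)
    ultimately show False using emeasure_space_1 by auto
  qed
  then obtain c where c: "c \<in> charts V" "emeasure \<mu> (cdom c \<inter> k_points V) \<noteq> 0" by blast
  have "m \<le> cdim c \<Longrightarrow> \<exists>S r. S \<in> sets \<mu> \<and> S \<subseteq> cdom c \<and> emeasure \<mu> S \<noteq> 0 \<and>
      (\<forall>x\<in>S. \<forall>j<m. k_coord c x j = r j)" for m
  proof (induction m)
    case 0
    then show ?case using c chart_sets by (intro exI[of _ "cdom c \<inter> k_points V"]) auto
  next
    case (Suc m)
    then obtain S r where S: "S \<in> sets \<mu>" "S \<subseteq> cdom c" "emeasure \<mu> S \<noteq> 0"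
      "\<forall>x\<in>S. \<forall>j<m. k_coord c x j = r j" by auto
    obtain s where "{x \<in> S. k_coord c x m = s} \<in> sets \<mu>" "emeasure \<mu> {x \<in> S. k_coord c x m = s} \<noteq> 0"
      using coordinate_atom[OF c(1) _ S(1-3), of m] Suc.prems by auto
    then show ?case using S(2,4)
      by (intro exI[of _ "{x \<in> S. k_coord c x m = s}"] exI[of _ "r(m := s)"]) (auto simp: less_Suc_eq)
  qed
  from this[OF order_refl] obtain S r where S: "S \<in> sets \<mu>" "S \<subseteq> cdom c" "emeasure \<mu> S \<noteq> 0"
    and r: "\<forall>x\<in>S. \<forall>j<cdim c. k_coord c x j = r j" by (elim exE conjE) (rule that; assumption)
  have "S \<noteq> {}" using S(3) by auto
  then obtain x where x: "x \<in> S" by blast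
  have S_points: "S \<subseteq> k_points V" using sets.sets_into_space[OF S(1)] by (simp add: space_mu)
  have "y = x" if "y \<in> S" for y
    using k_coord_inj[OF c(1), of y x] that x r S(2) S_points by auto
  then have "S = {x}" using x by blast
  then show ?thesis using S(3) S_points by auto
qed

lemma measure_phi:
  assumes g: "g \<in> L" and x: "x \<in> k_points V"
  shows "measure \<mu> {\<phi> g x} = measure \<mu> {x}"
proof -
  have meas: "\<phi> g \<in> measurable \<mu> \<mu>" and distr: "distr \<mu> \<mu> (\<phi> g) = \<mu>"
    using invariant g by (auto simp: invariant_measure_def)
  have "\<phi> g -` {\<phi> g x} \<inter> space \<mu> = {x}"
    using phi_inj[OF g _ x] x by (auto simp: space_mu)
  then show ?thesis
    using measure_distr[OF meas singleton_sets[OF phi_closed[OF g x]]] distr by simp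
qed

text \<open>The pairs \<open>(y, y)\<close> with \<open>y\<close> an atom form a strictly invariant set of positive measure in the
  square, hence a conull one.  But it does not meet \<open>{x} \<times> (V - {x})\<close>.\<close>

lemma full_atom:
  assumes x: "x \<in> k_points V" "emeasure \<mu> {x} \<noteq> 0"
  shows "prob {x} = 1"
proof -
  interpret MM: pair_prob_space \<mu> \<mu> ..
  define A where "A = {y. measure \<mu> {y} \<noteq> 0}"
  have A: "countable A" unfolding A_def by (rule countable_support)
  have A_points: "A \<subseteq> k_points V"
  proof
    fix y assume "y \<in> A"
    then have "{y} \<in> sets \<mu>" using measure_notin_sets[of "{y}" \<mu>] by (auto simp: A_def)
    then show "y \<in> k_points V" using sets.sets_into_space[of "{y}" \<mu>] by (auto simp: space_mu)
  qed
  define \<Delta> where "\<Delta> = (\<Union>y\<in>A. {y} \<times> {y})"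
  have diag: "(y, z) \<in> \<Delta> \<longleftrightarrow> y = z \<and> y \<in> A" for y z by (auto simp: \<Delta>_def)
  have "{y} \<times> {y} \<in> sets (\<mu> \<Otimes>\<^sub>M \<mu>)" if "y \<in> A" for y
    using that A_points singleton_sets by (intro pair_measureI) auto
  then have \<Delta>: "\<Delta> \<in> sets (\<mu> \<Otimes>\<^sub>M \<mu>)" unfolding \<Delta>_def using A by (intro sets.countable_UN') auto
  have "map_prod (\<phi> g) (\<phi> g) -` \<Delta> \<inter> space (\<mu> \<Otimes>\<^sub>M \<mu>) = \<Delta>" if g: "g \<in> L" for g
  proof -
    have "(\<phi> g y, \<phi> g z) \<in> \<Delta> \<longleftrightarrow> (y, z) \<in> \<Delta>" if "y \<in> k_points V" "z \<in> k_points V" for y z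
    proof -
      have "\<phi> g y = \<phi> g z \<longleftrightarrow> y = z" using phi_inj[OF g that] by metis
      moreover have "\<phi> g y \<in> A \<longleftrightarrow> y \<in> A" using measure_phi[OF g that(1)] by (simp add: A_def)
      ultimately show ?thesis by (simp only: diag)
    qed
    moreover have "\<Delta> \<subseteq> k_points V \<times> k_points V" using A_points by (auto simp: \<Delta>_def)
    ultimately show ?thesis by (fastforce simp: space_pair_measure space_mu)
  qed
  then have zero_one: "emeasure (\<mu> \<Otimes>\<^sub>M \<mu>) \<Delta> = 0 \<or> emeasure (\<mu> \<Otimes>\<^sub>M \<mu>) (space (\<mu> \<Otimes>\<^sub>M \<mu>) - \<Delta>) = 0"
    by (intro mixing[unfolded weakly_mixing_def ergodic_def, THEN bspec, OF \<Delta>, THEN mp] ballI)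
  have xs: "{x} \<in> sets \<mu>" by (rule singleton_sets[OF x(1)])
  have "x \<in> A" using x(2) by (simp add: A_def emeasure_eq_measure)
  then have "{x} \<times> {x} \<subseteq> \<Delta>" by (auto simp: \<Delta>_def)
  then have "emeasure (\<mu> \<Otimes>\<^sub>M \<mu>) ({x} \<times> {x}) \<le> emeasure (\<mu> \<Otimes>\<^sub>M \<mu>) \<Delta>"
    by (rule emeasure_mono[OF _ \<Delta>])
  moreover have "emeasure (\<mu> \<Otimes>\<^sub>M \<mu>) ({x} \<times> {x}) = emeasure \<mu> {x} * emeasure \<mu> {x}"
    by (rule emeasure_pair_measure_Times[OF xs xs])
  ultimately have "emeasure (\<mu> \<Otimes>\<^sub>M \<mu>) \<Delta> \<noteq> 0" using x(2) by auto
  with zero_one have "emeasure (\<mu> \<Otimes>\<^sub>M \<mu>) (space (\<mu> \<Otimes>\<^sub>M \<mu>) - \<Delta>) = 0" by blast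
  moreover have "{x} \<times> (space \<mu> - {x}) \<subseteq> space (\<mu> \<Otimes>\<^sub>M \<mu>) - \<Delta>"
    using x(1) by (auto simp: \<Delta>_def space_pair_measure space_mu)
  then have "emeasure (\<mu> \<Otimes>\<^sub>M \<mu>) ({x} \<times> (space \<mu> - {x})) \<le> emeasure (\<mu> \<Otimes>\<^sub>M \<mu>) (space (\<mu> \<Otimes>\<^sub>M \<mu>) - \<Delta>)"
    using \<Delta> by (intro emeasure_mono) auto
  moreover have "emeasure (\<mu> \<Otimes>\<^sub>M \<mu>) ({x} \<times> (space \<mu> - {x})) = emeasure \<mu> {x} * emeasure \<mu> (space \<mu> - {x})"
    using xs by (intro emeasure_pair_measure_Times) auto
  ultimately have "emeasure \<mu> (space \<mu> - {x}) = 0" using x(2) by simp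
  then have "prob (space \<mu> - {x}) = 0" by (simp add: measure_def)
  then show ?thesis using prob_compl[OF xs] by simp
qed

lemma dirac_at_fixed_point:
  "\<exists>x\<in>fixed_points L \<phi> (k_points V). \<mu> = return (borel_measurable_space T) x"
proof -
  obtain x where x: "x \<in> k_points V" "emeasure \<mu> {x} \<noteq> 0" using atom_exists by blast
  have one: "prob {x} = 1" by (rule full_atom[OF x])
  have xs: "{x} \<in> sets \<mu>" by (rule singleton_sets[OF x(1)])
  have AE_x: "AE y in \<mu>. y = x" using AE_in_set_eq_1[OF xs] one by simp
  have "\<phi> g x = x" if g: "g \<in> L" for g
  proof -
    have "prob {\<phi> g x} = 1" using measure_phi[OF g x(1)] one by simp
    then have "AE y in \<mu>. y = \<phi> g x"
      using AE_in_set_eq_1[OF singleton_sets[OF phi_closed[OF g x(1)]]] by simp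
    with AE_x have "AE y in \<mu>. \<phi> g x = x" by eventually_elim simp
    then show ?thesis by simp
  qed
  then have "x \<in> fixed_points L \<phi> (k_points V)" using x(1) by (simp add: fixed_points_def)
  moreover have "\<mu> = return (borel_measurable_space T) x"
  proof (rule measure_eqI)
    show "sets \<mu> = sets (return (borel_measurable_space T) x)" by (simp add: sets_mu)
    fix A assume A: "A \<in> sets \<mu>"
    have "emeasure \<mu> A = indicator A x"
    proof (cases "x \<in> A")
      case True
      from AE_x have "AE y in \<mu>. y \<in> A" by eventually_elim (use True in simp)
      then show ?thesis using True A by (simp add: emeasure_eq_1_AE)
    next
      case False
      from AE_x have "AE y in \<mu>. y \<notin> A" by eventually_elim (use False in simp)
      then show ?thesis using False A by (simp add: AE_iff_null_sets[symmetric] null_setsD1)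
    qed
    then show "emeasure \<mu> A = emeasure (return (borel_measurable_space T) x) A"
      using A by (simp add: sets_mu)
  qed
  ultimately show ?thesis by blast
qed

end

theorem corollary1p13:
  fixes v :: "'k::field \<Rightarrow> real"
    and \<G> :: "('g, 'k) atlas" and G :: "'g monoid"
    and V :: "('x, 'k) atlas" and \<phi> :: "'g \<Rightarrow> 'x \<Rightarrow> 'x"
    and L :: "'g set" and \<mu> :: "'x measure"
  assumes "complete_separable_valued_field v"
    and "k_algebraic_group \<G> G"
    and "k_variety V"
    and "k_action \<G> G V \<phi>"
    and "subgroup L (G\<lparr>carrier := k_points \<G>\<rparr>)" and "closedin (k_points_topology v \<G>) L"
    and "sets \<mu> = sets (borel_measurable_space (k_points_topology v V))"
    and "prob_space \<mu>"
    and "invariant_measure L \<phi> \<mu>"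
    and "weakly_mixing L \<phi> \<mu>"
  shows "\<exists>x \<in> fixed_points L \<phi> (k_points V).
           \<mu> = return (borel_measurable_space (k_points_topology v V)) x"
proof -
  interpret weakly_mixing_k_action v \<G> G V \<phi> L \<mu>
    using assms
    by (simp add: weakly_mixing_k_action_def weakly_mixing_k_action_axioms_def valued_def
      complete_separable_valued_field_def)
  show ?thesis by (rule dirac_at_fixed_point)
qed

end
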